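(* For a choice of parameters for which $U_k$ is defined, write $\xi_{\min}(U_k)$, $\xi_{\max}(U_k)$ for the smallest and largest roots of $U_k$, $\xi_-(U_k)$ for its largest negative root (if $k\ge 2$) and $\xi_+(U_k)$ for its smallest positive root. Define four numbers as follows. (1) $\mu_-^{LB}=\xi_{\min}(U_{N+1})$ with parameters $\gamma_E^{(m)}=\alpha_E^{(m)}$ for $m$ even, $\gamma_E^{(m)}=\beta_E^{(m)}$ for $m$ odd, and $\gamma_R^{(m)}=\beta_R^{(m)}$ for all $m$. (2) $\mu_-^{UB}=\max\{\xi_-(U_{2i}):\ 1\le 2i\le N+1\}$ with parameters $\gamma_E^{(m)}=\beta_E^{(m)}$, $\gamma_R^{(m)}=\beta_R^{(m)}$ for $m$ even and $\gamma_E^{(m)}=\alpha_E^{(m)}$, $\gamma_R^{(m)}=\alpha_R^{(m)}$ for $m$ odd. (3) $\mu_+^{LB}=\min\{\xi_+(U_{2i+1}):\ 0\le 2i\le N\}$ with parameters $\gamma_E^{(m)}=\alpha_E^{(m)}$, $\gamma_R^{(m)}=\alpha_R^{(m)}$ for $m$ even and $\gamma_E^{(m)}=\beta_E^{(m)}$, $\gamma_R^{(m)}=\beta_R^{(m)}$ for $m$ odd. (4) $\mu_+^{UB}=\xi_{\max}(U_{N+1})$ with parameters $\gamma_E^{(m)}=\beta_E^{(m)}$ for $m$ even, $\gamma_E^{(m)}=\alpha_E^{(m)}$ for $m$ odd, and $\gamma_R^{(m)}=\beta_R^{(m)}$ for all $m$. Then $\mu_-^{LB}$ is the minimum of $\xi_{\min}(U_{N+1})$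 over all admissible parameters, $\mu_-^{UB}$ is the maximum of $\xi_-(U_k)$ over all even $k$ with $2\le k\le N+1$ and all admissible parameters, $\mu_+^{LB}$ is the minimum of $\xi_+(U_k)$ over all odd $k$ with $1\le k\le N+1$ and all admissible parameters, $\mu_+^{UB}$ is the maximum of $\xi_{\max}(U_{N+1})$ over all admissible parameters, and every eigenvalue of $\mathcal{P}^{-1}\mathcal{A}$ lies in $[\mu_-^{LB},\mu_-^{UB}]\cup[\mu_+^{LB},\mu_+^{UB}]$.
   Context: Let $N\ge 1$ and let $n_0\ge n_1\ge\dots\ge n_N\ge 1$ be integers. Let $A_0\in\mathbb{R}^{n_0\times n_0}$ be symmetric positive definite, let $A_k\in\mathbb{R}^{n_k\times n_k}$ be symmetric positive semidefinite for $k=1,\dots,N$, and let $B_k\in\mathbb{R}^{n_k\times n_{k-1}}$ have full rank for $k=1,\dots,N$. Let $\mathcal{A}$ be the symmetric block tridiagonal matrix with diagonal blocks $A_0,-A_1,A_2,\dots,(-1)^NA_N$, with block subdiagonal $B_1,\dots,B_N$ and block superdiagonal $B_1^T,\dots,B_N^T$. Let $\widehat S_k\in\mathbb{R}^{n_k\times n_k}$, $k=0,\dots,N$, be symmetric positive definite matrices (regarded as approximations of $A_0$ for $k=0$ and of $\tilde S_k=A_k+B_k\widehat S_{k-1}^{-1}B_k^T$ for $k\ge1$), and let $\mathcal{P}=\mathrm{blkdiag}(\widehat S_0,\dots,\widehat S_N)$. Put $E_k=\widehat S_k^{-1/2}A_k\widehat S_k^{-1/2}$ for $k=0,\dots,N$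 and $R_k=\widehat S_k^{-1/2}B_k\widehat S_{k-1}^{-1/2}$ for $k=1,\dots,N$. Let $\alpha_E^{(k)},\beta_E^{(k)}$ be the smallest and largest eigenvalues of $E_k$ ($0\le k\le N$), and $\alpha_R^{(k)},\beta_R^{(k)}$ the smallest and largest eigenvalues of $R_kR_k^T$ ($1\le k\le N$). A parameter choice $\boldsymbol\gamma_E=(\gamma_E^{(0)},\dots,\gamma_E^{(N)})$, $\boldsymbol\gamma_R=(\gamma_R^{(1)},\dots,\gamma_R^{(N)})$ is called admissible if $\gamma_E^{(k)}\in[\alpha_E^{(k)},\beta_E^{(k)}]$ and $\gamma_R^{(k)}\in[\alpha_R^{(k)},\beta_R^{(k)}]$ for all $k$. For given parameters define polynomials in $\lambda$ by $U_0=1$, $U_1(\lambda)=\lambda-\gamma_E^{(0)}$ and $U_{k+1}(\lambda)=(\lambda+(-1)^{k+1}\gamma_E^{(k)})U_k(\lambda)-\gamma_R^{(k)}U_{k-1}(\lambda)$ for $1\le k\le N$. For admissible parameters all roots of $U_k$ ($1\le k\le N+1$) are real, simple and nonzero; $U_k$ has a positive root for every $k\ge1$ and a negative root for every $k\ge 2$. *)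

theory Defs
  imports
    "Jordan_Normal_Form.Spectral_Radius"
    "Jordan_Normal_Form.DL_Rank"
    "Jordan_Normal_Form.Gauss_Jordan_Elimination"
begin

text \<open>All block sizes vary with the block index, so matrices are those of \<open>Jordan_Normal_Form\<close>,
  which carry their dimensions as values.\<close>

definition spd_mat :: "nat \<Rightarrow> real mat \<Rightarrow> bool" where
  "spd_mat n M \<longleftrightarrow> M \<in> carrier_mat n n \<and> transpose_mat M = M \<and>
     (\<forall>v \<in> carrier_vec n. v \<noteq> 0\<^sub>v n \<longrightarrow> v \<bullet> (M *\<^sub>v v) > 0)"

definition spsd_mat :: "nat \<Rightarrow> real mat \<Rightarrow> bool" where
  "spsd_mat n M \<longleftrightarrow> M \<in> carrier_mat n n \<and> transpose_mat M = M \<and>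
     (\<forall>v \<in> carrier_vec n. v \<bullet> (M *\<^sub>v v) \<ge> 0)"

definition full_rank :: "nat \<Rightarrow> nat \<Rightarrow> real mat \<Rightarrow> bool" where
  "full_rank nr nc M \<longleftrightarrow> M \<in> carrier_mat nr nc \<and> vec_space.rank nr M = min nr nc"

text \<open>The inverse is only meaningful for invertible matrices, the square root only for symmetric
  positive definite ones.\<close>

definition mat_inv :: "real mat \<Rightarrow> real mat" where
  "mat_inv M = the (mat_inverse M)"

definition spd_sqrt :: "real mat \<Rightarrow> real mat" where
  "spd_sqrt M = (THE X. spd_mat (dim_row M) X \<and> X * X = M)"

definition inv_sqrt :: "real mat \<Rightarrow> real mat" where
  "inv_sqrt M = mat_inv (spd_sqrt M)"

text \<open>\<open>block_tridiag D L U N\<close> has diagonal blocks \<open>D 0, \<dots>, D N\<close>, subdiagonal blocks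
  \<open>L 1, \<dots>, L N\<close> (\<open>L k\<close> in block position \<open>(k, k - 1)\<close>) and superdiagonal blocks
  \<open>U 1, \<dots>, U N\<close> (\<open>U k\<close> in block position \<open>(k - 1, k)\<close>). It is built by bordering: the new
  last block row is \<open>(0 | L k | D k)\<close> and the new last block column has \<open>0\<close>, \<open>U k\<close>, \<open>D k\<close> from
  top to bottom, where the zero part covers all but the previous block.\<close>

fun block_tridiag ::
  "(nat \<Rightarrow> real mat) \<Rightarrow> (nat \<Rightarrow> real mat) \<Rightarrow> (nat \<Rightarrow> real mat) \<Rightarrow> nat \<Rightarrow> real mat" where
  "block_tridiag D L U 0 = D 0"
| "block_tridiag D L U (Suc k) =
     (let M = block_tridiag D L U k;
          p = dim_row M - dim_row (D k)
      in four_block_mat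
           M
           (0\<^sub>m p (dim_col (U (Suc k))) @\<^sub>r U (Suc k))
           (mat (dim_row (L (Suc k))) (dim_col M)
              (\<lambda>(i, j). if j < p then 0 else L (Suc k) $$ (i, j - p)))
           (D (Suc k)))"

definition saddle_mat :: "(nat \<Rightarrow> real mat) \<Rightarrow> (nat \<Rightarrow> real mat) \<Rightarrow> nat \<Rightarrow> real mat" where
  "saddle_mat A B N =
     block_tridiag (\<lambda>k. (- 1) ^ k \<cdot>\<^sub>m A k) B (\<lambda>k. transpose_mat (B k)) N"

definition precond_mat :: "(nat \<Rightarrow> real mat) \<Rightarrow> nat \<Rightarrow> real mat" where
  "precond_mat S N = diag_block_mat (map S [0..<Suc N])"

definition E_mat :: "(nat \<Rightarrow> real mat) \<Rightarrow> (nat \<Rightarrow> real mat) \<Rightarrow> nat \<Rightarrow> real mat" where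
  "E_mat A S k = inv_sqrt (S k) * A k * inv_sqrt (S k)"

definition R_mat :: "(nat \<Rightarrow> real mat) \<Rightarrow> (nat \<Rightarrow> real mat) \<Rightarrow> nat \<Rightarrow> real mat" where
  "R_mat B S k = inv_sqrt (S k) * B k * inv_sqrt (S (k - 1))"

definition \<alpha>E :: "(nat \<Rightarrow> real mat) \<Rightarrow> (nat \<Rightarrow> real mat) \<Rightarrow> nat \<Rightarrow> real" where
  "\<alpha>E A S k = Min (spectrum (E_mat A S k))"

definition \<beta>E :: "(nat \<Rightarrow> real mat) \<Rightarrow> (nat \<Rightarrow> real mat) \<Rightarrow> nat \<Rightarrow> real" where
  "\<beta>E A S k = Max (spectrum (E_mat A S k))"

definition \<alpha>R :: "(nat \<Rightarrow> real mat) \<Rightarrow> (nat \<Rightarrow> real mat) \<Rightarrow> nat \<Rightarrow> real" where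
  "\<alpha>R B S k = Min (spectrum (R_mat B S k * transpose_mat (R_mat B S k)))"

definition \<beta>R :: "(nat \<Rightarrow> real mat) \<Rightarrow> (nat \<Rightarrow> real mat) \<Rightarrow> nat \<Rightarrow> real" where
  "\<beta>R B S k = Max (spectrum (R_mat B S k * transpose_mat (R_mat B S k)))"

text \<open>Parameter tuples are functions on \<open>nat\<close>; only \<open>\<gamma>E 0, \<dots>, \<gamma>E N\<close> and
  \<open>\<gamma>R 1, \<dots>, \<gamma>R N\<close> are constrained, and only these enter \<open>U_poly \<gamma>E \<gamma>R k\<close> for
  \<open>k \<le> N + 1\<close>.\<close>

definition admissible_params ::
  "nat \<Rightarrow> (nat \<Rightarrow> real mat) \<Rightarrow> (nat \<Rightarrow> real mat) \<Rightarrow> (nat \<Rightarrow> real mat) \<Rightarrow>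
   (nat \<Rightarrow> real) \<Rightarrow> (nat \<Rightarrow> real) \<Rightarrow> bool" where
  "admissible_params N A B S \<gamma>E \<gamma>R \<longleftrightarrow>
     (\<forall>k \<in> {0..N}. \<gamma>E k \<in> {\<alpha>E A S k..\<beta>E A S k}) \<and>
     (\<forall>k \<in> {1..N}. \<gamma>R k \<in> {\<alpha>R B S k..\<beta>R B S k})"

fun U_poly :: "(nat \<Rightarrow> real) \<Rightarrow> (nat \<Rightarrow> real) \<Rightarrow> nat \<Rightarrow> real poly" where
  "U_poly \<gamma>E \<gamma>R 0 = 1"
| "U_poly \<gamma>E \<gamma>R (Suc 0) = [:- \<gamma>E 0, 1:]"
| "U_poly \<gamma>E \<gamma>R (Suc (Suc k)) =
     [:(- 1) ^ (k + 2) * \<gamma>E (k + 1), 1:] * U_poly \<gamma>E \<gamma>R (Suc k)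
     - Polynomial.smult (\<gamma>R (k + 1)) (U_poly \<gamma>E \<gamma>R k)"

definition \<xi>_min :: "real poly \<Rightarrow> real" where
  "\<xi>_min p = Min {x. poly p x = 0}"

definition \<xi>_max :: "real poly \<Rightarrow> real" where
  "\<xi>_max p = Max {x. poly p x = 0}"

definition \<xi>_neg :: "real poly \<Rightarrow> real" where
  "\<xi>_neg p = Max {x. poly p x = 0 \<and> x < 0}"

definition \<xi>_pos :: "real poly \<Rightarrow> real" where
  "\<xi>_pos p = Min {x. poly p x = 0 \<and> x > 0}"

definition \<mu>_neg_LB ::
  "nat \<Rightarrow> (nat \<Rightarrow> real mat) \<Rightarrow> (nat \<Rightarrow> real mat) \<Rightarrow> (nat \<Rightarrow> real mat) \<Rightarrow> real" where
  "\<mu>_neg_LB N A B S =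
     \<xi>_min (U_poly (\<lambda>m. if even m then \<alpha>E A S m else \<beta>E A S m) (\<beta>R B S) (N + 1))"

definition \<mu>_neg_UB ::
  "nat \<Rightarrow> (nat \<Rightarrow> real mat) \<Rightarrow> (nat \<Rightarrow> real mat) \<Rightarrow> (nat \<Rightarrow> real mat) \<Rightarrow> real" where
  "\<mu>_neg_UB N A B S =
     Max ((\<lambda>i. \<xi>_neg (U_poly (\<lambda>m. if even m then \<beta>E A S m else \<alpha>E A S m)
                              (\<lambda>m. if even m then \<beta>R B S m else \<alpha>R B S m) (2 * i)))
          ` {i. 1 \<le> 2 * i \<and> 2 * i \<le> N + 1})"

definition \<mu>_pos_LB ::
  "nat \<Rightarrow> (nat \<Rightarrow> real mat) \<Rightarrow> (nat \<Rightarrow> real mat) \<Rightarrow> (nat \<Rightarrow> real mat) \<Rightarrow> real" where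
  "\<mu>_pos_LB N A B S =
     Min ((\<lambda>i. \<xi>_pos (U_poly (\<lambda>m. if even m then \<alpha>E A S m else \<beta>E A S m)
                              (\<lambda>m. if even m then \<alpha>R B S m else \<beta>R B S m) (2 * i + 1)))
          ` {i. 0 \<le> 2 * i \<and> 2 * i \<le> N})"

definition \<mu>_pos_UB ::
  "nat \<Rightarrow> (nat \<Rightarrow> real mat) \<Rightarrow> (nat \<Rightarrow> real mat) \<Rightarrow> (nat \<Rightarrow> real mat) \<Rightarrow> real" where
  "\<mu>_pos_UB N A B S =
     \<xi>_max (U_poly (\<lambda>m. if even m then \<beta>E A S m else \<alpha>E A S m) (\<beta>R B S) (N + 1))"

text \<open>\<open>Min\<close> and \<open>Max\<close> are unspecified on infinite sets, hence these predicates for extrema over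
  all admissible parameters.\<close>

definition is_minimum :: "real \<Rightarrow> real set \<Rightarrow> bool" where
  "is_minimum m X \<longleftrightarrow> m \<in> X \<and> (\<forall>x \<in> X. m \<le> x)"

definition is_maximum :: "real \<Rightarrow> real set \<Rightarrow> bool" where
  "is_maximum m X \<longleftrightarrow> m \<in> X \<and> (\<forall>x \<in> X. x \<le> m)"

end

theory Submission
  imports Defs
begin

text \<open>
  Put \<open>d\<^sub>k = (- 1)^k \<gamma>\<^sub>E\<^sub>k\<close>. The ratios \<open>q\<^sub>k = U\<^sub>k\<^sub>+\<^sub>1(x) / U\<^sub>k(x)\<close> obey \<open>q\<^sub>0 = x - d\<^sub>0\<close> and
  \<open>q\<^sub>k = x - d\<^sub>k - \<gamma>\<^sub>R\<^sub>k / q\<^sub>k\<^sub>-\<^sub>1\<close>. Let \<open>H\<close> be the matrix that symmetric scaling by \<open>P\<^sup>-\<^sup>1\<^sup>/\<^sup>2\<close> makes of the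
  saddle point matrix; it is similar to the preconditioned matrix. Block elimination in \<open>x I - H\<close>
  produces Schur complements \<open>Q\<^sub>k = x I - D\<^sub>k - R\<^sub>k Q\<^sub>k\<^sub>-\<^sub>1\<^sup>-\<^sup>1 R\<^sub>k\<^sup>T\<close> with \<open>D\<^sub>k = (- 1)^k E\<^sub>k\<close>: the same
  recursion with matrices in place of numbers. One certificate controls both. A real \<open>x\<close> is
  separated by intervals \<open>C\<^sub>0, \<dots>, C\<^sub>N\<close> avoiding \<open>0\<close> if, with admissible parameters, the scalar
  recursion starts in \<open>C\<^sub>0\<close> and every step leads from \<open>C\<^sub>k\<^sub>-\<^sub>1\<close> into \<open>C\<^sub>k\<close>. Then no \<open>U\<^sub>k\<close> with admissible parameters
  vanishes at \<open>x\<close> (\<open>separating_imp_nonroot\<close>). And the spectrum of \<open>Q\<^sub>k\<close> stays inside \<open>C\<^sub>k\<close>,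
  because an eigenvalue of \<open>Q\<^sub>k\<close> is one scalar step applied to Rayleigh quotients; so all \<open>Q\<^sub>k\<close> are
  invertible and \<open>x\<close> is not an eigenvalue (\<open>schur_spectrum\<close>, \<open>trivial_solution\<close>).

  It remains to separate every \<open>x\<close> outside the two claimed intervals; the extremality
  statements follow from the same certificates, since a root of an admissible polynomial is never
  separated. One endpoint of \<open>C\<^sub>k\<close> is the ratio \<open>t\<^sub>k\<close> for the extremal parameters of the respective
  region. As \<open>x - d - r / q\<close> is monotone in \<open>d\<close>, in \<open>r\<close> and, on each side of \<open>0\<close>, in \<open>q\<close>, the
  extremal parameters are dictated by the signs of the \<open>q\<^sub>k\<close>: all negative below the spectrum, all
  positive above it, alternating in the gap around \<open>0\<close>. In the gap, for \<open>x \<le> 0\<close> the ratios with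
  even index are negative as soon as their predecessors are positive, so only lower bounds have to
  be propagated and the only threat is a polynomial of even degree losing its sign; for \<open>x \<ge> 0\<close> the
  roles are exchanged (\<open>separating_gap_left\<close>, \<open>separating_gap_right\<close>).

  The signs of the extremal ratios follow from the positivity of the Wronskian of
  \<open>U\<^sub>k\<close> and \<open>U\<^sub>k\<^sub>+\<^sub>1\<close>, which makes \<open>q\<^sub>k\<close> an increasing function of \<open>x\<close> between its poles; together with
  the known signs at \<open>0\<close> and at infinity this also gives the existence of the roots involved.
  On the matrix side the ingredients are the extremal property of Rayleigh quotients and the
  existence and uniqueness of positive definite square roots.
\<close>

section \<open>Three-term recurrences\<close>

text \<open>The characteristic polynomials of a Jacobi matrix with diagonal \<open>d\<close> and squared off-diagonal
  entries \<open>r\<close>. Leaving the diagonal arbitrary makes the class closed under the reflection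
  \<open>x \<mapsto> - x\<close>, so each statement about the left half line has a mirror image.\<close>
fun jacobi_poly :: "(nat \<Rightarrow> real) \<Rightarrow> (nat \<Rightarrow> real) \<Rightarrow> nat \<Rightarrow> real poly" where
  "jacobi_poly d r 0 = 1"
| "jacobi_poly d r (Suc 0) = [:- d 0, 1:]"
| "jacobi_poly d r (Suc (Suc k)) =
     [:- d (Suc k), 1:] * jacobi_poly d r (Suc k) - Polynomial.smult (r (Suc k)) (jacobi_poly d r k)"

lemma U_poly_eq_jacobi_poly:
  "U_poly \<gamma>E \<gamma>R k = jacobi_poly (\<lambda>k. (- 1) ^ k * \<gamma>E k) \<gamma>R k"
  by (induction k rule: induct_nat_012) simp_all

declare jacobi_poly.simps(3) [simp del]

lemma poly_jacobi_poly_Suc_Suc: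
  "poly (jacobi_poly d r (Suc (Suc k))) x =
     (x - d (Suc k)) * poly (jacobi_poly d r (Suc k)) x - r (Suc k) * poly (jacobi_poly d r k) x"
  by (simp add: jacobi_poly.simps(3) algebra_simps)

lemma monic_jacobi_poly: "degree (jacobi_poly d r k) = k \<and> lead_coeff (jacobi_poly d r k) = 1"
proof (induction k rule: induct_nat_012)
  case (ge2 k)
  let ?p = "[:- d (Suc k), 1:] * jacobi_poly d r (Suc k)"
  let ?q = "- Polynomial.smult (r (Suc k)) (jacobi_poly d r k)"
  note jacobi_poly.simps(3) [simp]
  have ne: "jacobi_poly d r (Suc k) \<noteq> 0"
    using ge2(2) by auto
  have p: "degree ?p = Suc (Suc k)"
    using ge2(2) ne by (subst degree_mult_eq) auto
  have lp: "lead_coeff ?p = 1"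
    using conjunct2[OF ge2(2)] by (simp only: lead_coeff_mult) simp
  have q: "degree ?q < degree ?p"
    using ge2(1) degree_smult_le[of "r (Suc k)" "jacobi_poly d r k"] by (simp only: p degree_minus)
  have "jacobi_poly d r (Suc (Suc k)) = ?q + ?p" by simp
  then show ?case
    using degree_add_eq_right[OF q] lead_coeff_add_le[OF q] p lp by metis
qed simp_all

lemma jacobi_poly_nonzero: "jacobi_poly d r k \<noteq> 0"
  using monic_jacobi_poly[of d r k] by auto

lemma finite_jacobi_roots: "finite {x. poly (jacobi_poly d r k) x = 0}"
  by (rule poly_roots_finite[OF jacobi_poly_nonzero])

lemma jacobi_poly_reflect:
  "poly (jacobi_poly (\<lambda>k. - d k) r k) (- x) = (- 1) ^ k * poly (jacobi_poly d r k) x"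
  by (induction k rule: induct_nat_012) (simp_all add: poly_jacobi_poly_Suc_Suc algebra_simps)

definition jacobi_ratio :: "(nat \<Rightarrow> real) \<Rightarrow> (nat \<Rightarrow> real) \<Rightarrow> nat \<Rightarrow> real \<Rightarrow> real" where
  "jacobi_ratio d r k x = poly (jacobi_poly d r (Suc k)) x / poly (jacobi_poly d r k) x"

lemma jacobi_ratio_reflect:
  "jacobi_ratio (\<lambda>k. - d k) r k (- x) = - jacobi_ratio d r k x"
  by (simp add: jacobi_ratio_def jacobi_poly_reflect)

lemma jacobi_ratio_0: "jacobi_ratio d r 0 x = x - d 0"
  by (simp add: jacobi_ratio_def)

lemma jacobi_ratio_Suc:
  assumes "poly (jacobi_poly d r (Suc k)) x \<noteq> 0"
  shows "jacobi_ratio d r (Suc k) x = x - d (Suc k) - r (Suc k) / jacobi_ratio d r k x"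
  using assms by (simp add: jacobi_ratio_def poly_jacobi_poly_Suc_Suc field_simps)

text \<open>The recurrence gives \<open>W\<^sub>k = p\<^sub>k\<^sup>2 + r\<^sub>k W\<^sub>k\<^sub>-\<^sub>1\<close> for these Wronskians, a sum of
  nonnegative terms that is positive because \<open>W\<^sub>0 = 1\<close>.\<close>
lemma jacobi_wronskian_pos:
  assumes "\<And>j. 1 \<le> j \<Longrightarrow> j \<le> k \<Longrightarrow> r j > 0"
  shows "poly (pderiv (jacobi_poly d r (Suc k))) x * poly (jacobi_poly d r k) x
         - poly (jacobi_poly d r (Suc k)) x * poly (pderiv (jacobi_poly d r k)) x > 0"
  using assms
proof (induction k)
  case 0
  show ?case by (simp add: pderiv_pCons)
next
  case (Suc k)
  let ?u = "poly (jacobi_poly d r k) x" and ?v = "poly (jacobi_poly d r (Suc k)) x"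
  let ?u' = "poly (pderiv (jacobi_poly d r k)) x" and ?v' = "poly (pderiv (jacobi_poly d r (Suc k))) x"
  have W: "?v' * ?u - ?v * ?u' > 0"
    by (rule Suc.IH) (use Suc.prems in auto)
  have D: "poly (pderiv (jacobi_poly d r (Suc (Suc k)))) x = ?v + (x - d (Suc k)) * ?v' - r (Suc k) * ?u'"
    unfolding jacobi_poly.simps pderiv_diff pderiv_mult pderiv_smult pderiv_pCons
    by (simp add: algebra_simps)
  have "poly (pderiv (jacobi_poly d r (Suc (Suc k)))) x * ?v
      - poly (jacobi_poly d r (Suc (Suc k))) x * ?v' = ?v\<^sup>2 + r (Suc k) * (?v' * ?u - ?v * ?u')"
    unfolding D poly_jacobi_poly_Suc_Suc by (simp add: algebra_simps power2_eq_square)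
  moreover have "r (Suc k) * (?v' * ?u - ?v * ?u') > 0"
    using W Suc.prems[of "Suc k"] by simp
  ultimately show ?case
    by (smt (verit) zero_le_power2)
qed

lemma jacobi_ratio_mono:
  assumes "\<And>j. 1 \<le> j \<Longrightarrow> j \<le> k \<Longrightarrow> r j > 0" and "x \<le> y"
    and nz: "\<And>z. x \<le> z \<Longrightarrow> z \<le> y \<Longrightarrow> poly (jacobi_poly d r k) z \<noteq> 0"
  shows "jacobi_ratio d r k x \<le> jacobi_ratio d r k y"
proof (rule DERIV_nonneg_imp_nondecreasing[OF \<open>x \<le> y\<close>])
  fix z assume z: "x \<le> z" "z \<le> y"
  let ?p = "jacobi_poly d r k" and ?q = "jacobi_poly d r (Suc k)"
  have "(jacobi_ratio d r k has_real_derivative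
      (poly (pderiv ?q) z * poly ?p z - poly ?q z * poly (pderiv ?p) z) / (poly ?p z * poly ?p z)) (at z)"
    unfolding jacobi_ratio_def[abs_def]
    by (rule DERIV_divide[OF poly_DERIV poly_DERIV nz[OF z]])
  moreover have "(poly (pderiv ?q) z * poly ?p z - poly ?q z * poly (pderiv ?p) z) / (poly ?p z * poly ?p z) \<ge> 0"
    using jacobi_wronskian_pos[of k r d z] assms(1) by (intro divide_nonneg_nonneg) auto
  ultimately show "\<exists>D. (jacobi_ratio d r k has_real_derivative D) (at z) \<and> 0 \<le> D" by blast
qed

lemma poly_constant_sign:
  fixes p :: "real poly"
  assumes "\<And>z. a \<le> z \<Longrightarrow> z \<le> b \<Longrightarrow> poly p z \<noteq> 0" and "a \<le> x" "x \<le> b" "a \<le> y" "y \<le> b"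
  shows "poly p x * poly p y > 0"
proof (rule ccontr)
  assume neg: "\<not> poly p x * poly p y > 0"
  have "poly p x \<noteq> 0" "poly p y \<noteq> 0" using assms by auto
  with neg have n: "poly p x * poly p y < 0" by (metis linorder_neqE_linordered_idom mult_eq_0_iff)
  then have "x \<noteq> y" by (metis not_square_less_zero)
  then consider "x < y" | "y < x" by linarith
  then show False
  proof cases
    case 1
    from poly_IVT[OF 1 n] obtain z where "x < z" "z < y" "poly p z = 0" by blast
    then show False using assms(1)[of z] assms(2-5) by simp
  next
    case 2
    from poly_IVT[OF 2, of p] n obtain z where "y < z" "z < x" "poly p z = 0" by (auto simp: mult.commute)
    then show False using assms(1)[of z] assms(2-5) by simp
  qed
qed

text \<open>Far to the left all ratios are at most \<open>- 1\<close>, a bound that reproduces itself through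
  the recursion for the ratios.\<close>
lemma jacobi_sign_at_minus_infinity:
  assumes "\<And>j. 1 \<le> j \<Longrightarrow> j < K \<Longrightarrow> r j > 0"
  shows "\<exists>b. \<forall>x \<le> b. \<forall>j \<le> K. (- 1) ^ j * poly (jacobi_poly d r j) x > 0"
proof -
  have "\<exists>b. \<forall>x \<le> b. (\<forall>j \<le> K. (- 1) ^ j * poly (jacobi_poly d r j) x > 0) \<and>
          (K > 0 \<longrightarrow> jacobi_ratio d r (K - 1) x \<le> - 1)"
    using assms
  proof (induction K)
    case 0
    then show ?case by simp
  next
    case (Suc K)
    then obtain b where b: "\<And>x. x \<le> b \<Longrightarrow> (\<forall>j \<le> K. (- 1) ^ j * poly (jacobi_poly d r j) x > 0)"
      "\<And>x. x \<le> b \<Longrightarrow> K > 0 \<Longrightarrow> jacobi_ratio d r (K - 1) x \<le> - 1"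
      by auto
    \<comment> \<open>The bound \<open>- 1\<close> on the previous ratio costs at most \<open>\<bar>r K\<bar>\<close> in the next step.\<close>
    define c where "c = min b (d K - \<bar>r K\<bar> - 1)"
    have rat: "jacobi_ratio d r K x \<le> - 1" if x: "x \<le> c" for x
    proof (cases K)
      case 0
      then show ?thesis using x abs_ge_zero[of "r 0"] unfolding c_def 0 jacobi_ratio_0 by linarith
    next
      case (Suc k)
      have q: "jacobi_ratio d r k x \<le> - 1" using b(2)[of x] x Suc by (simp add: c_def)
      have rp: "r K > 0" using Suc.prems[of K] Suc by simp
      have "poly (jacobi_poly d r K) x \<noteq> 0" using b(1)[of x] x by (force simp: c_def)
      then have eq: "jacobi_ratio d r K x = x - d K - r K / jacobi_ratio d r k x"
        using jacobi_ratio_Suc Suc by simp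
      have "- (r K / jacobi_ratio d r k x) \<le> r K"
      proof -
        have "r K * (- jacobi_ratio d r k x) \<ge> r K * 1" using q rp by (intro mult_left_mono) auto
        then show ?thesis using q rp by (simp add: field_simps)
      qed
      then show ?thesis using x rp unfolding eq c_def by linarith
    qed
    have "(- 1) ^ Suc K * poly (jacobi_poly d r (Suc K)) x > 0" if x: "x \<le> c" for x
    proof -
      have p: "(- 1) ^ K * poly (jacobi_poly d r K) x > 0" using b(1)[of x] x by (simp add: c_def)
      then have "poly (jacobi_poly d r K) x \<noteq> 0" by auto
      then have "(- 1) ^ Suc K * poly (jacobi_poly d r (Suc K)) x =
          - jacobi_ratio d r K x * ((- 1) ^ K * poly (jacobi_poly d r K) x)"
        by (simp add: jacobi_ratio_def)
      also have "\<dots> > 0" using rat[OF x] by (intro mult_pos_pos[OF _ p]) auto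
      finally show ?thesis .
    qed
    then show ?case
      using b(1) rat by (intro exI[of _ c]) (auto simp: le_Suc_eq c_def)
  qed
  then show ?thesis by blast
qed

text \<open>Interlacing at the left end: at the least root of \<open>p\<^sub>K\<close> the recurrence leaves
  \<open>p\<^sub>K\<^sub>+\<^sub>1 = - r\<^sub>K p\<^sub>K\<^sub>-\<^sub>1\<close>, whose sign is opposite to that of \<open>p\<^sub>K\<^sub>+\<^sub>1\<close> at minus infinity.
  Hence \<open>p\<^sub>K\<^sub>+\<^sub>1\<close> has a smaller root, and left of its least one all signs are those at minus infinity.\<close>
lemma jacobi_least_root:
  assumes "\<And>j. 1 \<le> j \<Longrightarrow> j < K \<Longrightarrow> r j > 0" and "K \<ge> 1"
  shows "\<exists>m. poly (jacobi_poly d r K) m = 0 \<and>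
             (\<forall>x < m. \<forall>j \<le> K. (- 1) ^ j * poly (jacobi_poly d r j) x > 0)"
proof -
  have "\<exists>m. poly (jacobi_poly d r K) m = 0 \<and> (- 1) ^ (K - 1) * poly (jacobi_poly d r (K - 1)) m > 0 \<and>
             (\<forall>x < m. \<forall>j \<le> K. (- 1) ^ j * poly (jacobi_poly d r j) x > 0)"
    using assms(2,1)
  proof (induction K rule: dec_induct)
    case base
    show ?case by (intro exI[of _ "d 0"]) (auto simp: le_Suc_eq)
  next
    case (step K)
    then obtain m where m: "poly (jacobi_poly d r K) m = 0"
      "(- 1) ^ (K - 1) * poly (jacobi_poly d r (K - 1)) m > 0"
      "\<And>x j. x < m \<Longrightarrow> j \<le> K \<Longrightarrow> (- 1) ^ j * poly (jacobi_poly d r j) x > 0" by auto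
    obtain k where k: "K = Suc k" using step.hyps by (cases K) auto
    let ?p = "jacobi_poly d r (Suc K)"
    have "poly ?p m = - r K * poly (jacobi_poly d r k) m"
      using m(1) unfolding k poly_jacobi_poly_Suc_Suc by simp
    then have "(- 1) ^ Suc K * poly ?p m = - (r K * ((- 1) ^ k * poly (jacobi_poly d r k) m))"
      unfolding k by simp
    moreover have "r K > 0" using step.prems[of K] step.hyps by simp
    ultimately have pm: "(- 1) ^ Suc K * poly ?p m < 0" using m(2) k by simp
    obtain b where b: "\<And>x j. x \<le> b \<Longrightarrow> j \<le> Suc K \<Longrightarrow> (- 1) ^ j * poly (jacobi_poly d r j) x > 0"
      using jacobi_sign_at_minus_infinity[of "Suc K" r d] step.prems by auto
    have neg_inf: "(- 1) ^ Suc K * poly ?p x > 0" if "x \<le> b" for x using b[of x "Suc K"] that by blast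
    have "b < m" using neg_inf[of m] pm by linarith
    have "(- 1) ^ Suc K * poly ?p b * ((- 1) ^ Suc K * poly ?p m) < 0"
      by (rule mult_pos_neg[OF neg_inf[OF order_refl] pm])
    then have "poly ?p b * poly ?p m < 0"
      by (cases "even K") auto
    from poly_IVT[OF \<open>b < m\<close> this] obtain z where z: "b < z" "z < m" "poly ?p z = 0" by blast
    define m' where "m' = Min {x. poly ?p x = 0}"
    have fin: "finite {x. poly ?p x = 0}" by (rule finite_jacobi_roots)
    have root: "poly ?p m' = 0" using Min_in[OF fin] z unfolding m'_def by blast
    have least: "m' \<le> x" if "poly ?p x = 0" for x
      using Min_le[OF fin] that unfolding m'_def by blast
    have "m' < m" using least[OF z(3)] z(2) by simp
    have sgn: "(- 1) ^ Suc K * poly ?p x > 0" if x: "x < m'" for x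
    proof -
      have "poly ?p x * poly ?p (min x b) > 0"
        by (rule poly_constant_sign[of "min x b" x]) (use least x in force)+
      moreover have "(- 1) ^ Suc K * poly ?p (min x b) > 0" by (rule neg_inf) simp
      ultimately show ?thesis
        by (cases "even K") (auto simp: zero_less_mult_iff)
    qed
    show ?case
    proof (intro exI[of _ m'] conjI allI impI)
      show "0 < (- 1) ^ (Suc K - 1) * poly (jacobi_poly d r (Suc K - 1)) m'"
        using m(3)[OF \<open>m' < m\<close>, of K] by simp
      fix x j assume "x < m'" "j \<le> Suc K"
      then show "0 < (- 1) ^ j * poly (jacobi_poly d r j) x"
        using m(3)[of x j] sgn[of x] \<open>m' < m\<close> by (cases "j = Suc K") auto
    qed (rule root)
  qed
  then show ?thesis by blast
qed

lemma jacobi_greatest_root: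
  assumes "\<And>j. 1 \<le> j \<Longrightarrow> j < K \<Longrightarrow> r j > 0" and "K \<ge> 1"
  shows "\<exists>m. poly (jacobi_poly d r K) m = 0 \<and> (\<forall>x > m. \<forall>j \<le> K. poly (jacobi_poly d r j) x > 0)"
proof -
  obtain m where m: "poly (jacobi_poly (\<lambda>k. - d k) r K) m = 0"
    "\<And>x j. x < m \<Longrightarrow> j \<le> K \<Longrightarrow> (- 1) ^ j * poly (jacobi_poly (\<lambda>k. - d k) r j) x > 0"
    using jacobi_least_root[of K r "\<lambda>k. - d k"] assms by auto
  have "poly (jacobi_poly d r K) (- m) = 0"
    using m(1) jacobi_poly_reflect[of d r K "- m"] by simp
  moreover have "poly (jacobi_poly d r j) x > 0" if "x > - m" "j \<le> K" for x j
    using m(2)[of "- x" j] that by (simp add: jacobi_poly_reflect mult.assoc[symmetric] flip: power_mult_distrib)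
  ultimately show ?thesis by blast
qed

text \<open>If \<open>p\<^sub>k\<^sub>+\<^sub>1\<close> had no negative root, then \<open>p\<^sub>k / p\<^sub>k\<^sub>+\<^sub>1\<close> would be decreasing on the
  nonpositive half line and therefore positive on all of it, although the two polynomials have
  opposite signs at minus infinity.\<close>
lemma jacobi_negative_root:
  assumes r: "\<And>j. 1 \<le> j \<Longrightarrow> j \<le> k \<Longrightarrow> r j > 0" and pos: "jacobi_ratio d r k 0 > 0"
  shows "\<exists>x < 0. poly (jacobi_poly d r (Suc k)) x = 0"
proof (rule ccontr)
  assume "\<not> ?thesis"
  then have nz: "poly (jacobi_poly d r (Suc k)) x \<noteq> 0" if "x < 0" for x using that by blast
  let ?p = "jacobi_poly d r k" and ?q = "jacobi_poly d r (Suc k)"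
  have q0: "poly ?q 0 \<noteq> 0" and p0: "poly ?p 0 \<noteq> 0" using pos unfolding jacobi_ratio_def by auto
  obtain m where m: "\<And>x j. x < m \<Longrightarrow> j \<le> Suc k \<Longrightarrow> (- 1) ^ j * poly (jacobi_poly d r j) x > 0"
    using jacobi_least_root[of "Suc k" r d] r by fastforce
  \<comment> \<open>A negative point to the left of all roots, where the signs are those at minus infinity.\<close>
  define x where "x = min m 0 - 1"
  have "x < m" "x < 0" unfolding x_def by auto
  let ?g = "\<lambda>z. poly ?p z / poly ?q z"
  have "?g 0 \<le> ?g x"
  proof (rule DERIV_nonpos_imp_nonincreasing[of x 0 ?g])
    fix z assume z: "x \<le> z" "z \<le> 0"
    have "poly ?q z \<noteq> 0" using z nz[of z] q0 by (cases "z = 0") auto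
    then have "(?g has_real_derivative
      (poly (pderiv ?p) z * poly ?q z - poly ?p z * poly (pderiv ?q) z) / (poly ?q z * poly ?q z)) (at z)"
      by (rule DERIV_divide[OF poly_DERIV poly_DERIV])
    moreover have "(poly (pderiv ?p) z * poly ?q z - poly ?p z * poly (pderiv ?q) z) / (poly ?q z * poly ?q z) \<le> 0"
      using jacobi_wronskian_pos[of k r d z] r by (intro divide_nonpos_nonneg) (auto simp: mult.commute)
    ultimately show "\<exists>D. (?g has_real_derivative D) (at z) \<and> D \<le> 0" by blast
  qed (use \<open>x < 0\<close> in simp)
  moreover have "?g 0 > 0" using pos unfolding jacobi_ratio_def by (auto simp add: zero_less_divide_iff)
  ultimately have "?g x > 0" by linarith
  moreover have "(- 1) ^ k * poly ?p x > 0" "(- 1) ^ Suc k * poly ?q x > 0"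
    using m[OF \<open>x < m\<close>, of k] m[OF \<open>x < m\<close>, of "Suc k"] by simp_all
  ultimately show False
    by (cases "even k") (auto simp: zero_less_divide_iff)
qed

lemma jacobi_positive_root:
  assumes r: "\<And>j. 1 \<le> j \<Longrightarrow> j \<le> k \<Longrightarrow> r j > 0" and "jacobi_ratio d r k 0 < 0"
  shows "\<exists>x > 0. poly (jacobi_poly d r (Suc k)) x = 0"
proof -
  have "jacobi_ratio (\<lambda>k. - d k) r k 0 > 0"
    using jacobi_ratio_reflect[of d r k 0] assms(2) by simp
  from jacobi_negative_root[of k r "\<lambda>k. - d k", OF r this]
  obtain x where "x < 0" "poly (jacobi_poly (\<lambda>k. - d k) r (Suc k)) x = 0" by blast
  then show ?thesis
    using jacobi_poly_reflect[of d r "Suc k" "- x"] by (intro exI[of _ "- x"]) simp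
qed

text \<open>While \<open>p\<^sub>k\<close> keeps its sign to the left of \<open>0\<close>, monotonicity keeps a negative ratio
  negative. This transfers the absence of roots from \<open>p\<^sub>k\<close> to \<open>p\<^sub>k\<^sub>+\<^sub>1\<close>.\<close>
lemma jacobi_sign_left_of_0:
  assumes r: "\<And>j. 1 \<le> j \<Longrightarrow> j \<le> k \<Longrightarrow> r j > 0" and "x \<le> 0"
    and nz: "\<And>z. x \<le> z \<Longrightarrow> z \<le> 0 \<Longrightarrow> poly (jacobi_poly d r k) z \<noteq> 0"
    and neg: "jacobi_ratio d r k 0 < 0"
  shows "poly (jacobi_poly d r (Suc k)) x * poly (jacobi_poly d r (Suc k)) 0 > 0"
proof -
  have "jacobi_ratio d r k x < 0" using jacobi_ratio_mono[OF r \<open>x \<le> 0\<close> nz] neg by force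
  moreover have "poly (jacobi_poly d r k) x * poly (jacobi_poly d r k) 0 > 0"
    by (rule poly_constant_sign[of x 0]) (use nz \<open>x \<le> 0\<close> in auto)
  ultimately have "(jacobi_ratio d r k x * jacobi_ratio d r k 0) *
      (poly (jacobi_poly d r k) x * poly (jacobi_poly d r k) 0) > 0"
    using neg by (metis mult_neg_neg mult_pos_pos)
  moreover have "poly (jacobi_poly d r k) x \<noteq> 0" "poly (jacobi_poly d r k) 0 \<noteq> 0"
    using nz \<open>x \<le> 0\<close> by auto
  ultimately show ?thesis unfolding jacobi_ratio_def by simp
qed

lemma jacobi_sign_right_of_0:
  assumes r: "\<And>j. 1 \<le> j \<Longrightarrow> j \<le> k \<Longrightarrow> r j > 0" and "x \<ge> 0"
    and nz: "\<And>z. 0 \<le> z \<Longrightarrow> z \<le> x \<Longrightarrow> poly (jacobi_poly d r k) z \<noteq> 0"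
    and pos: "jacobi_ratio d r k 0 > 0"
  shows "poly (jacobi_poly d r (Suc k)) x * poly (jacobi_poly d r (Suc k)) 0 > 0"
proof -
  have "jacobi_ratio d r k x > 0" using jacobi_ratio_mono[OF r \<open>x \<ge> 0\<close> nz] pos by force
  moreover have "poly (jacobi_poly d r k) x * poly (jacobi_poly d r k) 0 > 0"
    by (rule poly_constant_sign[of 0 x]) (use nz \<open>x \<ge> 0\<close> in auto)
  ultimately have "(jacobi_ratio d r k x * jacobi_ratio d r k 0) *
      (poly (jacobi_poly d r k) x * poly (jacobi_poly d r k) 0) > 0"
    using pos by (metis mult_pos_pos)
  moreover have "poly (jacobi_poly d r k) x \<noteq> 0" "poly (jacobi_poly d r k) 0 \<noteq> 0"
    using nz \<open>x \<ge> 0\<close> by auto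
  ultimately show ?thesis unfolding jacobi_ratio_def by simp
qed

section \<open>Separating intervals and extremal parameters\<close>

text \<open>The certificate that \<open>x\<close> is neither a root of an admissible polynomial nor an eigenvalue.
  The inclusion \<open>{p..q} \<subseteq> C k\<close> says that \<open>C k\<close> is an interval; this convexity is what lets
  \<open>C k\<close> capture Rayleigh quotients once it contains the eigenvalues.\<close>
definition separating ::
  "nat \<Rightarrow> (nat \<Rightarrow> real) \<Rightarrow> (nat \<Rightarrow> real) \<Rightarrow> (nat \<Rightarrow> real) \<Rightarrow> (nat \<Rightarrow> real) \<Rightarrow> real \<Rightarrow> (nat \<Rightarrow> real set) \<Rightarrow> bool" where
  "separating N aE bE aR bR x C \<longleftrightarrow>
     (\<forall>k \<le> N. 0 \<notin> C k \<and> (\<forall>p \<in> C k. \<forall>q \<in> C k. {p..q} \<subseteq> C k)) \<and>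
     (\<forall>g \<in> {aE 0..bE 0}. x - g \<in> C 0) \<and>
     (\<forall>k < N. \<forall>q \<in> C k. \<forall>g \<in> {aE (Suc k)..bE (Suc k)}. \<forall>r \<in> {aR (Suc k)..bR (Suc k)}.
        x - (- 1) ^ Suc k * g - r / q \<in> C (Suc k))"

lemma separating_imp_nonroot:
  assumes sep: "separating N aE bE aR bR x C"
    and g: "\<forall>k \<in> {0..N}. g k \<in> {aE k..bE k}" and r: "\<forall>k \<in> {1..N}. r k \<in> {aR k..bR k}"
    and "k \<le> N + 1"
  shows "poly (jacobi_poly (\<lambda>k. (- 1) ^ k * g k) r k) x \<noteq> 0"
proof -
  let ?d = "\<lambda>k. (- 1) ^ k * g k"
  have main: "poly (jacobi_poly ?d r k) x \<noteq> 0 \<and> jacobi_ratio ?d r k x \<in> C k" if "k \<le> N" for k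
    using that
  proof (induction k)
    case 0
    then show ?case using sep g unfolding separating_def jacobi_ratio_0 by auto
  next
    case (Suc k)
    then have IH: "poly (jacobi_poly ?d r k) x \<noteq> 0" "jacobi_ratio ?d r k x \<in> C k" by auto
    have "jacobi_ratio ?d r k x \<noteq> 0" using IH(2) sep Suc.prems unfolding separating_def by (metis Suc_leD)
    then have nz: "poly (jacobi_poly ?d r (Suc k)) x \<noteq> 0" unfolding jacobi_ratio_def by auto
    have "x - (- 1) ^ Suc k * g (Suc k) - r (Suc k) / jacobi_ratio ?d r k x \<in> C (Suc k)"
      using sep IH(2) g r Suc.prems unfolding separating_def by auto
    then show ?case using nz jacobi_ratio_Suc[OF nz] by simp
  qed
  show ?thesis
  proof (cases "k \<le> N")
    case False
    then have k: "k = Suc N" using \<open>k \<le> N + 1\<close> by simp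
    have "jacobi_ratio ?d r N x \<noteq> 0"
      using main[of N] sep unfolding separating_def by (metis order_refl)
    then show ?thesis unfolding k jacobi_ratio_def by auto
  qed (use main in blast)
qed

lemma Min_eq_least:
  fixes A :: "'a :: linorder set"
  assumes "finite A" "m \<in> A" "\<And>x. x < m \<Longrightarrow> x \<notin> A"
  shows "Min A = m"
  using assms by (intro Min_eqI) (auto simp: not_less[symmetric])

lemma Max_eq_greatest:
  fixes A :: "'a :: linorder set"
  assumes "finite A" "m \<in> A" "\<And>x. x > m \<Longrightarrow> x \<notin> A"
  shows "Max A = m"
  using assms by (intro Max_eqI) (auto simp: not_less[symmetric])

lemma jacobi_below_\<xi>_min:
  assumes r: "\<And>j. 1 \<le> j \<Longrightarrow> j < K \<Longrightarrow> r j > 0" and K: "K \<ge> 1"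
  shows "poly (jacobi_poly d r K) (\<xi>_min (jacobi_poly d r K)) = 0"
    and "x < \<xi>_min (jacobi_poly d r K) \<Longrightarrow> j \<le> K \<Longrightarrow> (- 1) ^ j * poly (jacobi_poly d r j) x > 0"
proof -
  obtain m where m: "poly (jacobi_poly d r K) m = 0"
    "\<And>x j. x < m \<Longrightarrow> j \<le> K \<Longrightarrow> (- 1) ^ j * poly (jacobi_poly d r j) x > 0"
    using jacobi_least_root[of K r d, OF r K] by auto
  have nz: "poly (jacobi_poly d r K) x \<noteq> 0" if "x < m" for x
    using m(2)[OF that order_refl] by auto
  have "\<xi>_min (jacobi_poly d r K) = m"
    unfolding \<xi>_min_def by (rule Min_eq_least[OF finite_jacobi_roots]) (use m(1) nz in auto)
  then show "poly (jacobi_poly d r K) (\<xi>_min (jacobi_poly d r K)) = 0"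
    and "x < \<xi>_min (jacobi_poly d r K) \<Longrightarrow> j \<le> K \<Longrightarrow> (- 1) ^ j * poly (jacobi_poly d r j) x > 0"
    using m by simp_all
qed

lemma jacobi_above_\<xi>_max:
  assumes r: "\<And>j. 1 \<le> j \<Longrightarrow> j < K \<Longrightarrow> r j > 0" and K: "K \<ge> 1"
  shows "poly (jacobi_poly d r K) (\<xi>_max (jacobi_poly d r K)) = 0"
    and "x > \<xi>_max (jacobi_poly d r K) \<Longrightarrow> j \<le> K \<Longrightarrow> poly (jacobi_poly d r j) x > 0"
proof -
  obtain m where m: "poly (jacobi_poly d r K) m = 0"
    "\<And>x j. x > m \<Longrightarrow> j \<le> K \<Longrightarrow> poly (jacobi_poly d r j) x > 0"
    using jacobi_greatest_root[of K r d, OF r K] by auto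
  have nz: "poly (jacobi_poly d r K) x \<noteq> 0" if "x > m" for x
    using m(2)[OF that order_refl] by auto
  have "\<xi>_max (jacobi_poly d r K) = m"
    unfolding \<xi>_max_def by (rule Max_eq_greatest[OF finite_jacobi_roots]) (use m(1) nz in auto)
  then show "poly (jacobi_poly d r K) (\<xi>_max (jacobi_poly d r K)) = 0"
    and "x > \<xi>_max (jacobi_poly d r K) \<Longrightarrow> j \<le> K \<Longrightarrow> poly (jacobi_poly d r j) x > 0"
    using m by simp_all
qed

text \<open>The bounds on the parameters, detached from the matrices they come from.\<close>
locale parameter_box =
  fixes N :: nat and aE bE aR bR :: "nat \<Rightarrow> real"
  assumes aE_0: "aE 0 > 0" and aE_nonneg: "k \<le> N \<Longrightarrow> aE k \<ge> 0"
    and aE_le_bE: "k \<le> N \<Longrightarrow> aE k \<le> bE k"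
    and aR_pos: "1 \<le> k \<Longrightarrow> k \<le> N \<Longrightarrow> aR k > 0"
    and aR_le_bR: "1 \<le> k \<Longrightarrow> k \<le> N \<Longrightarrow> aR k \<le> bR k"
begin

definition admissible :: "(nat \<Rightarrow> real) \<Rightarrow> (nat \<Rightarrow> real) \<Rightarrow> bool" where
  "admissible g r \<longleftrightarrow> (\<forall>k \<in> {0..N}. g k \<in> {aE k..bE k}) \<and> (\<forall>k \<in> {1..N}. r k \<in> {aR k..bR k})"

abbreviation U :: "(nat \<Rightarrow> real) \<Rightarrow> (nat \<Rightarrow> real) \<Rightarrow> nat \<Rightarrow> real poly" where
  "U g r \<equiv> jacobi_poly (\<lambda>k. (- 1) ^ k * g k) r"

abbreviation ratio :: "(nat \<Rightarrow> real) \<Rightarrow> (nat \<Rightarrow> real) \<Rightarrow> nat \<Rightarrow> real \<Rightarrow> real" where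
  "ratio g r \<equiv> jacobi_ratio (\<lambda>k. (- 1) ^ k * g k) r"

lemma admissible_pos:
  assumes "admissible g r"
  shows "g 0 > 0" and "k \<le> N \<Longrightarrow> g k \<ge> 0" and "1 \<le> k \<Longrightarrow> k \<le> N \<Longrightarrow> r k > 0"
proof -
  have "aE 0 \<le> g 0" using assms unfolding admissible_def by simp
  then show "g 0 > 0" using aE_0 by linarith
  show "g k \<ge> 0" if "k \<le> N"
    using assms[unfolded admissible_def, THEN conjunct1, THEN bspec, of k] aE_nonneg[OF that] that by simp
  show "r k > 0" if "1 \<le> k" "k \<le> N"
    using assms[unfolded admissible_def, THEN conjunct2, THEN bspec, of k] aR_pos[OF that] that by simp
qed

text \<open>At \<open>0\<close> the two terms of the recursion for the ratios have the same sign, so the ratios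
  alternate in sign whatever the parameters.\<close>
lemma ratio_sign_at_0:
  assumes "admissible g r" "k \<le> N"
  shows "poly (U g r k) 0 \<noteq> 0 \<and> (if even k then ratio g r k 0 < 0 else ratio g r k 0 > 0)"
  using assms(2)
proof (induction k)
  case 0
  then show ?case using admissible_pos(1)[OF assms(1)] by (simp add: jacobi_ratio_0)
next
  case (Suc k)
  then have IH: "poly (U g r k) 0 \<noteq> 0" "if even k then ratio g r k 0 < 0 else ratio g r k 0 > 0" by auto
  then have nz: "poly (U g r (Suc k)) 0 \<noteq> 0" unfolding jacobi_ratio_def by (auto split: if_splits)
  have "g (Suc k) \<ge> 0" "r (Suc k) > 0" using admissible_pos[OF assms(1)] Suc.prems by auto
  moreover have "ratio g r (Suc k) 0 = - ((- 1) ^ Suc k * g (Suc k)) - r (Suc k) / ratio g r k 0"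
    using jacobi_ratio_Suc[OF nz] by simp
  moreover have "even k \<Longrightarrow> r (Suc k) / ratio g r k 0 < 0" "odd k \<Longrightarrow> r (Suc k) / ratio g r k 0 > 0"
    using IH(2) \<open>r (Suc k) > 0\<close> by (simp_all add: divide_less_0_iff)
  ultimately have "if even (Suc k) then ratio g r (Suc k) 0 < 0 else ratio g r (Suc k) 0 > 0"
    by (cases "even k") simp_all
  then show ?case using nz by blast
qed

lemma U_at_0_nonzero:
  assumes "admissible g r" "k \<le> N + 1"
  shows "poly (U g r k) 0 \<noteq> 0"
proof (cases k)
  case (Suc j)
  then have "ratio g r j 0 \<noteq> 0" using ratio_sign_at_0[OF assms(1), of j] assms(2) by (cases "even j") simp_all
  then show ?thesis unfolding jacobi_ratio_def Suc by simp
qed simp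

lemma \<xi>_neg_root:
  assumes a: "admissible g r" and k: "even k" "2 \<le> k" "k \<le> N + 1"
  shows "poly (U g r k) (\<xi>_neg (U g r k)) = 0" "\<xi>_neg (U g r k) < 0"
    and "poly (U g r k) z = 0 \<Longrightarrow> z < 0 \<Longrightarrow> z \<le> \<xi>_neg (U g r k)"
proof -
  obtain j where j: "k = Suc j" using k(2) by (cases k) auto
  have "ratio g r j 0 > 0" using ratio_sign_at_0[OF a, of j] k unfolding j by simp
  moreover have "r i > 0" if "1 \<le> i" "i \<le> j" for i
    using admissible_pos(3)[OF a, of i] that k j by simp
  ultimately obtain x where "x < 0" "poly (U g r k) x = 0"
    unfolding j using jacobi_negative_root[of j r] by blast
  then have ne: "{x. poly (U g r k) x = 0 \<and> x < 0} \<noteq> {}" by blast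
  have fin: "finite {x. poly (U g r k) x = 0 \<and> x < 0}"
    by (rule finite_subset[OF _ finite_jacobi_roots]) blast
  show "poly (U g r k) (\<xi>_neg (U g r k)) = 0" "\<xi>_neg (U g r k) < 0"
    using Max_in[OF fin ne] unfolding \<xi>_neg_def by auto
  show "poly (U g r k) z = 0 \<Longrightarrow> z < 0 \<Longrightarrow> z \<le> \<xi>_neg (U g r k)"
    unfolding \<xi>_neg_def by (rule Max_ge[OF fin]) blast
qed

lemma \<xi>_pos_root:
  assumes a: "admissible g r" and k: "odd k" "k \<le> N + 1"
  shows "poly (U g r k) (\<xi>_pos (U g r k)) = 0" "\<xi>_pos (U g r k) > 0"
    and "poly (U g r k) z = 0 \<Longrightarrow> z > 0 \<Longrightarrow> \<xi>_pos (U g r k) \<le> z"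
proof -
  obtain j where j: "k = Suc j" using k(1) by (cases k) auto
  have "ratio g r j 0 < 0" using ratio_sign_at_0[OF a, of j] k unfolding j by simp
  moreover have "r i > 0" if "1 \<le> i" "i \<le> j" for i
    using admissible_pos(3)[OF a, of i] that k j by simp
  ultimately obtain x where "x > 0" "poly (U g r k) x = 0"
    unfolding j using jacobi_positive_root[of j r] by blast
  then have ne: "{x. poly (U g r k) x = 0 \<and> x > 0} \<noteq> {}" by blast
  have fin: "finite {x. poly (U g r k) x = 0 \<and> x > 0}"
    by (rule finite_subset[OF _ finite_jacobi_roots]) blast
  show "poly (U g r k) (\<xi>_pos (U g r k)) = 0" "\<xi>_pos (U g r k) > 0"
    using Min_in[OF fin ne] unfolding \<xi>_pos_def by auto
  show "poly (U g r k) z = 0 \<Longrightarrow> z > 0 \<Longrightarrow> \<xi>_pos (U g r k) \<le> z"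
    unfolding \<xi>_pos_def by (rule Min_le[OF fin]) blast
qed

text \<open>Polynomials of odd degree need no condition of their own: the preceding ratio has even
  index, is negative at \<open>0\<close> and stays negative to the left of \<open>0\<close>.\<close>
lemma gap_sign_left:
  assumes a: "admissible g r" and "x \<le> 0"
    and gap: "\<And>k. even k \<Longrightarrow> 2 \<le> k \<Longrightarrow> k \<le> N + 1 \<Longrightarrow> x > \<xi>_neg (U g r k)"
    and k: "k \<le> N + 1"
  shows "poly (U g r k) x * poly (U g r k) 0 > 0"
proof -
  have nz: "poly (U g r j) z \<noteq> 0" if "even j" "j \<le> N + 1" "x \<le> z" "z \<le> 0" for j z
  proof (cases "j = 0 \<or> z = 0")
    case True
    then show ?thesis using U_at_0_nonzero[OF a \<open>j \<le> N + 1\<close>] by auto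
  next
    case False
    then have "z < 0" "j \<noteq> 0" using that by auto
    with \<open>even j\<close> have "2 \<le> j" by presburger
    then show ?thesis
      using \<xi>_neg_root(3)[OF a \<open>even j\<close> _ that(2), of z] gap[OF \<open>even j\<close> _ that(2)] that(3) \<open>z < 0\<close>
      by linarith
  qed
  show ?thesis
  proof (cases "even k")
    case True
    then show ?thesis using nz[OF True k] \<open>x \<le> 0\<close> by (intro poly_constant_sign[of x 0]) auto
  next
    case False
    then obtain j where j: "k = Suc j" "even j" by (cases k) auto
    show ?thesis unfolding j(1)
      using ratio_sign_at_0[OF a, of j] nz[OF \<open>even j\<close>] k j admissible_pos(3)[OF a] \<open>x \<le> 0\<close>
      by (intro jacobi_sign_left_of_0) auto
  qed
qed

lemma gap_sign_right:
  assumes a: "admissible g r" and "x \<ge> 0"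
    and gap: "\<And>k. odd k \<Longrightarrow> k \<le> N + 1 \<Longrightarrow> x < \<xi>_pos (U g r k)"
    and k: "k \<le> N + 1"
  shows "poly (U g r k) x * poly (U g r k) 0 > 0"
proof -
  have nz: "poly (U g r j) z \<noteq> 0" if "odd j" "j \<le> N + 1" "0 \<le> z" "z \<le> x" for j z
  proof (cases "z = 0")
    case True
    then show ?thesis using U_at_0_nonzero[OF a \<open>j \<le> N + 1\<close>] by auto
  next
    case False
    then have "z > 0" using that by simp
    then show ?thesis using \<xi>_pos_root(3)[OF a that(1,2), of z] gap[OF that(1,2)] that(4) by linarith
  qed
  show ?thesis
  proof (cases "odd k")
    case True
    then show ?thesis using nz[OF True k] \<open>x \<ge> 0\<close> by (intro poly_constant_sign[of 0 x]) auto
  next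
    case False
    show ?thesis
    proof (cases k)
      case 0
      then show ?thesis by simp
    next
      case (Suc j)
      with False have "odd j" by simp
      show ?thesis unfolding Suc
        using ratio_sign_at_0[OF a, of j] nz[OF \<open>odd j\<close>] k Suc \<open>odd j\<close> admissible_pos(3)[OF a] \<open>x \<ge> 0\<close>
        by (intro jacobi_sign_right_of_0) auto
    qed
  qed
qed

lemma gap_ratio_sign:
  assumes a: "admissible g r" and k: "k \<le> N"
    and pos: "\<And>k. k \<le> N + 1 \<Longrightarrow> poly (U g r k) x * poly (U g r k) 0 > 0"
  shows "if even k then ratio g r k x < 0 else ratio g r k x > 0"
proof -
  have "poly (U g r k) x * poly (U g r k) 0 > 0" "poly (U g r (Suc k)) x * poly (U g r (Suc k)) 0 > 0"
    using pos[of k] pos[of "Suc k"] k by simp_all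
  then have "ratio g r k x * ratio g r k 0 > 0"
    unfolding jacobi_ratio_def times_divide_times_eq by (rule divide_pos_pos[rotated])
  then show ?thesis
    using ratio_sign_at_0[OF a k] by (cases "even k") (simp_all add: zero_less_mult_iff)
qed

text \<open>\<open>gE_up\<close> maximizes and \<open>gE_lo\<close> minimizes every signed diagonal entry \<open>(- 1)^m g m\<close>.
  In the gap the ratio with index \<open>m - 1\<close> is positive for even \<open>m\<close> and negative for odd \<open>m\<close>, so
  \<open>gR_up\<close> maximizes and \<open>gR_lo\<close> minimizes the subtracted term \<open>r m / q\<close>.\<close>
definition "gE_up m = (if even m then bE m else aE m)"
definition "gE_lo m = (if even m then aE m else bE m)"
definition "gR_up m = (if even m then bR m else aR m)"
definition "gR_lo m = (if even m then aR m else bR m)"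

lemma admissible_extremal:
  "admissible gE_lo bR" "admissible gE_up bR" "admissible gE_up gR_up" "admissible gE_lo gR_lo"
  using aE_le_bE aR_le_bR unfolding admissible_def gE_up_def gE_lo_def gR_up_def gR_lo_def by auto

text \<open>All ratios are negative here, so \<open>- r / q\<close> is positive and largest for the largest \<open>r\<close> and
  the largest \<open>q\<close>: upper bounds propagate.\<close>
lemma separating_below:
  assumes x: "x < \<xi>_min (U gE_lo bR (N + 1))"
  shows "\<exists>C. separating N aE bE aR bR x C"
proof -
  let ?t = "\<lambda>k. ratio gE_lo bR k x"
  note adm = admissible_extremal(1)
  have sgn: "(- 1) ^ k * poly (U gE_lo bR k) x > 0" if "k \<le> N + 1" for k
    by (rule jacobi_below_\<xi>_min(2)[OF _ _ x that]) (use admissible_pos(3)[OF adm] in auto)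
  have nz: "poly (U gE_lo bR k) x \<noteq> 0" if "k \<le> N + 1" for k using sgn[OF that] by auto
  have t: "?t k < 0" if "k \<le> N" for k
    using sgn[of k] sgn[of "Suc k"] that unfolding jacobi_ratio_def
    by (cases "even k") (auto simp: divide_less_0_iff)
  have "separating N aE bE aR bR x (\<lambda>k. {..?t k})"
    unfolding separating_def
  proof (intro conjI allI impI ballI)
    fix k assume "k \<le> N" then show "0 \<notin> {..?t k}" using t by force
  next
    fix g assume "g \<in> {aE 0..bE 0}"
    then show "x - g \<in> {..?t 0}" by (simp add: jacobi_ratio_0 gE_lo_def)
  next
    fix k q g r assume k: "k < N" and q: "q \<in> {..?t k}"
      and g: "g \<in> {aE (Suc k)..bE (Suc k)}" and r: "r \<in> {aR (Suc k)..bR (Suc k)}"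
    have tk: "?t k < 0" using t k by simp
    have rp: "r > 0" using r aR_pos[of "Suc k"] k by auto
    have "r / (- q) \<le> bR (Suc k) / (- ?t k)"
      using q r tk rp by (intro frac_le) auto
    moreover have "(- 1) ^ Suc k * gE_lo (Suc k) \<le> (- 1) ^ Suc k * g"
      using g by (auto simp: gE_lo_def)
    moreover have "?t (Suc k) = x - (- 1) ^ Suc k * gE_lo (Suc k) - bR (Suc k) / ?t k"
      by (rule jacobi_ratio_Suc[OF nz]) (use k in simp)
    ultimately show "x - (- 1) ^ Suc k * g - r / q \<in> {..?t (Suc k)}" by simp
  qed auto
  then show ?thesis by blast
qed

lemma separating_above:
  assumes x: "x > \<xi>_max (U gE_up bR (N + 1))"
  shows "\<exists>C. separating N aE bE aR bR x C"
proof -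
  let ?t = "\<lambda>k. ratio gE_up bR k x"
  note adm = admissible_extremal(2)
  have sgn: "poly (U gE_up bR k) x > 0" if "k \<le> N + 1" for k
    by (rule jacobi_above_\<xi>_max(2)[OF _ _ x that]) (use admissible_pos(3)[OF adm] in auto)
  have nz: "poly (U gE_up bR k) x \<noteq> 0" if "k \<le> N + 1" for k using sgn[OF that] by auto
  have t: "?t k > 0" if "k \<le> N" for k
    using sgn[of k] sgn[of "Suc k"] that unfolding jacobi_ratio_def by simp
  have "separating N aE bE aR bR x (\<lambda>k. {?t k..})"
    unfolding separating_def
  proof (intro conjI allI impI ballI)
    fix k assume "k \<le> N" then show "0 \<notin> {?t k..}" using t by force
  next
    fix g assume "g \<in> {aE 0..bE 0}"
    then show "x - g \<in> {?t 0..}" by (simp add: jacobi_ratio_0 gE_up_def)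
  next
    fix k q g r assume k: "k < N" and q: "q \<in> {?t k..}"
      and g: "g \<in> {aE (Suc k)..bE (Suc k)}" and r: "r \<in> {aR (Suc k)..bR (Suc k)}"
    have tk: "?t k > 0" using t k by simp
    have rp: "r > 0" using r aR_pos[of "Suc k"] k by auto
    have "r / q \<le> bR (Suc k) / ?t k"
      using q r tk rp by (intro frac_le) auto
    moreover have "(- 1) ^ Suc k * gE_up (Suc k) \<ge> (- 1) ^ Suc k * g"
      using g by (auto simp: gE_up_def)
    moreover have "?t (Suc k) = x - (- 1) ^ Suc k * gE_up (Suc k) - bR (Suc k) / ?t k"
      by (rule jacobi_ratio_Suc[OF nz]) (use k in simp)
    ultimately show "x - (- 1) ^ Suc k * g - r / q \<in> {?t (Suc k)..}" by simp
  qed auto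
  then show ?thesis by blast
qed

text \<open>Only the lower bounds \<open>t\<^sub>k\<close> are propagated. The upper bound \<open>0\<close> for even indices holds
  because \<open>x\<close>, \<open>- g\<close> and \<open>- r / q\<close> are all nonpositive and the last one is negative; at index \<open>0\<close>
  it is the positivity of \<open>g\<close> that excludes \<open>0\<close>.\<close>
lemma separating_gap_left:
  assumes "x \<le> 0" and gap: "\<And>k. even k \<Longrightarrow> 2 \<le> k \<Longrightarrow> k \<le> N + 1 \<Longrightarrow> x > \<xi>_neg (U gE_up gR_up k)"
  shows "\<exists>C. separating N aE bE aR bR x C"
proof -
  let ?t = "\<lambda>k. ratio gE_up gR_up k x"
  let ?C = "\<lambda>k. if even k then {?t k..<0} else {?t k..}"
  note adm = admissible_extremal(3)
  note sgn = gap_sign_left[OF adm \<open>x \<le> 0\<close> gap]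
  have nz: "poly (U gE_up gR_up k) x \<noteq> 0" if "k \<le> N + 1" for k using sgn[OF _ _ _ that] by auto
  have t: "if even k then ?t k < 0 else ?t k > 0" if "k \<le> N" for k
    by (rule gap_ratio_sign[OF adm that]) (rule sgn)
  have "separating N aE bE aR bR x ?C"
    unfolding separating_def
  proof (intro conjI allI impI ballI)
    fix k assume "k \<le> N" then show "0 \<notin> ?C k" using t[of k] by auto
  next
    fix g assume "g \<in> {aE 0..bE 0}"
    then show "x - g \<in> ?C 0" using \<open>x \<le> 0\<close> aE_0 by (simp add: jacobi_ratio_0 gE_up_def)
  next
    fix k q g r assume k: "k < N" and q: "q \<in> ?C k"
      and g: "g \<in> {aE (Suc k)..bE (Suc k)}" and r: "r \<in> {aR (Suc k)..bR (Suc k)}"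
    have rp: "aR (Suc k) > 0" "r > 0" "g \<ge> 0"
      using g r aR_pos[of "Suc k"] aE_nonneg[of "Suc k"] k by auto
    have eq: "?t (Suc k) = x - (- 1) ^ Suc k * gE_up (Suc k) - gR_up (Suc k) / ?t k"
      by (rule jacobi_ratio_Suc[OF nz]) (use k in simp)
    show "x - (- 1) ^ Suc k * g - r / q \<in> ?C (Suc k)"
    proof (cases "even k")
      case True
      then have tk: "?t k < 0" using t[of k] k by simp
      have "aR (Suc k) / (- ?t k) \<le> r / (- q)"
        using q r tk rp True by (intro frac_le) auto
      then show ?thesis using g eq True by (simp add: gE_up_def gR_up_def)
    next
      case False
      then have tk: "?t k > 0" using t[of k] k by simp
      have "r / q \<le> bR (Suc k) / ?t k"
        using q r tk rp False by (intro frac_le) auto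
      moreover have "r / q > 0" using q tk rp False by (intro divide_pos_pos) auto
      ultimately show ?thesis using g eq False \<open>x \<le> 0\<close> rp by (simp add: gE_up_def gR_up_def)
    qed
  qed (auto split: if_splits)
  then show ?thesis by blast
qed

lemma separating_gap_right:
  assumes "x \<ge> 0" and gap: "\<And>k. odd k \<Longrightarrow> k \<le> N + 1 \<Longrightarrow> x < \<xi>_pos (U gE_lo gR_lo k)"
  shows "\<exists>C. separating N aE bE aR bR x C"
proof -
  let ?t = "\<lambda>k. ratio gE_lo gR_lo k x"
  let ?C = "\<lambda>k. if even k then {..?t k} else {0<..?t k}"
  note adm = admissible_extremal(4)
  note sgn = gap_sign_right[OF adm \<open>x \<ge> 0\<close> gap]
  have nz: "poly (U gE_lo gR_lo k) x \<noteq> 0" if "k \<le> N + 1" for k using sgn[OF _ _ that] by auto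
  have t: "if even k then ?t k < 0 else ?t k > 0" if "k \<le> N" for k
    by (rule gap_ratio_sign[OF adm that]) (rule sgn)
  have "separating N aE bE aR bR x ?C"
    unfolding separating_def
  proof (intro conjI allI impI ballI)
    fix k assume "k \<le> N" then show "0 \<notin> ?C k" using t[of k] by auto
  next
    fix g assume "g \<in> {aE 0..bE 0}"
    then show "x - g \<in> ?C 0" by (simp add: jacobi_ratio_0 gE_lo_def)
  next
    fix k q g r assume k: "k < N" and q: "q \<in> ?C k"
      and g: "g \<in> {aE (Suc k)..bE (Suc k)}" and r: "r \<in> {aR (Suc k)..bR (Suc k)}"
    have rp: "aR (Suc k) > 0" "r > 0" "g \<ge> 0"
      using g r aR_pos[of "Suc k"] aE_nonneg[of "Suc k"] k by auto
    have eq: "?t (Suc k) = x - (- 1) ^ Suc k * gE_lo (Suc k) - gR_lo (Suc k) / ?t k"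
      by (rule jacobi_ratio_Suc[OF nz]) (use k in simp)
    show "x - (- 1) ^ Suc k * g - r / q \<in> ?C (Suc k)"
    proof (cases "even k")
      case True
      then have tk: "?t k < 0" using t[of k] k by simp
      have "r / (- q) \<le> bR (Suc k) / (- ?t k)"
        using q r tk rp True by (intro frac_le) auto
      moreover have "r / (- q) > 0" using q tk rp True by (intro divide_pos_pos) auto
      ultimately show ?thesis using g eq True \<open>x \<ge> 0\<close> rp by (simp add: gE_lo_def gR_lo_def)
    next
      case False
      then have tk: "?t k > 0" using t[of k] k by simp
      have "aR (Suc k) / ?t k \<le> r / q"
        using q r tk rp False by (intro frac_le) auto
      then show ?thesis using g eq False by (simp add: gE_lo_def gR_lo_def)
    qed
  qed (auto split: if_splits)
  then show ?thesis by blast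
qed

text \<open>The value is attained because the extremal parameters are themselves admissible; it is a
  bound because a smaller root would be separated. The three lemmas on the other extrema follow the
  same pattern.\<close>
lemma \<xi>_min_minimum:
  "is_minimum (\<xi>_min (U gE_lo bR (N + 1))) {\<xi>_min (U g r (N + 1)) | g r. admissible g r}"
  unfolding is_minimum_def
proof (intro conjI ballI)
  fix y assume "y \<in> {\<xi>_min (U g r (N + 1)) | g r. admissible g r}"
  then obtain g r where a: "admissible g r" and y: "y = \<xi>_min (U g r (N + 1))" by blast
  have "poly (U g r (N + 1)) y = 0"
    unfolding y by (rule jacobi_below_\<xi>_min(1)) (use admissible_pos(3)[OF a] in auto)
  then show "\<xi>_min (U gE_lo bR (N + 1)) \<le> y"
    using separating_below[of y] separating_imp_nonroot[of N aE bE aR bR y _ g r "N + 1"] a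
    unfolding admissible_def by force
qed (use admissible_extremal(1) in blast)

lemma \<xi>_max_maximum:
  "is_maximum (\<xi>_max (U gE_up bR (N + 1))) {\<xi>_max (U g r (N + 1)) | g r. admissible g r}"
  unfolding is_maximum_def
proof (intro conjI ballI)
  fix y assume "y \<in> {\<xi>_max (U g r (N + 1)) | g r. admissible g r}"
  then obtain g r where a: "admissible g r" and y: "y = \<xi>_max (U g r (N + 1))" by blast
  have "poly (U g r (N + 1)) y = 0"
    unfolding y by (rule jacobi_above_\<xi>_max(1)) (use admissible_pos(3)[OF a] in auto)
  then show "y \<le> \<xi>_max (U gE_up bR (N + 1))"
    using separating_above[of y] separating_imp_nonroot[of N aE bE aR bR y _ g r "N + 1"] a
    unfolding admissible_def by force
qed (use admissible_extremal(2) in blast)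

abbreviation "gap_left \<equiv> Max ((\<lambda>i. \<xi>_neg (U gE_up gR_up (2 * i))) ` {i. 1 \<le> 2 * i \<and> 2 * i \<le> N + 1})"
abbreviation "gap_right \<equiv> Min ((\<lambda>i. \<xi>_pos (U gE_lo gR_lo (2 * i + 1))) ` {i. 0 \<le> 2 * i \<and> 2 * i \<le> N})"

lemma gap_left_ge:
  assumes "even k" "2 \<le> k" "k \<le> N + 1"
  shows "\<xi>_neg (U gE_up gR_up k) \<le> gap_left"
proof -
  have "finite {i. 1 \<le> 2 * i \<and> 2 * i \<le> N + 1}" by (rule finite_subset[of _ "{..N + 1}"]) auto
  moreover obtain i where "k = 2 * i" using assms(1) by (elim evenE)
  ultimately show ?thesis using assms(2,3) by (intro Max_ge) auto
qed

lemma gap_right_le: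
  assumes "odd k" "k \<le> N + 1"
  shows "gap_right \<le> \<xi>_pos (U gE_lo gR_lo k)"
proof -
  have "finite {i. 0 \<le> 2 * i \<and> 2 * i \<le> N}" by (rule finite_subset[of _ "{..N}"]) auto
  moreover obtain i where "k = 2 * i + 1" using assms(1) by (elim oddE)
  ultimately show ?thesis using assms(2) by (intro Min_le) auto
qed

lemma separating_left_gap:
  assumes "x \<le> 0" "gap_left < x"
  shows "\<exists>C. separating N aE bE aR bR x C"
  using separating_gap_left[OF assms(1)] gap_left_ge assms(2) by (meson le_less_trans)

lemma separating_right_gap:
  assumes "x \<ge> 0" "x < gap_right"
  shows "\<exists>C. separating N aE bE aR bR x C"
  using separating_gap_right[OF assms(1)] gap_right_le assms(2) by (meson less_le_trans)

lemma \<xi>_neg_maximum: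
  assumes "N \<ge> 1"
  shows "is_maximum gap_left
    {\<xi>_neg (U g r k) | k g r. even k \<and> 2 \<le> k \<and> k \<le> N + 1 \<and> admissible g r}"
  unfolding is_maximum_def
proof (intro conjI ballI)
  let ?I = "{i. 1 \<le> 2 * i \<and> 2 * i \<le> N + 1}"
  have "finite ?I" by (rule finite_subset[of _ "{..N + 1}"]) auto
  moreover have "1 \<in> ?I" using assms by simp
  ultimately have "gap_left \<in> (\<lambda>i. \<xi>_neg (U gE_up gR_up (2 * i))) ` ?I" by (intro Max_in) auto
  then obtain i where i: "1 \<le> 2 * i" "2 * i \<le> N + 1" "gap_left = \<xi>_neg (U gE_up gR_up (2 * i))" by blast
  have "even (2 * i)" "2 \<le> 2 * i" using i(1) by simp_all
  then show "gap_left \<in> {\<xi>_neg (U g r k) | k g r. even k \<and> 2 \<le> k \<and> k \<le> N + 1 \<and> admissible g r}"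
    using i(2,3) admissible_extremal(3) by blast
next
  fix y assume "y \<in> {\<xi>_neg (U g r k) | k g r. even k \<and> 2 \<le> k \<and> k \<le> N + 1 \<and> admissible g r}"
  then obtain k g r where k: "even k" "2 \<le> k" "k \<le> N + 1" and a: "admissible g r"
    and y: "y = \<xi>_neg (U g r k)" by blast
  have root: "poly (U g r k) y = 0" "y < 0" using \<xi>_neg_root(1,2)[OF a k] by (simp_all add: y)
  show "y \<le> gap_left"
  proof (rule ccontr)
    assume "\<not> y \<le> gap_left"
    then obtain C where "separating N aE bE aR bR y C" using separating_left_gap[of y] root(2) by auto
    from separating_imp_nonroot[OF this _ _ k(3), of g r] show False
      using a root(1) unfolding admissible_def by blast
  qed
qed

lemma \<xi>_pos_minimum:
  "is_minimum gap_right
    {\<xi>_pos (U g r k) | k g r. odd k \<and> 1 \<le> k \<and> k \<le> N + 1 \<and> admissible g r}"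
  unfolding is_minimum_def
proof (intro conjI ballI)
  let ?I = "{i. 0 \<le> 2 * i \<and> 2 * i \<le> N}"
  have "finite ?I" by (rule finite_subset[of _ "{..N}"]) auto
  moreover have "0 \<in> ?I" by simp
  ultimately have "gap_right \<in> (\<lambda>i. \<xi>_pos (U gE_lo gR_lo (2 * i + 1))) ` ?I" by (intro Min_in) blast+
  then obtain i where i: "2 * i \<le> N" "gap_right = \<xi>_pos (U gE_lo gR_lo (2 * i + 1))" by blast
  have "odd (2 * i + 1)" "1 \<le> 2 * i + 1" "2 * i + 1 \<le> N + 1" using i(1) by simp_all
  then show "gap_right \<in> {\<xi>_pos (U g r k) | k g r. odd k \<and> 1 \<le> k \<and> k \<le> N + 1 \<and> admissible g r}"
    using i(2) admissible_extremal(4) by blast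
next
  fix y assume "y \<in> {\<xi>_pos (U g r k) | k g r. odd k \<and> 1 \<le> k \<and> k \<le> N + 1 \<and> admissible g r}"
  then obtain k g r where k: "odd k" "k \<le> N + 1" and a: "admissible g r"
    and y: "y = \<xi>_pos (U g r k)" by blast
  have root: "poly (U g r k) y = 0" "y > 0" using \<xi>_pos_root(1,2)[OF a k] by (simp_all add: y)
  show "gap_right \<le> y"
  proof (rule ccontr)
    assume "\<not> gap_right \<le> y"
    then obtain C where "separating N aE bE aR bR y C" using separating_right_gap[of y] root(2) by auto
    from separating_imp_nonroot[OF this _ _ k(2), of g r] show False
      using a root(1) unfolding admissible_def by blast
  qed
qed

lemma nonseparating_bounds:
  assumes "\<nexists>C. separating N aE bE aR bR x C"
  shows "x \<in> {\<xi>_min (U gE_lo bR (N + 1))..gap_left} \<union> {gap_right..\<xi>_max (U gE_up bR (N + 1))}"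
proof -
  have "\<xi>_min (U gE_lo bR (N + 1)) \<le> x" "x \<le> \<xi>_max (U gE_up bR (N + 1))"
    using separating_below[of x] separating_above[of x] assms by (meson not_le)+
  moreover have "x \<le> gap_left \<or> gap_right \<le> x"
    using separating_left_gap[of x] separating_right_gap[of x] assms by (meson linear not_le)
  ultimately show ?thesis by auto
qed

end

section \<open>Rayleigh quotients of real symmetric matrices\<close>

definition symmetric_mat :: "nat \<Rightarrow> real mat \<Rightarrow> bool" where
  "symmetric_mat n M \<longleftrightarrow> M \<in> carrier_mat n n \<and> transpose_mat M = M"

lemma symmetric_matD:
  assumes "symmetric_mat n M"
  shows "M \<in> carrier_mat n n" "transpose_mat M = M"
  using assms by (auto simp: symmetric_mat_def)

lemma scalar_prod_self_nonneg: "(v :: real vec) \<bullet> v \<ge> 0"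
  unfolding scalar_prod_def by (intro sum_nonneg) auto

lemma scalar_prod_self_eq_0:
  assumes "(v :: real vec) \<in> carrier_vec n"
  shows "v \<bullet> v = 0 \<longleftrightarrow> v = 0\<^sub>v n"
proof
  assume "v \<bullet> v = 0"
  then have "\<forall>i \<in> {0..<dim_vec v}. v $ i * v $ i = 0"
    unfolding scalar_prod_def by (subst (asm) sum_nonneg_eq_0_iff) auto
  then show "v = 0\<^sub>v n" using assms by (intro eq_vecI) auto
qed (use assms in auto)

lemma scalar_prod_self_pos:
  assumes "(v :: real vec) \<in> carrier_vec n" "v \<noteq> 0\<^sub>v n"
  shows "v \<bullet> v > 0"
  using scalar_prod_self_eq_0[OF assms(1)] scalar_prod_self_nonneg[of v] assms(2) by linarith

lemma scalar_prod_mult_mat_vec: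
  fixes M :: "real mat"
  assumes "M \<in> carrier_mat nr nc" "x \<in> carrier_vec nr" "y \<in> carrier_vec nc"
  shows "x \<bullet> (M *\<^sub>v y) = (transpose_mat M *\<^sub>v x) \<bullet> y"
  using transpose_vec_mult_scalar[OF assms(1,3,2)] by simp

lemma smult_mat_mult_vec:
  fixes M :: "real mat"
  assumes "M \<in> carrier_mat nr nc" "v \<in> carrier_vec nc"
  shows "(k \<cdot>\<^sub>m M) *\<^sub>v v = k \<cdot>\<^sub>v (M *\<^sub>v v)"
  using assms by (intro eq_vecI) auto

lemma symmetric_form_commute:
  assumes "symmetric_mat n M" "x \<in> carrier_vec n" "y \<in> carrier_vec n"
  shows "x \<bullet> (M *\<^sub>v y) = y \<bullet> (M *\<^sub>v x)"
proof -
  note M = symmetric_matD[OF assms(1)]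
  have "x \<bullet> (M *\<^sub>v y) = (M *\<^sub>v x) \<bullet> y"
    using scalar_prod_mult_mat_vec[OF M(1) assms(2,3)] M(2) by simp
  also have "\<dots> = y \<bullet> (M *\<^sub>v x)" using M(1) assms(2,3) by (intro comm_scalar_prod[of _ n]) auto
  finally show ?thesis .
qed

lemma form_smult:
  fixes M :: "real mat"
  assumes "M \<in> carrier_mat n n" "v \<in> carrier_vec n"
  shows "(c \<cdot>\<^sub>v v) \<bullet> (M *\<^sub>v (c \<cdot>\<^sub>v v)) = c\<^sup>2 * (v \<bullet> (M *\<^sub>v v))"
  using assms by (simp add: mult_mat_vec[OF assms] power2_eq_square)

lemma form_add:
  assumes S: "symmetric_mat n M" and x: "x \<in> carrier_vec n" and y: "y \<in> carrier_vec n"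
  shows "(x + y) \<bullet> (M *\<^sub>v (x + y)) = x \<bullet> (M *\<^sub>v x) + 2 * (x \<bullet> (M *\<^sub>v y)) + y \<bullet> (M *\<^sub>v y)"
proof -
  note M = symmetric_matD(1)[OF S]
  have Mx: "M *\<^sub>v x \<in> carrier_vec n" and My: "M *\<^sub>v y \<in> carrier_vec n" using M x y by auto
  show ?thesis
    unfolding mult_add_distrib_mat_vec[OF M x y] add_scalar_prod_distrib[OF x y add_carrier_vec[OF Mx My]]
      scalar_prod_add_distrib[OF x Mx My] scalar_prod_add_distrib[OF y Mx My]
    using symmetric_form_commute[OF S x y] by simp
qed

text \<open>The discriminant of the nonnegative quadratic polynomial
  \<open>t \<mapsto> (x + t y) \<bullet> M (x + t y)\<close>.\<close>
lemma psd_Cauchy_Schwarz: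
  assumes S: "symmetric_mat n M" and psd: "\<And>v. v \<in> carrier_vec n \<Longrightarrow> v \<bullet> (M *\<^sub>v v) \<ge> 0"
    and x: "x \<in> carrier_vec n" and y: "y \<in> carrier_vec n"
  shows "(x \<bullet> (M *\<^sub>v y))\<^sup>2 \<le> (x \<bullet> (M *\<^sub>v x)) * (y \<bullet> (M *\<^sub>v y))"
proof -
  note M = symmetric_matD(1)[OF S]
  define a b c where "a = x \<bullet> (M *\<^sub>v x)" and "b = x \<bullet> (M *\<^sub>v y)" and "c = y \<bullet> (M *\<^sub>v y)"
  have q: "a + 2 * t * b + t\<^sup>2 * c \<ge> 0" for t
  proof -
    have "(x + t \<cdot>\<^sub>v y) \<bullet> (M *\<^sub>v (x + t \<cdot>\<^sub>v y)) \<ge> 0" using x y by (intro psd) auto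
    moreover have "(x + t \<cdot>\<^sub>v y) \<bullet> (M *\<^sub>v (x + t \<cdot>\<^sub>v y)) = a + 2 * (x \<bullet> (M *\<^sub>v (t \<cdot>\<^sub>v y))) + t\<^sup>2 * c"
      unfolding form_add[OF S x smult_carrier_vec[THEN iffD2, OF y]] form_smult[OF M y] a_def c_def ..
    moreover have "x \<bullet> (M *\<^sub>v (t \<cdot>\<^sub>v y)) = t * b"
      using M x y by (simp add: mult_mat_vec[OF M y] b_def)
    ultimately show ?thesis by (simp add: algebra_simps)
  qed
  have c: "c \<ge> 0" using psd[OF y] by (simp add: c_def)
  have "b\<^sup>2 \<le> a * c"
  proof (cases "c = 0")
    case True
    have "b = 0"
    proof (rule ccontr)
      assume "b \<noteq> 0"
      \<comment> \<open>At this \<open>t\<close> the polynomial, linear because \<open>c = 0\<close>, takes the value \<open>- 1\<close>.\<close>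
      then show False using q[of "- (a + 1) / (2 * b)"] True by (simp add: field_simps)
    qed
    then show ?thesis using True by simp
  next
    case False
    with c have "c > 0" by simp
    have "0 \<le> (a + 2 * (- b / c) * b + (- b / c)\<^sup>2 * c) * c"
      using q[of "- b / c"] \<open>c > 0\<close> by (intro mult_nonneg_nonneg) auto
    also have "\<dots> = a * c - b\<^sup>2" using \<open>c > 0\<close> by (simp add: field_simps power2_eq_square)
    finally show ?thesis by simp
  qed
  then show ?thesis by (simp add: a_def b_def c_def)
qed

lemma form_bounded:
  fixes M :: "real mat"
  assumes M: "M \<in> carrier_mat n n"
  shows "\<exists>c > 0. \<forall>v \<in> carrier_vec n. \<bar>v \<bullet> (M *\<^sub>v v)\<bar> \<le> c * (v \<bullet> v)"
proof -
  define c where "c = (\<Sum>i = 0..<n. \<Sum>j = 0..<n. \<bar>M $$ (i, j)\<bar>) + 1"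
  have c: "c > 0" unfolding c_def by (intro add_nonneg_pos sum_nonneg) auto
  have "\<bar>v \<bullet> (M *\<^sub>v v)\<bar> \<le> c * (v \<bullet> v)" if v: "v \<in> carrier_vec n" for v
  proof -
    have sq: "\<bar>v $ i * v $ j\<bar> \<le> v \<bullet> v" if ij: "i < n" "j < n" for i j
    proof -
      have le: "v $ k * v $ k \<le> v \<bullet> v" if "k < n" for k
        unfolding scalar_prod_def using that v
        by (intro member_le_sum[where f = "\<lambda>k. v $ k * v $ k"]) auto
      have "2 * \<bar>v $ i * v $ j\<bar> \<le> v $ i * v $ i + v $ j * v $ j"
        using sum_squares_bound[of "\<bar>v $ i\<bar>" "\<bar>v $ j\<bar>"] by (simp add: abs_mult power2_eq_square)
      then show ?thesis using le[OF ij(1)] le[OF ij(2)] by linarith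
    qed
    have "v \<bullet> (M *\<^sub>v v) = (\<Sum>i = 0..<n. v $ i * (\<Sum>j = 0..<n. M $$ (i, j) * v $ j))"
      using M v unfolding scalar_prod_def by (auto intro!: sum.cong simp: scalar_prod_def)
    also have "\<dots> = (\<Sum>i = 0..<n. \<Sum>j = 0..<n. M $$ (i, j) * (v $ i * v $ j))"
      by (simp add: sum_distrib_left algebra_simps)
    also have "\<bar>\<dots>\<bar> \<le> (\<Sum>i = 0..<n. \<Sum>j = 0..<n. \<bar>M $$ (i, j)\<bar> * (v \<bullet> v))"
      by (intro order.trans[OF sum_abs] sum_mono)
        (auto simp: abs_mult[of "M $$ _"] intro!: mult_left_mono sq)
    also have "\<dots> \<le> c * (v \<bullet> v)"
      using scalar_prod_self_nonneg[of v] unfolding c_def distrib_right sum_distrib_right by simp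
    finally show ?thesis .
  qed
  with c show ?thesis by blast
qed

lemma mat_inv:
  assumes M: "M \<in> carrier_mat n n"
    and inj: "\<And>v. v \<in> carrier_vec n \<Longrightarrow> M *\<^sub>v v = 0\<^sub>v n \<Longrightarrow> v = 0\<^sub>v n"
  shows "mat_inv M \<in> carrier_mat n n" "M * mat_inv M = 1\<^sub>m n" "mat_inv M * M = 1\<^sub>m n"
proof -
  have "det M \<noteq> 0" using det_0_iff_vec_prod_zero[OF M] inj by blast
  from det_non_zero_imp_unit[OF M this, of "()"] have "mat_inverse M \<noteq> None"
    using mat_inverse(1)[OF M, of "()"] by blast
  then obtain B where "mat_inverse M = Some B" by blast
  with mat_inverse(2)[OF M this]
  show "mat_inv M \<in> carrier_mat n n" "M * mat_inv M = 1\<^sub>m n" "mat_inv M * M = 1\<^sub>m n"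
    unfolding mat_inv_def by auto
qed

lemma mat_inv_mult_vec:
  assumes M: "M \<in> carrier_mat n n"
    and inj: "\<And>v. v \<in> carrier_vec n \<Longrightarrow> M *\<^sub>v v = 0\<^sub>v n \<Longrightarrow> v = 0\<^sub>v n"
    and v: "v \<in> carrier_vec n"
  shows "mat_inv M *\<^sub>v (M *\<^sub>v v) = v" "M *\<^sub>v (mat_inv M *\<^sub>v v) = v"
proof -
  note i = mat_inv[OF M inj]
  show "mat_inv M *\<^sub>v (M *\<^sub>v v) = v"
    using assoc_mult_mat_vec[OF i(1) M v] i(3) v by simp
  show "M *\<^sub>v (mat_inv M *\<^sub>v v) = v"
    using assoc_mult_mat_vec[OF M i(1) v] i(2) v by simp
qed

lemma symmetric_mat_inv:
  assumes S: "symmetric_mat n M"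
    and inj: "\<And>v. v \<in> carrier_vec n \<Longrightarrow> M *\<^sub>v v = 0\<^sub>v n \<Longrightarrow> v = 0\<^sub>v n"
  shows "symmetric_mat n (mat_inv M)"
proof -
  note M = symmetric_matD[OF S]
  note i = mat_inv[OF M(1) inj]
  let ?I = "mat_inv M"
  have T: "transpose_mat ?I \<in> carrier_mat n n" using i(1) by simp
  have "transpose_mat ?I * M = 1\<^sub>m n"
    using transpose_mult[OF M(1) i(1)] i(2) M(2) by simp
  then have "transpose_mat ?I = transpose_mat ?I * (M * ?I)" using i(2) T by simp
  also have "\<dots> = (transpose_mat ?I * M) * ?I" using assoc_mult_mat[OF T M(1) i(1)] by simp
  also have "\<dots> = ?I" using \<open>transpose_mat ?I * M = 1\<^sub>m n\<close> i(1) by simp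
  finally show ?thesis using i(1) by (simp add: symmetric_mat_def)
qed

lemma symmetric_congruence:
  assumes R: "R \<in> carrier_mat n m" and G: "symmetric_mat m G"
  shows "symmetric_mat n (R * G * transpose_mat R)"
proof -
  note GC = symmetric_matD[OF G]
  have T: "transpose_mat R \<in> carrier_mat m n" using R by simp
  have RG: "R * G \<in> carrier_mat n m" using R GC(1) by auto
  have "transpose_mat (R * G * transpose_mat R) = R * (G * transpose_mat R)"
    unfolding transpose_mult[OF RG T] transpose_mult[OF R GC(1)] GC(2) by simp
  also have "\<dots> = R * G * transpose_mat R" using R GC(1) T by simp
  finally show ?thesis using RG T by (auto simp: symmetric_mat_def)
qed

lemma symmetric_mat_add:
  assumes "symmetric_mat n M" "symmetric_mat n M'"
  shows "symmetric_mat n (M + M')"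
  using assms by (auto simp: symmetric_mat_def transpose_add[of _ n n])

definition shift_mat :: "nat \<Rightarrow> real \<Rightarrow> real mat \<Rightarrow> real mat" where
  "shift_mat n x M = x \<cdot>\<^sub>m 1\<^sub>m n - M"

lemma shift_mat:
  assumes "symmetric_mat n M"
  shows "symmetric_mat n (shift_mat n x M)"
    and "v \<in> carrier_vec n \<Longrightarrow> shift_mat n x M *\<^sub>v v = x \<cdot>\<^sub>v v - M *\<^sub>v v"
    and "v \<in> carrier_vec n \<Longrightarrow> v \<bullet> (shift_mat n x M *\<^sub>v v) = x * (v \<bullet> v) - v \<bullet> (M *\<^sub>v v)"
proof -
  note M = symmetric_matD[OF assms]
  note one = smult_mat_mult_vec[OF one_carrier_mat]
  show "symmetric_mat n (shift_mat n x M)"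
    unfolding symmetric_mat_def shift_mat_def
    using M by (auto simp: transpose_minus[OF _ M(1)] intro!: eq_matI)
  show *: "shift_mat n x M *\<^sub>v v = x \<cdot>\<^sub>v v - M *\<^sub>v v" if v: "v \<in> carrier_vec n" for v
    unfolding shift_mat_def using M v
    by (subst minus_mult_distrib_mat_vec[of _ n n]) (auto simp: one)
  show "v \<bullet> (shift_mat n x M *\<^sub>v v) = x * (v \<bullet> v) - v \<bullet> (M *\<^sub>v v)" if v: "v \<in> carrier_vec n" for v
    unfolding *[OF v] using M v by (subst scalar_prod_minus_distrib[of _ n]) auto
qed

lemma eigenvalue_iff:
  fixes M :: "real mat"
  assumes "M \<in> carrier_mat n n"
  shows "eigenvalue M k \<longleftrightarrow> (\<exists>v \<in> carrier_vec n. v \<noteq> 0\<^sub>v n \<and> M *\<^sub>v v = k \<cdot>\<^sub>v v)"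
  using assms unfolding eigenvalue_def eigenvector_def by auto

lemma eigenvalue_form:
  fixes M :: "real mat"
  assumes M: "M \<in> carrier_mat n n" and "eigenvalue M k"
  shows "\<exists>v \<in> carrier_vec n. v \<bullet> v > 0 \<and> v \<bullet> (M *\<^sub>v v) = k * (v \<bullet> v)"
proof -
  obtain v where v: "v \<in> carrier_vec n" "v \<noteq> 0\<^sub>v n" "M *\<^sub>v v = k \<cdot>\<^sub>v v"
    using assms eigenvalue_iff[OF M] by blast
  then show ?thesis using scalar_prod_self_pos[OF v(1,2)] by (intro bexI[of _ v]) auto
qed

text \<open>The supremum \<open>m\<close> of the Rayleigh quotients is an eigenvalue, shown without compactness.
  Otherwise the positive semidefinite matrix \<open>Q = m I - M\<close> has an inverse \<open>G\<close>, and the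
  Cauchy-Schwarz inequality for \<open>Q\<close> applied to \<open>w\<close> and \<open>G w\<close> gives
  \<open>1 \<le> (w \<bullet> Q w) (w \<bullet> G w)\<close> for unit vectors \<open>w\<close>. As \<open>w \<bullet> G w\<close> is bounded, \<open>w \<bullet> Q w\<close> is
  bounded away from \<open>0\<close>, so \<open>m\<close> was not the least upper bound.\<close>
lemma symmetric_mat_greatest_eigenvalue:
  assumes S: "symmetric_mat n M" and n: "n \<ge> 1"
  shows "\<exists>m. eigenvalue M m \<and> (\<forall>v \<in> carrier_vec n. v \<bullet> (M *\<^sub>v v) \<le> m * (v \<bullet> v))"
proof -
  note M = symmetric_matD(1)[OF S]
  obtain c where c: "\<And>v. v \<in> carrier_vec n \<Longrightarrow> \<bar>v \<bullet> (M *\<^sub>v v)\<bar> \<le> c * (v \<bullet> v)"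
    using form_bounded[OF M] by blast
  define F where "F = {v \<bullet> (M *\<^sub>v v) | v. v \<in> carrier_vec n \<and> v \<bullet> v = 1}"
  have "unit_vec n 0 \<in> carrier_vec n" "unit_vec n 0 \<bullet> (unit_vec n 0 :: real vec) = 1" using n by auto
  then have ne: "F \<noteq> {}" unfolding F_def by blast
  have bdd: "bdd_above F" unfolding F_def bdd_above_def using c by (intro exI[of _ c]) fastforce
  define m where "m = Sup F"
  have normalize: "\<exists>w \<in> carrier_vec n. w \<bullet> w = 1 \<and> v \<bullet> (M *\<^sub>v v) = (v \<bullet> v) * (w \<bullet> (M *\<^sub>v w))"
    if v: "v \<in> carrier_vec n" "v \<noteq> 0\<^sub>v n" for v
  proof -
    have p: "v \<bullet> v > 0" by (rule scalar_prod_self_pos[OF v])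
    let ?t = "inverse (sqrt (v \<bullet> v))"
    have t: "?t\<^sup>2 * (v \<bullet> v) = 1" using p by (simp add: power_inverse)
    have "(?t \<cdot>\<^sub>v v) \<bullet> (?t \<cdot>\<^sub>v v) = 1" using t v(1) by (simp add: power2_eq_square mult.assoc)
    moreover have "(v \<bullet> v) * ((?t \<cdot>\<^sub>v v) \<bullet> (M *\<^sub>v (?t \<cdot>\<^sub>v v))) = v \<bullet> (M *\<^sub>v v)"
      unfolding form_smult[OF M v(1)] using t by (simp add: algebra_simps)
    ultimately show ?thesis using v(1) by (intro bexI[of _ "?t \<cdot>\<^sub>v v"]) auto
  qed
  have le: "v \<bullet> (M *\<^sub>v v) \<le> m * (v \<bullet> v)" if v: "v \<in> carrier_vec n" for v
  proof (cases "v = 0\<^sub>v n")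
    case True
    then show ?thesis using M by simp
  next
    case False
    then obtain w where w: "w \<in> carrier_vec n" "w \<bullet> w = 1" "v \<bullet> (M *\<^sub>v v) = (v \<bullet> v) * (w \<bullet> (M *\<^sub>v w))"
      using normalize[OF v] by blast
    have "w \<bullet> (M *\<^sub>v w) \<le> m" unfolding m_def using w bdd by (intro cSup_upper) (auto simp: F_def)
    then have "(v \<bullet> v) * (w \<bullet> (M *\<^sub>v w)) \<le> (v \<bullet> v) * m"
      by (rule mult_left_mono[OF _ scalar_prod_self_nonneg])
    then show ?thesis unfolding w(3) by (simp only: mult.commute)
  qed
  have "eigenvalue M m"
  proof (rule ccontr)
    assume no: "\<not> eigenvalue M m"
    let ?Q = "shift_mat n m M"
    note Q = shift_mat[OF S, where x = m]
    note QC = symmetric_matD(1)[OF Q(1)]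
    have inj: "v = 0\<^sub>v n" if v: "v \<in> carrier_vec n" "?Q *\<^sub>v v = 0\<^sub>v n" for v
    proof (rule ccontr)
      assume "v \<noteq> 0\<^sub>v n"
      have eq: "m \<cdot>\<^sub>v v - M *\<^sub>v v = 0\<^sub>v n" using Q(2)[OF v(1)] v(2) by simp
      have "M *\<^sub>v v = m \<cdot>\<^sub>v v"
      proof (rule eq_vecI)
        fix i assume i: "i < dim_vec (m \<cdot>\<^sub>v v)"
        have "(m \<cdot>\<^sub>v v - M *\<^sub>v v) $ i = 0" unfolding eq using i v(1) by simp
        then show "(M *\<^sub>v v) $ i = (m \<cdot>\<^sub>v v) $ i" using i v(1) M by simp
      qed (use v(1) M in auto)
      then show False using no v(1) \<open>v \<noteq> 0\<^sub>v n\<close> eigenvalue_iff[OF M] by blast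
    qed
    let ?G = "mat_inv ?Q"
    have G: "?G \<in> carrier_mat n n" by (rule mat_inv(1)[OF QC inj])
    have QG: "?Q *\<^sub>v (?G *\<^sub>v v) = v" if "v \<in> carrier_vec n" for v
      by (rule mat_inv_mult_vec(2)[OF QC inj that])
    obtain d where d: "d > 0" "\<And>v. v \<in> carrier_vec n \<Longrightarrow> \<bar>v \<bullet> (?G *\<^sub>v v)\<bar> \<le> d * (v \<bullet> v)"
      using form_bounded[OF G] by blast
    have psd: "v \<bullet> (?Q *\<^sub>v v) \<ge> 0" if "v \<in> carrier_vec n" for v
      using Q(3)[OF that] le[OF that] by simp
    have bound: "w \<bullet> (M *\<^sub>v w) \<le> m - 1 / d" if w: "w \<in> carrier_vec n" "w \<bullet> w = 1" for w
    proof -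
      have Gw: "?G *\<^sub>v w \<in> carrier_vec n" using G w(1) by auto
      have "1 = (w \<bullet> (?Q *\<^sub>v (?G *\<^sub>v w)))\<^sup>2" using QG[OF w(1)] w(2) by simp
      also have "\<dots> \<le> (w \<bullet> (?Q *\<^sub>v w)) * ((?G *\<^sub>v w) \<bullet> (?Q *\<^sub>v (?G *\<^sub>v w)))"
        by (rule psd_Cauchy_Schwarz[OF Q(1) psd w(1) Gw])
      also have "(?G *\<^sub>v w) \<bullet> (?Q *\<^sub>v (?G *\<^sub>v w)) = w \<bullet> (?G *\<^sub>v w)"
        using QG[OF w(1)] comm_scalar_prod[OF Gw w(1)] by simp
      also have "(w \<bullet> (?Q *\<^sub>v w)) * (w \<bullet> (?G *\<^sub>v w)) \<le> (w \<bullet> (?Q *\<^sub>v w)) * d"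
        using d(2)[OF w(1)] w(2) psd[OF w(1)] by (intro mult_left_mono) auto
      finally have "1 / d \<le> w \<bullet> (?Q *\<^sub>v w)" using d(1) by (simp add: field_simps)
      then show ?thesis using Q(3)[OF w(1)] w(2) by simp
    qed
    have "Sup F \<le> m - 1 / d" using bound by (intro cSup_least[OF ne]) (auto simp: F_def)
    then show False using d(1) unfolding m_def by (simp add: field_simps)
  qed
  with le show ?thesis by blast
qed

lemma symmetric_mat_uminus:
  assumes "symmetric_mat n M"
  shows "symmetric_mat n (- M)"
  using assms by (auto simp: symmetric_mat_def transpose_uminus)

lemma symmetric_mat_least_eigenvalue:
  assumes S: "symmetric_mat n M" and n: "n \<ge> 1"
  shows "\<exists>m. eigenvalue M m \<and> (\<forall>v \<in> carrier_vec n. m * (v \<bullet> v) \<le> v \<bullet> (M *\<^sub>v v))"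
proof -
  note M = symmetric_matD(1)[OF S]
  have neg: "- M *\<^sub>v v = - (M *\<^sub>v v)" if "v \<in> carrier_vec n" for v
    using M that by (intro uminus_mult_mat_vec) auto
  obtain m where m: "eigenvalue (- M) m" "\<And>v. v \<in> carrier_vec n \<Longrightarrow> v \<bullet> (- M *\<^sub>v v) \<le> m * (v \<bullet> v)"
    using symmetric_mat_greatest_eigenvalue[OF symmetric_mat_uminus[OF S] n] by blast
  obtain v where v: "v \<in> carrier_vec n" "v \<noteq> 0\<^sub>v n" "- M *\<^sub>v v = m \<cdot>\<^sub>v v"
    using m(1) eigenvalue_iff[of "- M" n] M by auto
  have "M *\<^sub>v v = (- m) \<cdot>\<^sub>v v"
  proof -
    have "M *\<^sub>v v = - (- M *\<^sub>v v)" unfolding neg[OF v(1)] by simp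
    then show ?thesis unfolding v(3) using v(1) by (auto simp: smult_vec_def)
  qed
  then have "eigenvalue M (- m)" using v eigenvalue_iff[OF M] by blast
  moreover have "- m * (v \<bullet> v) \<le> v \<bullet> (M *\<^sub>v v)" if "v \<in> carrier_vec n" for v
    using m(2)[OF that] unfolding neg[OF that] using M that by simp
  ultimately show ?thesis by blast
qed

lemma rayleigh_bounds:
  assumes S: "symmetric_mat n M" and n: "n \<ge> 1"
  shows "finite (spectrum M)" "spectrum M \<noteq> {}"
    and "v \<in> carrier_vec n \<Longrightarrow> Min (spectrum M) * (v \<bullet> v) \<le> v \<bullet> (M *\<^sub>v v)"
    and "v \<in> carrier_vec n \<Longrightarrow> v \<bullet> (M *\<^sub>v v) \<le> Max (spectrum M) * (v \<bullet> v)"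
proof -
  note M = symmetric_matD(1)[OF S]
  show fin: "finite (spectrum M)" by (rule card_finite_spectrum(1)[OF M])
  obtain l where l: "eigenvalue M l" "\<And>v. v \<in> carrier_vec n \<Longrightarrow> l * (v \<bullet> v) \<le> v \<bullet> (M *\<^sub>v v)"
    using symmetric_mat_least_eigenvalue[OF S n] by blast
  obtain u where u: "eigenvalue M u" "\<And>v. v \<in> carrier_vec n \<Longrightarrow> v \<bullet> (M *\<^sub>v v) \<le> u * (v \<bullet> v)"
    using symmetric_mat_greatest_eigenvalue[OF S n] by blast
  have lu: "l \<in> spectrum M" "u \<in> spectrum M" using l(1) u(1) by (auto simp: spectrum_def)
  then show "spectrum M \<noteq> {}" by blast
  show "Min (spectrum M) * (v \<bullet> v) \<le> v \<bullet> (M *\<^sub>v v)" if v: "v \<in> carrier_vec n"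
    using mult_right_mono[OF Min_le[OF fin lu(1)] scalar_prod_self_nonneg[of v]] l(2)[OF v] by linarith
  show "v \<bullet> (M *\<^sub>v v) \<le> Max (spectrum M) * (v \<bullet> v)" if v: "v \<in> carrier_vec n"
    using mult_right_mono[OF Max_ge[OF fin lu(2)] scalar_prod_self_nonneg[of v]] u(2)[OF v] by linarith
qed

section \<open>Square roots of positive definite matrices\<close>

lemma mat_eq_by_vec:
  fixes A B :: "real mat"
  assumes A: "A \<in> carrier_mat n m" and B: "B \<in> carrier_mat n m"
    and eq: "\<And>v. v \<in> carrier_vec m \<Longrightarrow> A *\<^sub>v v = B *\<^sub>v v"
  shows "A = B"
proof (rule eq_matI)
  fix i j assume ij: "i < dim_row B" "j < dim_col B"
  have "(A *\<^sub>v unit_vec m j) $ i = (B *\<^sub>v unit_vec m j) $ i" using eq by simp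
  then show "A $$ (i, j) = B $$ (i, j)" using A B ij by simp
qed (use A B in auto)

lemma spsd_matD:
  assumes "spsd_mat n M"
  shows "symmetric_mat n M" "v \<in> carrier_vec n \<Longrightarrow> v \<bullet> (M *\<^sub>v v) \<ge> 0"
  using assms by (auto simp: spsd_mat_def symmetric_mat_def)

lemma spsd_zero_mat: "spsd_mat n (0\<^sub>m n n)"
proof -
  have "0\<^sub>m n n *\<^sub>v v = 0\<^sub>v n" if "v \<in> carrier_vec n" for v :: "real vec"
    using that by (intro eq_vecI) auto
  then show ?thesis by (auto simp: spsd_mat_def)
qed

lemma spd_imp_spsd:
  assumes "spd_mat n M"
  shows "spsd_mat n M"
proof -
  have "v \<bullet> (M *\<^sub>v v) \<ge> 0" if "v \<in> carrier_vec n" for v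
    using assms that unfolding spd_mat_def by (cases "v = 0\<^sub>v n") auto
  then show ?thesis using assms by (auto simp: spd_mat_def spsd_mat_def)
qed

lemma spsd_form_zero:
  assumes M: "spsd_mat n M" and v: "v \<in> carrier_vec n" and zero: "v \<bullet> (M *\<^sub>v v) = 0"
  shows "M *\<^sub>v v = 0\<^sub>v n"
proof -
  have Mv: "M *\<^sub>v v \<in> carrier_vec n" using symmetric_matD(1)[OF spsd_matD(1)[OF M]] v by auto
  have "((M *\<^sub>v v) \<bullet> (M *\<^sub>v v))\<^sup>2 \<le> 0"
    using psd_Cauchy_Schwarz[OF spsd_matD[OF M] Mv v] zero by simp
  then show ?thesis using scalar_prod_self_eq_0[OF Mv] by simp
qed

lemma spd_injective:
  assumes "spd_mat n M" "v \<in> carrier_vec n" "M *\<^sub>v v = 0\<^sub>v n"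
  shows "v = 0\<^sub>v n"
proof (rule ccontr)
  assume "v \<noteq> 0\<^sub>v n"
  then have "v \<bullet> (M *\<^sub>v v) > 0" using assms(1,2) unfolding spd_mat_def by blast
  then show False using assms by simp
qed

definition outer_mat :: "nat \<Rightarrow> real vec \<Rightarrow> real mat" where
  "outer_mat n v = mat n n (\<lambda>(i, j). v $ i * v $ j)"

lemma outer_mat:
  assumes v: "v \<in> carrier_vec n"
  shows "symmetric_mat n (outer_mat n v)"
    and "w \<in> carrier_vec n \<Longrightarrow> outer_mat n v *\<^sub>v w = (v \<bullet> w) \<cdot>\<^sub>v v"
proof -
  show "symmetric_mat n (outer_mat n v)"
    unfolding symmetric_mat_def outer_mat_def by (auto intro!: eq_matI simp: mult.commute)
  show "outer_mat n v *\<^sub>v w = (v \<bullet> w) \<cdot>\<^sub>v v" if "w \<in> carrier_vec n"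
    using v that unfolding outer_mat_def
    by (intro eq_vecI) (auto simp: scalar_prod_def sum_distrib_left sum_distrib_right mult_ac intro!: sum.cong)
qed

lemma symmetric_mat_add_outer:
  assumes S: "symmetric_mat n M" and v: "v \<in> carrier_vec n"
  shows "symmetric_mat n (M + c \<cdot>\<^sub>m outer_mat n v)"
    and "w \<in> carrier_vec n \<Longrightarrow> (M + c \<cdot>\<^sub>m outer_mat n v) *\<^sub>v w = M *\<^sub>v w + (c * (v \<bullet> w)) \<cdot>\<^sub>v v"
proof -
  note M = symmetric_matD[OF S] and O = symmetric_matD[OF outer_mat(1)[OF v]]
  have T: "transpose_mat (c \<cdot>\<^sub>m outer_mat n v) = c \<cdot>\<^sub>m outer_mat n v"
    by (subst (2) O(2)[symmetric]) (rule eq_matI, auto)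
  show "symmetric_mat n (M + c \<cdot>\<^sub>m outer_mat n v)"
    unfolding symmetric_mat_def using M O(1) T by (auto simp: transpose_add[of _ n n])
  show "(M + c \<cdot>\<^sub>m outer_mat n v) *\<^sub>v w = M *\<^sub>v w + (c * (v \<bullet> w)) \<cdot>\<^sub>v v" if w: "w \<in> carrier_vec n"
    using M O w outer_mat(2)[OF v w]
    by (subst add_mult_distrib_mat_vec[of _ n n]) (auto simp: smult_mat_mult_vec[OF O(1) w] smult_smult_assoc)
qed

lemma orthonormal_kernel_imp_zero:
  assumes M: "(M :: real mat) \<in> carrier_mat n n" and len: "length vs = n"
    and ker: "\<And>v. v \<in> set vs \<Longrightarrow> v \<in> carrier_vec n \<and> M *\<^sub>v v = 0\<^sub>v n"
    and orth: "\<And>i j. i < n \<Longrightarrow> j < n \<Longrightarrow> vs ! i \<bullet> vs ! j = (if i = j then 1 else 0)"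
  shows "M = 0\<^sub>m n n"
proof -
  let ?P = "mat_of_cols n vs"
  have P: "?P \<in> carrier_mat n n" using len by (metis mat_of_cols_carrier(1))
  then have T: "transpose_mat ?P \<in> carrier_mat n n" by simp
  have c: "col ?P i = vs ! i" if "i < n" for i
    using that len ker nth_mem[of i vs] by (intro col_mat_of_cols) auto
  have "transpose_mat ?P * ?P = 1\<^sub>m n"
    using P orth c by (intro eq_matI) auto
  from mat_mult_left_right_inverse[OF T P this] have PT: "?P * transpose_mat ?P = 1\<^sub>m n" .
  have row: "row M i \<bullet> vs ! j = 0" if "i < n" "j < n" for i j
  proof -
    have "(M *\<^sub>v vs ! j) $ i = 0" using ker[of "vs ! j"] that len by simp
    then show ?thesis using M that by simp
  qed
  have "M * ?P = 0\<^sub>m n n"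
    using M P row c by (intro eq_matI) auto
  have "M = M * (?P * transpose_mat ?P)" using M PT by simp
  also have "\<dots> = (M * ?P) * transpose_mat ?P" using M P T by simp
  also have "\<dots> = 0\<^sub>m n n" unfolding \<open>M * ?P = 0\<^sub>m n n\<close> by (rule left_mult_zero_mat[OF T])
  finally show ?thesis .
qed

text \<open>Deflation: subtract the spectral projection of a unit eigenvector \<open>v\<close> for the greatest
  eigenvalue \<open>m > 0\<close>. The remainder is positive semidefinite by the Cauchy-Schwarz inequality and
  has one more orthonormal kernel vector; if \<open>X\<close> is its root, \<open>X + sqrt m v v\<^sup>T\<close> is the wanted one.
  The list \<open>vs\<close> of orthonormal kernel vectors serves as the induction measure: when it has full
  length, the matrix is zero.\<close>
lemma spsd_sqrt_exists_aux:
  assumes "spsd_mat n M" "length vs + r = n"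
    and "\<And>v. v \<in> set vs \<Longrightarrow> v \<in> carrier_vec n \<and> M *\<^sub>v v = 0\<^sub>v n"
    and "\<And>i j. i < length vs \<Longrightarrow> j < length vs \<Longrightarrow> vs ! i \<bullet> vs ! j = (if i = j then 1 else 0)"
  shows "\<exists>X. spsd_mat n X \<and> X * X = M"
  using assms
proof (induction r arbitrary: M vs)
  case 0
  then have "M = 0\<^sub>m n n"
    by (intro orthonormal_kernel_imp_zero[of M n vs]) (auto simp: spsd_mat_def)
  moreover have "spsd_mat n (0\<^sub>m n n)" by (rule spsd_zero_mat)
  ultimately show ?case by (intro exI[of _ "0\<^sub>m n n"]) auto
next
  case (Suc r)
  note S = spsd_matD(1)[OF Suc.prems(1)] and psd = spsd_matD(2)[OF Suc.prems(1)]
  note M = symmetric_matD(1)[OF S]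
  obtain m where m: "eigenvalue M m" "\<And>v. v \<in> carrier_vec n \<Longrightarrow> v \<bullet> (M *\<^sub>v v) \<le> m * (v \<bullet> v)"
    using symmetric_mat_greatest_eigenvalue[OF S] Suc.prems(2) by auto
  show ?case
  proof (cases "m > 0")
    case False
    have "M *\<^sub>v v = 0\<^sub>v n" if v: "v \<in> carrier_vec n" for v
    proof -
      have "m * (v \<bullet> v) \<le> 0" using False scalar_prod_self_nonneg[of v] by (simp add: mult_nonpos_nonneg)
      then show ?thesis using m(2)[OF v] psd[OF v] by (intro spsd_form_zero[OF Suc.prems(1) v]) linarith
    qed
    then have "M = 0\<^sub>m n n" using M by (intro mat_eq_by_vec[of _ n n]) auto
    moreover have "spsd_mat n (0\<^sub>m n n)" by (rule spsd_zero_mat)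
    ultimately show ?thesis by (intro exI[of _ "0\<^sub>m n n"]) auto
  next
    case True
    obtain u where u: "u \<in> carrier_vec n" "u \<noteq> 0\<^sub>v n" "M *\<^sub>v u = m \<cdot>\<^sub>v u"
      using m(1) eigenvalue_iff[OF M] by blast
    define v where "v = inverse (sqrt (u \<bullet> u)) \<cdot>\<^sub>v u"
    have v: "v \<in> carrier_vec n" using u(1) by (simp add: v_def)
    have "(inverse (sqrt (u \<bullet> u)))\<^sup>2 * (u \<bullet> u) = 1"
      using scalar_prod_self_pos[OF u(1,2)] by (simp add: power_inverse)
    then have vv: "v \<bullet> v = 1" using u(1) by (simp add: v_def power2_eq_square mult.assoc)
    have Mv: "M *\<^sub>v v = m \<cdot>\<^sub>v v"
      unfolding v_def mult_mat_vec[OF M u(1)] u(3) by (simp add: smult_smult_assoc mult.commute)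
    have vw: "v \<bullet> w = 0" if w: "w \<in> set vs" for w
    proof -
      have wc: "w \<in> carrier_vec n" "M *\<^sub>v w = 0\<^sub>v n" using Suc.prems(3)[OF w] by auto
      have "m * (w \<bullet> v) = v \<bullet> (M *\<^sub>v w)"
        using symmetric_form_commute[OF S v wc(1)] Mv v wc(1) by simp
      then show ?thesis using wc v True comm_scalar_prod[OF v wc(1)] by simp
    qed
    let ?M = "M + (- m) \<cdot>\<^sub>m outer_mat n v"
    note M' = symmetric_mat_add_outer[OF S v, where c = "- m"]
    have psd': "spsd_mat n ?M"
    proof -
      have "x \<bullet> (?M *\<^sub>v x) \<ge> 0" if x: "x \<in> carrier_vec n" for x
      proof -
        have "x \<bullet> (?M *\<^sub>v x) = x \<bullet> (M *\<^sub>v x) - m * (x \<bullet> v)\<^sup>2"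
          unfolding M'(2)[OF x] using M x v comm_scalar_prod[OF v x]
          by (subst scalar_prod_add_distrib[of _ n]) (auto simp: power2_eq_square)
        moreover have "(x \<bullet> (M *\<^sub>v v))\<^sup>2 \<le> (x \<bullet> (M *\<^sub>v x)) * (v \<bullet> (M *\<^sub>v v))"
          by (rule psd_Cauchy_Schwarz[OF S psd x v])
        then have "m * (m * (x \<bullet> v)\<^sup>2) \<le> m * (x \<bullet> (M *\<^sub>v x))"
          unfolding Mv using x v vv by (simp add: power_mult_distrib power2_eq_square mult_ac)
        ultimately show ?thesis using True by (simp add: mult_le_cancel_left_pos)
      qed
      then show ?thesis using M'(1) by (auto simp: spsd_mat_def symmetric_mat_def)
    qed
    have M'v: "?M *\<^sub>v v = 0\<^sub>v n" unfolding M'(2)[OF v] Mv vv using v by (intro eq_vecI) auto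
    have M'w: "?M *\<^sub>v w = 0\<^sub>v n" if w: "w \<in> set vs" for w
    proof -
      have "w \<in> carrier_vec n" "M *\<^sub>v w = 0\<^sub>v n" using Suc.prems(3)[OF w] by auto
      then show ?thesis using M'(2)[of w] vw[OF w] v by (auto intro!: eq_vecI)
    qed
    have "\<exists>X. spsd_mat n X \<and> X * X = ?M"
    proof (rule Suc.IH[OF psd', of "v # vs"])
      show "length (v # vs) + r = n" using Suc.prems(2) by simp
      show "w \<in> carrier_vec n \<and> ?M *\<^sub>v w = 0\<^sub>v n" if "w \<in> set (v # vs)" for w
        using that M'v M'w v Suc.prems(3) by auto
      fix i j assume ij: "i < length (v # vs)" "j < length (v # vs)"
      have wv: "w \<bullet> v = 0" if "w \<in> set vs" for w
        using vw[OF that] comm_scalar_prod[OF v, of w] Suc.prems(3)[OF that] by simp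
      show "(v # vs) ! i \<bullet> (v # vs) ! j = (if i = j then 1 else 0)"
        using ij vv vw wv Suc.prems(4) by (cases i; cases j) auto
    qed
    then obtain X where X: "spsd_mat n X" "X * X = ?M" by blast
    note SX = spsd_matD(1)[OF X(1)]
    note XC = symmetric_matD(1)[OF SX]
    have XX: "X *\<^sub>v (X *\<^sub>v w) = ?M *\<^sub>v w" if w: "w \<in> carrier_vec n" for w
      using assoc_mult_mat_vec[OF XC XC w] X(2) by simp
    have Xv: "X *\<^sub>v v = 0\<^sub>v n"
    proof -
      have Xvc: "X *\<^sub>v v \<in> carrier_vec n" using XC v by auto
      have "(X *\<^sub>v v) \<bullet> (X *\<^sub>v v) = v \<bullet> (X *\<^sub>v (X *\<^sub>v v))"
        by (rule symmetric_form_commute[OF SX Xvc v])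
      also have "\<dots> = 0" unfolding XX[OF v] M'v using v by simp
      finally show ?thesis using scalar_prod_self_eq_0[OF Xvc] by simp
    qed
    let ?Y = "X + sqrt m \<cdot>\<^sub>m outer_mat n v"
    note Y = symmetric_mat_add_outer[OF SX v, where c = "sqrt m"]
    note YC = symmetric_matD(1)[OF Y(1)]
    have "spsd_mat n ?Y"
    proof -
      have "x \<bullet> (?Y *\<^sub>v x) \<ge> 0" if x: "x \<in> carrier_vec n" for x
      proof -
        have "x \<bullet> (?Y *\<^sub>v x) = x \<bullet> (X *\<^sub>v x) + sqrt m * (x \<bullet> v)\<^sup>2"
          unfolding Y(2)[OF x] using XC x v comm_scalar_prod[OF v x]
          by (subst scalar_prod_add_distrib[of _ n]) (auto simp: power2_eq_square)
        then show ?thesis using spsd_matD(2)[OF X(1) x] True by simp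
      qed
      then show ?thesis using Y(1) by (auto simp: spsd_mat_def symmetric_mat_def)
    qed
    moreover have "?Y * ?Y = M"
    proof (rule mat_eq_by_vec[of _ n n])
      fix w :: "real vec" assume w: "w \<in> carrier_vec n"
      have Xw: "X *\<^sub>v w \<in> carrier_vec n" using XC w by auto
      have vXw: "v \<bullet> (X *\<^sub>v w) = 0"
        using symmetric_form_commute[OF SX v w] Xv w by simp
      let ?c = "sqrt m * (v \<bullet> w)"
      have z: "X *\<^sub>v w + ?c \<cdot>\<^sub>v v \<in> carrier_vec n" using Xw v by auto
      have "(?Y * ?Y) *\<^sub>v w = ?Y *\<^sub>v (X *\<^sub>v w + ?c \<cdot>\<^sub>v v)"
        using assoc_mult_mat_vec[OF YC YC w] Y(2)[OF w] by simp
      also have "\<dots> = X *\<^sub>v (X *\<^sub>v w + ?c \<cdot>\<^sub>v v) + (sqrt m * (v \<bullet> (X *\<^sub>v w + ?c \<cdot>\<^sub>v v))) \<cdot>\<^sub>v v"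
        by (rule Y(2)[OF z])
      also have "X *\<^sub>v (X *\<^sub>v w + ?c \<cdot>\<^sub>v v) = ?M *\<^sub>v w + ?c \<cdot>\<^sub>v 0\<^sub>v n"
        using v by (simp add: mult_add_distrib_mat_vec[OF XC Xw] mult_mat_vec[OF XC v] XX[OF w] Xv)
      also have "v \<bullet> (X *\<^sub>v w + ?c \<cdot>\<^sub>v v) = ?c"
        using v Xw vXw vv by (subst scalar_prod_add_distrib[of _ n]) auto
      also have "sqrt m * ?c = m * (v \<bullet> w)" using True by simp
      finally show "(?Y * ?Y) *\<^sub>v w = M *\<^sub>v w"
        unfolding M'(2)[OF w] using v M w by (intro eq_vecI) auto
    qed (use YC M in auto)
    ultimately show ?thesis by blast
  qed
qed

lemma spd_sqrt_exists:
  assumes M: "spd_mat n M"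
  shows "\<exists>X. spd_mat n X \<and> X * X = M"
proof -
  obtain X where X: "spsd_mat n X" "X * X = M"
    using spsd_sqrt_exists_aux[OF spd_imp_spsd[OF M], of "[]" n] by auto
  note XC = symmetric_matD(1)[OF spsd_matD(1)[OF X(1)]]
  have "v \<bullet> (X *\<^sub>v v) > 0" if v: "v \<in> carrier_vec n" "v \<noteq> 0\<^sub>v n" for v
  proof -
    have "v \<bullet> (X *\<^sub>v v) \<noteq> 0"
    proof
      assume "v \<bullet> (X *\<^sub>v v) = 0"
      then have "X *\<^sub>v v = 0\<^sub>v n" by (rule spsd_form_zero[OF X(1) v(1)])
      then have "M *\<^sub>v v = 0\<^sub>v n"
        using assoc_mult_mat_vec[OF XC XC v(1)] X(2) XC by auto
      then show False using spd_injective[OF M v(1)] v(2) by blast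
    qed
    then show ?thesis using spsd_matD(2)[OF X(1) v(1)] by linarith
  qed
  then have "spd_mat n X" using X(1) by (auto simp: spd_mat_def spsd_mat_def)
  with X(2) show ?thesis by blast
qed

text \<open>With \<open>D = X - Y\<close> one has \<open>X D + D Y = 0\<close>. For an eigenvector \<open>v\<close> of \<open>D\<close> with eigenvalue
  \<open>k\<close> this yields \<open>k (v \<bullet> X v + v \<bullet> Y v) = 0\<close>, hence \<open>k = 0\<close>; a symmetric matrix without nonzero
  eigenvalues vanishes.\<close>
lemma spd_sqrt_unique:
  assumes X: "spd_mat n X" and Y: "spd_mat n Y" and eq: "X * X = Y * Y"
  shows "X = Y"
proof (cases "n = 0")
  case True
  then show ?thesis using X Y by (auto simp: spd_mat_def intro!: eq_matI)
next
  case False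
  then have n: "n \<ge> 1" by simp
  have XC: "X \<in> carrier_mat n n" and YC: "Y \<in> carrier_mat n n" using X Y by (auto simp: spd_mat_def)
  have SY: "symmetric_mat n Y" using Y by (auto simp: spd_mat_def symmetric_mat_def)
  let ?D = "X - Y"
  have D: "symmetric_mat n ?D"
    using X Y by (auto simp: spd_mat_def symmetric_mat_def transpose_minus[OF XC YC])
  note DC = symmetric_matD(1)[OF D]
  have zero: "k = 0" if k: "eigenvalue ?D k" for k
  proof -
    obtain v where v: "v \<in> carrier_vec n" "v \<noteq> 0\<^sub>v n" "?D *\<^sub>v v = k \<cdot>\<^sub>v v"
      using k eigenvalue_iff[OF DC] by blast
    have Xv: "X *\<^sub>v v \<in> carrier_vec n" and Yv: "Y *\<^sub>v v \<in> carrier_vec n" using XC YC v by auto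
    have XYv: "X *\<^sub>v (Y *\<^sub>v v) \<in> carrier_vec n" using XC Yv by auto
    have "X *\<^sub>v (X *\<^sub>v v) = Y *\<^sub>v (Y *\<^sub>v v)"
      using assoc_mult_mat_vec[OF XC XC v(1)] assoc_mult_mat_vec[OF YC YC v(1)] eq by simp
    then have "X *\<^sub>v (?D *\<^sub>v v) = - (?D *\<^sub>v (Y *\<^sub>v v))"
      unfolding minus_mult_distrib_mat_vec[OF XC YC v(1)] minus_mult_distrib_mat_vec[OF XC YC Yv]
        mult_minus_distrib_mat_vec[OF XC Xv Yv]
      using XYv YC XC by (intro eq_vecI) (auto simp del: index_mult_mat_vec)
    then have "v \<bullet> (X *\<^sub>v (?D *\<^sub>v v)) = - (v \<bullet> (?D *\<^sub>v (Y *\<^sub>v v)))"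
      using v(1) YC by simp
    moreover have "v \<bullet> (X *\<^sub>v (?D *\<^sub>v v)) = k * (v \<bullet> (X *\<^sub>v v))"
      unfolding v(3) mult_mat_vec[OF XC v(1)] using v(1) Xv by simp
    moreover have "v \<bullet> (?D *\<^sub>v (Y *\<^sub>v v)) = k * (v \<bullet> (Y *\<^sub>v v))"
      unfolding symmetric_form_commute[OF D v(1) Yv] v(3)
      using v(1) Yv comm_scalar_prod[OF v(1) Yv] by simp
    ultimately have "k * (v \<bullet> (X *\<^sub>v v) + v \<bullet> (Y *\<^sub>v v)) = 0" by (simp add: algebra_simps)
    moreover have "v \<bullet> (X *\<^sub>v v) > 0" "v \<bullet> (Y *\<^sub>v v) > 0" using X Y v by (auto simp: spd_mat_def)
    ultimately show ?thesis by simp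
  qed
  obtain l where l: "eigenvalue ?D l" "\<And>v. v \<in> carrier_vec n \<Longrightarrow> l * (v \<bullet> v) \<le> v \<bullet> (?D *\<^sub>v v)"
    using symmetric_mat_least_eigenvalue[OF D n] by blast
  obtain u where u: "eigenvalue ?D u" "\<And>v. v \<in> carrier_vec n \<Longrightarrow> v \<bullet> (?D *\<^sub>v v) \<le> u * (v \<bullet> v)"
    using symmetric_mat_greatest_eigenvalue[OF D n] by blast
  have form: "v \<bullet> (?D *\<^sub>v v) = 0" if "v \<in> carrier_vec n" for v
    using l(2)[OF that] u(2)[OF that] zero[OF l(1)] zero[OF u(1)] by simp
  then have "spsd_mat n ?D" using D by (auto simp: spsd_mat_def symmetric_mat_def)
  then have Dv: "?D *\<^sub>v v = 0\<^sub>v n" if "v \<in> carrier_vec n" for v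
    using spsd_form_zero form that by blast
  show ?thesis
  proof (rule mat_eq_by_vec[OF XC YC])
    fix v :: "real vec" assume v: "v \<in> carrier_vec n"
    have e: "X *\<^sub>v v - Y *\<^sub>v v = 0\<^sub>v n"
      using Dv[OF v] minus_mult_distrib_mat_vec[OF XC YC v] by simp
    show "X *\<^sub>v v = Y *\<^sub>v v"
    proof (rule eq_vecI)
      fix i assume i: "i < dim_vec (Y *\<^sub>v v)"
      have "(X *\<^sub>v v - Y *\<^sub>v v) $ i = 0" unfolding e using i YC by simp
      then show "(X *\<^sub>v v) $ i = (Y *\<^sub>v v) $ i" using i by simp
    qed (use XC YC in auto)
  qed
qed

lemma spd_sqrt:
  assumes "spd_mat n M"
  shows "spd_mat n (spd_sqrt M)" "spd_sqrt M * spd_sqrt M = M"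
proof -
  have n: "dim_row M = n" using assms by (auto simp: spd_mat_def)
  have "\<exists>!X. spd_mat n X \<and> X * X = M"
    using spd_sqrt_exists[OF assms] spd_sqrt_unique by metis
  from theI'[OF this] show "spd_mat n (spd_sqrt M)" "spd_sqrt M * spd_sqrt M = M"
    unfolding spd_sqrt_def n by auto
qed

lemma inv_sqrt:
  assumes M: "spd_mat n M"
  shows "symmetric_mat n (inv_sqrt M)"
    and "v \<in> carrier_vec n \<Longrightarrow> inv_sqrt M *\<^sub>v (spd_sqrt M *\<^sub>v v) = v"
    and "v \<in> carrier_vec n \<Longrightarrow> spd_sqrt M *\<^sub>v (inv_sqrt M *\<^sub>v v) = v"
    and "v \<in> carrier_vec n \<Longrightarrow> inv_sqrt M *\<^sub>v (M *\<^sub>v v) = spd_sqrt M *\<^sub>v v"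
proof -
  note X = spd_sqrt[OF M]
  have S: "symmetric_mat n (spd_sqrt M)" using X(1) by (auto simp: spd_mat_def symmetric_mat_def)
  note XC = symmetric_matD(1)[OF S]
  note inj = spd_injective[OF X(1)]
  show "symmetric_mat n (inv_sqrt M)" unfolding inv_sqrt_def by (rule symmetric_mat_inv[OF S inj])
  show *: "inv_sqrt M *\<^sub>v (spd_sqrt M *\<^sub>v v) = v" if "v \<in> carrier_vec n" for v
    unfolding inv_sqrt_def by (rule mat_inv_mult_vec(1)[OF XC inj that])
  show "spd_sqrt M *\<^sub>v (inv_sqrt M *\<^sub>v v) = v" if "v \<in> carrier_vec n"
    unfolding inv_sqrt_def by (rule mat_inv_mult_vec(2)[OF XC inj that])
  show "inv_sqrt M *\<^sub>v (M *\<^sub>v v) = spd_sqrt M *\<^sub>v v" if v: "v \<in> carrier_vec n"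
  proof -
    have "M *\<^sub>v v = spd_sqrt M *\<^sub>v (spd_sqrt M *\<^sub>v v)"
      using assoc_mult_mat_vec[OF XC XC v] X(2) by simp
    then show ?thesis using *[of "spd_sqrt M *\<^sub>v v"] XC v by simp
  qed
qed

section \<open>Symmetrically scaled blocks\<close>

text \<open>A maximal independent set of columns forms an invertible \<open>n \<times> n\<close> matrix, and \<open>v\<close> is
  orthogonal to all of its columns.\<close>
lemma full_row_rank_transpose_injective:
  fixes B :: "real mat"
  assumes B: "B \<in> carrier_mat n m" and rank: "vec_space.rank n B = n"
    and v: "v \<in> carrier_vec n" and zero: "transpose_mat B *\<^sub>v v = 0\<^sub>v m"
  shows "v = 0\<^sub>v n"
proof -
  interpret vec_space "TYPE(real)" n .
  obtain S where S: "maximal S (\<lambda>T. T \<subseteq> set (cols B) \<and> lin_indpt T)"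
    using maximal_exists[of "\<lambda>T. T \<subseteq> set (cols B) \<and> lin_indpt T" "card (set (cols B))" "{}"]
    by (meson List.finite_set card_mono empty_iff empty_subsetI finite_lin_indpt2 rev_finite_subset)
  then have Ssub: "S \<subseteq> set (cols B)" and li: "lin_indpt S" by (auto simp: maximal_def)
  have card: "card S = n" using rank_card_indpt[OF B S] rank by simp
  have fin: "finite S" using Ssub finite_subset by blast
  then obtain ss where ss: "set ss = S" "distinct ss" using finite_distinct_list by blast
  have len: "length ss = n" using ss card distinct_card by fastforce
  have ssc: "set ss \<subseteq> carrier_vec n" using Ssub ss cols_dim[of B] B by auto
  let ?P = "mat_of_cols n ss"
  have P: "?P \<in> carrier_mat n n" using len by (metis mat_of_cols_carrier(1))
  have cols: "cols ?P = ss" using ssc by (rule cols_mat_of_cols)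
  have "rank ?P = n" using lin_indpt_full_rank[OF P] cols ss li by simp
  then have det: "det ?P \<noteq> 0" using det_rank_iff[OF P] by simp
  have "transpose_mat ?P *\<^sub>v v = 0\<^sub>v n"
  proof (rule eq_vecI)
    fix i assume i: "i < dim_vec (0\<^sub>v n :: real vec)"
    then have "ss ! i \<in> set (cols B)" using ss len Ssub nth_mem[of i ss] by auto
    then obtain j where j: "j < m" "ss ! i = col B j"
      using B by (auto simp: cols_def)
    have "(transpose_mat B *\<^sub>v v) $ j = 0" using zero j by simp
    then have "col B j \<bullet> v = 0" using B j by simp
    then show "(transpose_mat ?P *\<^sub>v v) $ i = 0\<^sub>v n $ i"
      using i j P len ssc nth_mem[of i ss] by (auto simp: col_mat_of_cols)
  qed (use P in auto)
  moreover have "det (transpose_mat ?P) \<noteq> 0" using det_transpose[OF P] det by simp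
  ultimately show ?thesis using det_0_iff_vec_prod_zero[of "transpose_mat ?P" n] P v by auto
qed

lemma scaled_mult_vec:
  fixes Z W B :: "real mat"
  assumes "Z \<in> carrier_mat n n" "B \<in> carrier_mat n m" "W \<in> carrier_mat m m" "v \<in> carrier_vec m"
  shows "(Z * B * W) *\<^sub>v v = Z *\<^sub>v (B *\<^sub>v (W *\<^sub>v v))"
  using assms by (simp add: assoc_mult_mat_vec[of _ n m _ m] assoc_mult_mat_vec[of _ n n _ m])

lemma E_mat:
  assumes S: "spd_mat n (S k)" and A: "symmetric_mat n (A k)"
  shows "symmetric_mat n (E_mat A S k)"
    and "v \<in> carrier_vec n \<Longrightarrow> E_mat A S k *\<^sub>v v = inv_sqrt (S k) *\<^sub>v (A k *\<^sub>v (inv_sqrt (S k) *\<^sub>v v))"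
    and "v \<in> carrier_vec n \<Longrightarrow>
      v \<bullet> (E_mat A S k *\<^sub>v v) = (inv_sqrt (S k) *\<^sub>v v) \<bullet> (A k *\<^sub>v (inv_sqrt (S k) *\<^sub>v v))"
proof -
  note Z = symmetric_matD[OF inv_sqrt(1)[OF S]] and AC = symmetric_matD[OF A]
  show "symmetric_mat n (E_mat A S k)"
    using symmetric_congruence[OF Z(1) A] unfolding E_mat_def Z(2) .
  show *: "E_mat A S k *\<^sub>v v = inv_sqrt (S k) *\<^sub>v (A k *\<^sub>v (inv_sqrt (S k) *\<^sub>v v))"
    if "v \<in> carrier_vec n" for v
    unfolding E_mat_def by (rule scaled_mult_vec[OF Z(1) AC(1) Z(1) that])
  show "v \<bullet> (E_mat A S k *\<^sub>v v) = (inv_sqrt (S k) *\<^sub>v v) \<bullet> (A k *\<^sub>v (inv_sqrt (S k) *\<^sub>v v))"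
    if v: "v \<in> carrier_vec n"
  proof -
    have AZv: "A k *\<^sub>v (inv_sqrt (S k) *\<^sub>v v) \<in> carrier_vec n" using Z(1) AC(1) v by auto
    show ?thesis unfolding *[OF v] scalar_prod_mult_mat_vec[OF Z(1) v AZv] Z(2) ..
  qed
qed

lemma R_mat:
  assumes S: "spd_mat n (S k)" and S': "spd_mat m (S (k - 1))" and B: "B k \<in> carrier_mat n m"
  shows "R_mat B S k \<in> carrier_mat n m"
    and "v \<in> carrier_vec m \<Longrightarrow>
      R_mat B S k *\<^sub>v v = inv_sqrt (S k) *\<^sub>v (B k *\<^sub>v (inv_sqrt (S (k - 1)) *\<^sub>v v))"
    and "w \<in> carrier_vec n \<Longrightarrow> transpose_mat (R_mat B S k) *\<^sub>v w =
      inv_sqrt (S (k - 1)) *\<^sub>v (transpose_mat (B k) *\<^sub>v (inv_sqrt (S k) *\<^sub>v w))"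
proof -
  note Z = symmetric_matD[OF inv_sqrt(1)[OF S]] and W = symmetric_matD[OF inv_sqrt(1)[OF S']]
  have BT: "transpose_mat (B k) \<in> carrier_mat m n" using B by simp
  have ZB: "inv_sqrt (S k) * B k \<in> carrier_mat n m" using Z(1) B by auto
  show "R_mat B S k \<in> carrier_mat n m" using ZB W(1) by (auto simp: R_mat_def)
  show "R_mat B S k *\<^sub>v v = inv_sqrt (S k) *\<^sub>v (B k *\<^sub>v (inv_sqrt (S (k - 1)) *\<^sub>v v))"
    if "v \<in> carrier_vec m" for v
    unfolding R_mat_def by (rule scaled_mult_vec[OF Z(1) B W(1) that])
  have "transpose_mat (R_mat B S k) = inv_sqrt (S (k - 1)) * transpose_mat (B k) * inv_sqrt (S k)"
    unfolding R_mat_def transpose_mult[OF ZB W(1)] transpose_mult[OF Z(1) B] Z(2) W(2)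
    using Z(1) W(1) BT by simp
  then show "transpose_mat (R_mat B S k) *\<^sub>v w =
      inv_sqrt (S (k - 1)) *\<^sub>v (transpose_mat (B k) *\<^sub>v (inv_sqrt (S k) *\<^sub>v w))"
    if "w \<in> carrier_vec n" using scaled_mult_vec[OF W(1) BT Z(1) that] by simp
qed

lemma gram_mat:
  fixes R :: "real mat"
  assumes R: "R \<in> carrier_mat n m"
  shows "symmetric_mat n (R * transpose_mat R)"
    and "v \<in> carrier_vec n \<Longrightarrow>
      v \<bullet> ((R * transpose_mat R) *\<^sub>v v) = (transpose_mat R *\<^sub>v v) \<bullet> (transpose_mat R *\<^sub>v v)"
proof -
  have T: "transpose_mat R \<in> carrier_mat m n" using R by simp
  show "symmetric_mat n (R * transpose_mat R)"
    using R T transpose_mult[OF R T] by (auto simp: symmetric_mat_def)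
  show "v \<bullet> ((R * transpose_mat R) *\<^sub>v v) = (transpose_mat R *\<^sub>v v) \<bullet> (transpose_mat R *\<^sub>v v)"
    if v: "v \<in> carrier_vec n"
  proof -
    have Tv: "transpose_mat R *\<^sub>v v \<in> carrier_vec m" using T v by auto
    show ?thesis
      unfolding assoc_mult_mat_vec[OF R T v] by (rule scalar_prod_mult_mat_vec[OF R v Tv])
  qed
qed

lemma add_diff_cancel_left_vec:
  fixes a b :: "real vec"
  assumes "a \<in> carrier_vec n" "b \<in> carrier_vec n"
  shows "a + b - a = b"
  using assms by (intro eq_vecI) auto

lemma Min_spectrum_form:
  assumes S: "symmetric_mat n M" and n: "n \<ge> 1"
  shows "\<exists>v \<in> carrier_vec n. v \<bullet> v > 0 \<and> v \<bullet> (M *\<^sub>v v) = Min (spectrum M) * (v \<bullet> v)"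
proof -
  have "eigenvalue M (Min (spectrum M))"
    using Min_in[OF rayleigh_bounds(1,2)[OF S n]] by (simp add: spectrum_def)
  from eigenvalue_form[OF symmetric_matD(1)[OF S] this] show ?thesis .
qed

section \<open>Block elimination\<close>

text \<open>The scaled problem. Of the spectra of \<open>E\<^sub>k\<close> and \<open>R\<^sub>k R\<^sub>k\<^sup>T\<close> only the bounds on
  quadratic forms matter, where \<open>v \<bullet> R\<^sub>k R\<^sub>k\<^sup>T v\<close> is written as the square of the norm of \<open>R\<^sub>k\<^sup>T v\<close>.\<close>
locale block_elimination =
  fixes N :: nat and n :: "nat \<Rightarrow> nat" and E R :: "nat \<Rightarrow> real mat"
    and aE bE aR bR :: "nat \<Rightarrow> real" and x :: real and C :: "nat \<Rightarrow> real set"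
  assumes n: "k \<le> N \<Longrightarrow> n k \<ge> 1"
    and E: "k \<le> N \<Longrightarrow> symmetric_mat (n k) (E k)"
    and R: "k < N \<Longrightarrow> R (Suc k) \<in> carrier_mat (n (Suc k)) (n k)"
    and E_form: "k \<le> N \<Longrightarrow> v \<in> carrier_vec (n k) \<Longrightarrow>
      aE k * (v \<bullet> v) \<le> v \<bullet> (E k *\<^sub>v v) \<and> v \<bullet> (E k *\<^sub>v v) \<le> bE k * (v \<bullet> v)"
    and R_form: "k < N \<Longrightarrow> v \<in> carrier_vec (n (Suc k)) \<Longrightarrow>
      aR (Suc k) * (v \<bullet> v) \<le> (transpose_mat (R (Suc k)) *\<^sub>v v) \<bullet> (transpose_mat (R (Suc k)) *\<^sub>v v) \<and>
      (transpose_mat (R (Suc k)) *\<^sub>v v) \<bullet> (transpose_mat (R (Suc k)) *\<^sub>v v) \<le> bR (Suc k) * (v \<bullet> v)"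
    and aR_pos: "k < N \<Longrightarrow> aR (Suc k) > 0"
    and sep: "separating N aE bE aR bR x C"
begin

abbreviation Dg :: "nat \<Rightarrow> real mat" where "Dg k \<equiv> (- 1) ^ k \<cdot>\<^sub>m E k"

fun schur :: "nat \<Rightarrow> real mat" where
  "schur 0 = shift_mat (n 0) x (Dg 0)"
| "schur (Suc k) = shift_mat (n (Suc k)) x (Dg (Suc k) + R (Suc k) * mat_inv (schur k) * transpose_mat (R (Suc k)))"

lemma Dg:
  assumes "k \<le> N"
  shows "symmetric_mat (n k) (Dg k)"
    and "v \<in> carrier_vec (n k) \<Longrightarrow> Dg k *\<^sub>v v = (- 1) ^ k \<cdot>\<^sub>v (E k *\<^sub>v v)"
    and "v \<in> carrier_vec (n k) \<Longrightarrow> v \<bullet> (Dg k *\<^sub>v v) = (- 1) ^ k * (v \<bullet> (E k *\<^sub>v v))"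
proof -
  note EC = symmetric_matD[OF E[OF assms]]
  have "transpose_mat (Dg k) = Dg k" by (subst (2) EC(2)[symmetric]) (rule eq_matI, auto)
  then show "symmetric_mat (n k) (Dg k)" using EC(1) by (auto simp: symmetric_mat_def)
  show *: "Dg k *\<^sub>v v = (- 1) ^ k \<cdot>\<^sub>v (E k *\<^sub>v v)" if "v \<in> carrier_vec (n k)" for v
    by (rule smult_mat_mult_vec[OF EC(1) that])
  show "v \<bullet> (Dg k *\<^sub>v v) = (- 1) ^ k * (v \<bullet> (E k *\<^sub>v v))" if "v \<in> carrier_vec (n k)"
    unfolding *[OF that] using EC(1) that by simp
qed

lemma C_props:
  assumes "k \<le> N"
  shows "0 \<notin> C k" "p \<in> C k \<Longrightarrow> q \<in> C k \<Longrightarrow> p \<le> t \<Longrightarrow> t \<le> q \<Longrightarrow> t \<in> C k"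
proof -
  have "0 \<notin> C k \<and> (\<forall>p \<in> C k. \<forall>q \<in> C k. {p..q} \<subseteq> C k)"
    using sep assms unfolding separating_def by blast
  then show "0 \<notin> C k" "p \<in> C k \<Longrightarrow> q \<in> C k \<Longrightarrow> p \<le> t \<Longrightarrow> t \<le> q \<Longrightarrow> t \<in> C k"
    by (blast, meson atLeastAtMost_iff subsetD)
qed

lemma C_start: "g \<in> {aE 0..bE 0} \<Longrightarrow> x - g \<in> C 0"
  using sep unfolding separating_def by blast

lemma C_step:
  "k < N \<Longrightarrow> q \<in> C k \<Longrightarrow> g \<in> {aE (Suc k)..bE (Suc k)} \<Longrightarrow> r \<in> {aR (Suc k)..bR (Suc k)} \<Longrightarrow>
    x - (- 1) ^ Suc k * g - r / q \<in> C (Suc k)"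
  using sep unfolding separating_def by blast

lemma schur_injective_aux:
  assumes "k \<le> N" and S: "symmetric_mat (n k) M" and "spectrum M \<subseteq> C k"
    and v: "v \<in> carrier_vec (n k)" "M *\<^sub>v v = 0\<^sub>v (n k)"
  shows "v = 0\<^sub>v (n k)"
proof (rule ccontr)
  assume "v \<noteq> 0\<^sub>v (n k)"
  moreover have "M *\<^sub>v v = 0 \<cdot>\<^sub>v v" using v by auto
  ultimately have "eigenvalue M 0" using v(1) eigenvalue_iff[OF symmetric_matD(1)[OF S]] by blast
  then show False using assms(3) C_props(1)[OF \<open>k \<le> N\<close>] by (auto simp: spectrum_def)
qed

text \<open>The eigenvalues of the inverse are the reciprocals of points of \<open>C k\<close>. The extreme ones
  have the same sign, as the interval \<open>C k\<close> avoids \<open>0\<close>; inversion is monotone between them, so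
  the reciprocal of a Rayleigh quotient of the inverse lies in \<open>C k\<close> again.\<close>
lemma inverse_form:
  assumes k: "k \<le> N" and S: "symmetric_mat (n k) M" and spec: "spectrum M \<subseteq> C k"
    and w: "w \<in> carrier_vec (n k)" "w \<bullet> w > 0"
  shows "\<exists>q \<in> C k. w \<bullet> (mat_inv M *\<^sub>v w) = (w \<bullet> w) / q"
proof -
  note MC = symmetric_matD(1)[OF S]
  note inj = schur_injective_aux[OF k S spec]
  let ?G = "mat_inv M"
  have G: "symmetric_mat (n k) ?G" by (rule symmetric_mat_inv[OF S inj])
  note GC = symmetric_matD(1)[OF G]
  have inv: "\<exists>q \<in> C k. s = 1 / q" if s: "s \<in> spectrum ?G" for s
  proof -
    obtain v where v: "v \<in> carrier_vec (n k)" "v \<noteq> 0\<^sub>v (n k)" "?G *\<^sub>v v = s \<cdot>\<^sub>v v"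
      using s eigenvalue_iff[OF GC] by (auto simp: spectrum_def)
    have vs: "v = s \<cdot>\<^sub>v (M *\<^sub>v v)"
      using mat_inv_mult_vec(2)[OF MC inj v(1)] v(3) mult_mat_vec[OF MC v(1)] by simp
    have "s \<noteq> 0"
    proof
      assume "s = 0"
      then have "v = 0 \<cdot>\<^sub>v (M *\<^sub>v v)" using vs by simp
      also have "\<dots> = 0\<^sub>v (n k)" using MC v(1) by (intro eq_vecI) auto
      finally show False using v(2) by simp
    qed
    have "M *\<^sub>v v = (1 / s) \<cdot>\<^sub>v v"
      by (subst (2) vs) (use \<open>s \<noteq> 0\<close> MC v(1) in \<open>simp add: smult_smult_assoc\<close>)
    then have "1 / s \<in> spectrum M" using v eigenvalue_iff[OF MC] by (auto simp: spectrum_def)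
    then show ?thesis using spec \<open>s \<noteq> 0\<close> by (intro bexI[of _ "1 / s"]) auto
  qed
  note ray = rayleigh_bounds[OF G n[OF k]]
  obtain p q where p: "p \<in> C k" "Min (spectrum ?G) = 1 / p" and q: "q \<in> C k" "Max (spectrum ?G) = 1 / q"
    using inv[OF Min_in[OF ray(1,2)]] inv[OF Max_in[OF ray(1,2)]] by blast
  define t where "t = w \<bullet> (?G *\<^sub>v w) / (w \<bullet> w)"
  have t: "1 / p \<le> t" "t \<le> 1 / q"
    using ray(3,4)[OF w(1)] w(2) unfolding t_def p(2) q(2) by (simp_all add: field_simps)
  have pq: "p \<noteq> 0" "q \<noteq> 0" using p(1) q(1) C_props(1)[OF k] by auto
  have "\<not> (p \<le> 0 \<and> 0 \<le> q)" "\<not> (q \<le> 0 \<and> 0 \<le> p)"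
    using C_props(2)[OF k p(1) q(1), of 0] C_props(2)[OF k q(1) p(1), of 0] C_props(1)[OF k] by blast+
  then have "(p > 0 \<and> q > 0) \<or> (p < 0 \<and> q < 0)" using pq by linarith
  then have "1 / t \<in> C k \<and> t \<noteq> 0"
  proof
    assume pos: "p > 0 \<and> q > 0"
    then have "1 / p > 0" by simp
    with t(1) have "t > 0" by linarith
    have "q \<le> 1 / t" "1 / t \<le> p" using t pos \<open>t > 0\<close> by (simp_all add: field_simps)
    then show ?thesis using C_props(2)[OF k q(1) p(1)] \<open>t > 0\<close> by simp
  next
    assume neg: "p < 0 \<and> q < 0"
    then have "1 / q < 0" by simp
    with t(2) have "t < 0" by linarith
    have "q \<le> 1 / t" "1 / t \<le> p" using t neg \<open>t < 0\<close> by (simp_all add: field_simps)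
    then show ?thesis using C_props(2)[OF k q(1) p(1)] \<open>t < 0\<close> by simp
  qed
  moreover have "w \<bullet> (?G *\<^sub>v w) = (w \<bullet> w) / (1 / t)" using w(2) by (simp add: t_def)
  ultimately show ?thesis by blast
qed

lemma E_quotient:
  assumes "k \<le> N" "v \<in> carrier_vec (n k)" "v \<bullet> v > 0"
  shows "\<exists>g \<in> {aE k..bE k}. v \<bullet> (E k *\<^sub>v v) = g * (v \<bullet> v)"
  using E_form[OF assms(1,2)] assms(3)
  by (intro bexI[of _ "v \<bullet> (E k *\<^sub>v v) / (v \<bullet> v)"]) (auto simp: field_simps)

text \<open>Evaluate the quadratic form of \<open>Q\<^sub>k\<^sub>+\<^sub>1\<close> at an eigenvector \<open>v\<close>. The diagonal block contributes
  a parameter \<open>g\<close> and, with \<open>w = R\<^sub>k\<^sub>+\<^sub>1\<^sup>T v\<close>, the remaining term contributes \<open>r / q\<close>, where \<open>r\<close> is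
  the quotient of the squared norms of \<open>w\<close> and \<open>v\<close> and \<open>q \<in> C k\<close> comes from the quadratic form
  of the inverse at \<open>w\<close>. So the eigenvalue is one admissible step of the scalar recursion.\<close>
lemma schur_spectrum:
  assumes "k \<le> N"
  shows "symmetric_mat (n k) (schur k) \<and> spectrum (schur k) \<subseteq> C k"
  using assms
proof (induction k)
  case 0
  note D0 = Dg[OF 0]
  note sh = shift_mat[OF D0(1), where x = x]
  have "mu \<in> C 0" if "mu \<in> spectrum (schur 0)" for mu
  proof -
    have "eigenvalue (shift_mat (n 0) x (Dg 0)) mu" using that by (simp add: spectrum_def)
    from eigenvalue_form[OF symmetric_matD(1)[OF sh(1)] this]
    obtain v where v: "v \<in> carrier_vec (n 0)" "v \<bullet> v > 0"
      "v \<bullet> (shift_mat (n 0) x (Dg 0) *\<^sub>v v) = mu * (v \<bullet> v)" by blast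
    obtain g where g: "g \<in> {aE 0..bE 0}" "v \<bullet> (E 0 *\<^sub>v v) = g * (v \<bullet> v)"
      using E_quotient[OF 0 v(1,2)] by blast
    have "mu * (v \<bullet> v) = (x - g) * (v \<bullet> v)"
      using v(3) sh(3)[OF v(1)] D0(3)[OF v(1)] g(2) by (simp add: algebra_simps)
    then have "mu = x - g" using v(2) by simp
    then show ?thesis using C_start[OF g(1)] by simp
  qed
  then show ?case using sh(1) by auto
next
  case (Suc k)
  then have k: "k \<le> N" "k < N" by auto
  with Suc.IH have S: "symmetric_mat (n k) (schur k)" and spec: "spectrum (schur k) \<subseteq> C k" by auto
  let ?G = "mat_inv (schur k)" and ?R = "R (Suc k)" and ?T = "transpose_mat (R (Suc k))" and ?m = "n (Suc k)"
  have G: "symmetric_mat (n k) ?G" by (rule symmetric_mat_inv[OF S schur_injective_aux[OF k(1) S spec]])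
  note GC = symmetric_matD[OF G]
  note RC = R[OF k(2)]
  have TC: "?T \<in> carrier_mat (n k) ?m" using RC by simp
  have RG: "?R * ?G \<in> carrier_mat ?m (n k)" using RC GC by auto
  note D = Dg[OF Suc.prems]
  note DC = symmetric_matD[OF D(1)]
  have RGT: "?R * ?G * ?T \<in> carrier_mat ?m ?m" using RG TC by auto
  have sym: "symmetric_mat ?m (Dg (Suc k) + ?R * ?G * ?T)"
    by (rule symmetric_mat_add[OF D(1) symmetric_congruence[OF RC G]])
  note sh = shift_mat[OF sym, where x = x]
  have "mu \<in> C (Suc k)" if "mu \<in> spectrum (schur (Suc k))" for mu
  proof -
    have "eigenvalue (schur (Suc k)) mu" using that by (simp add: spectrum_def)
    from eigenvalue_form[OF _ this] sh(1)
    obtain v where v: "v \<in> carrier_vec ?m" "v \<bullet> v > 0" "v \<bullet> (schur (Suc k) *\<^sub>v v) = mu * (v \<bullet> v)"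
      by (metis schur.simps(2) symmetric_matD(1))
    obtain g where g: "g \<in> {aE (Suc k)..bE (Suc k)}" "v \<bullet> (E (Suc k) *\<^sub>v v) = g * (v \<bullet> v)"
      using E_quotient[OF Suc.prems v(1,2)] by blast
    let ?w = "?T *\<^sub>v v"
    have w: "?w \<in> carrier_vec (n k)" using TC v(1) by auto
    define r where "r = (?w \<bullet> ?w) / (v \<bullet> v)"
    have rw: "?w \<bullet> ?w = r * (v \<bullet> v)" using v(2) by (simp add: r_def)
    have r: "r \<in> {aR (Suc k)..bR (Suc k)}"
      using R_form[OF k(2) v(1)] v(2) by (simp add: r_def field_simps)
    then have "r > 0" using aR_pos[OF k(2)] by auto
    then have "?w \<bullet> ?w > 0" unfolding rw using v(2) by simp
    then obtain q where q: "q \<in> C k" "?w \<bullet> (?G *\<^sub>v ?w) = (?w \<bullet> ?w) / q"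
      using inverse_form[OF k(1) S spec w] by blast
    have Gw: "?G *\<^sub>v ?w \<in> carrier_vec (n k)" using GC w by auto
    have "v \<bullet> ((?R * ?G * ?T) *\<^sub>v v) = v \<bullet> (?R *\<^sub>v (?G *\<^sub>v ?w))"
      using assoc_mult_mat_vec[OF RG TC v(1)] assoc_mult_mat_vec[OF RC GC(1) w] by simp
    also have "\<dots> = ?w \<bullet> (?G *\<^sub>v ?w)" by (rule scalar_prod_mult_mat_vec[OF RC v(1) Gw])
    finally have RGTv: "v \<bullet> ((?R * ?G * ?T) *\<^sub>v v) = r / q * (v \<bullet> v)" unfolding q(2) rw by simp
    have "v \<bullet> ((Dg (Suc k) + ?R * ?G * ?T) *\<^sub>v v) = v \<bullet> (Dg (Suc k) *\<^sub>v v) + v \<bullet> ((?R * ?G * ?T) *\<^sub>v v)"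
      unfolding add_mult_distrib_mat_vec[OF DC(1) RGT v(1)]
      by (rule scalar_prod_add_distrib[of _ ?m]) (use v(1) DC(1) RGT in auto)
    then have "mu * (v \<bullet> v) = (x - (- 1) ^ Suc k * g - r / q) * (v \<bullet> v)"
      using v(3) sh(3)[OF v(1)] D(3)[OF v(1)] g(2) RGTv by (simp add: algebra_simps)
    then have "mu = x - (- 1) ^ Suc k * g - r / q" using v(2) by simp
    then show ?thesis using C_step[OF k(2) q(1) g(1) r] by simp
  qed
  then show ?case using sh(1) by auto
qed

lemma schur_injective:
  assumes "k \<le> N" "v \<in> carrier_vec (n k)" "schur k *\<^sub>v v = 0\<^sub>v (n k)"
  shows "v = 0\<^sub>v (n k)"
  using schur_injective_aux[OF assms(1)] schur_spectrum[OF assms(1)] assms(2,3) by blast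

text \<open>Forward elimination turns the block equations into \<open>Q\<^sub>k y\<^sub>k = R\<^sub>k\<^sub>+\<^sub>1\<^sup>T y\<^sub>k\<^sub>+\<^sub>1\<close> and
  \<open>Q\<^sub>N y\<^sub>N = 0\<close>; back substitution then uses that every \<open>Q\<^sub>k\<close> is injective.\<close>
lemma trivial_solution:
  assumes y: "\<And>k. k \<le> N \<Longrightarrow> y k \<in> carrier_vec (n k)"
    and eq: "\<And>k. k \<le> N \<Longrightarrow>
      Dg k *\<^sub>v y k + (if k = 0 then 0\<^sub>v (n k) else R k *\<^sub>v y (k - 1)) +
      (if k < N then transpose_mat (R (Suc k)) *\<^sub>v y (Suc k) else 0\<^sub>v (n k)) = x \<cdot>\<^sub>v y k"
    and "k \<le> N"
  shows "y k = 0\<^sub>v (n k)"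
proof -
  let ?f = "\<lambda>k. if k < N then transpose_mat (R (Suc k)) *\<^sub>v y (Suc k) else 0\<^sub>v (n k)"
  have f: "?f k \<in> carrier_vec (n k)" if "k \<le> N" for k
    using R[of k] y[of "Suc k"] by auto
  have elim: "schur k *\<^sub>v y k = ?f k" if "k \<le> N" for k
    using that
  proof (induction k)
    case 0
    note D = Dg[OF 0]
    have Dy: "Dg 0 *\<^sub>v y 0 \<in> carrier_vec (n 0)" using symmetric_matD(1)[OF D(1)] y[OF 0] by auto
    have "schur 0 *\<^sub>v y 0 = x \<cdot>\<^sub>v y 0 - Dg 0 *\<^sub>v y 0"
      using shift_mat(2)[OF D(1) y[OF 0]] by simp
    also have "x \<cdot>\<^sub>v y 0 = Dg 0 *\<^sub>v y 0 + ?f 0"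
      using eq[OF 0] Dy by simp
    also have "\<dots> - Dg 0 *\<^sub>v y 0 = ?f 0"
      by (rule add_diff_cancel_left_vec[OF Dy f[OF 0]])
    finally show ?case .
  next
    case (Suc k)
    then have k: "k \<le> N" "k < N" by auto
    let ?G = "mat_inv (schur k)" and ?R = "R (Suc k)" and ?T = "transpose_mat (R (Suc k))" and ?m = "n (Suc k)"
    have S: "symmetric_mat (n k) (schur k)" using schur_spectrum[OF k(1)] by blast
    note inj = schur_injective[OF k(1)]
    have G: "?G \<in> carrier_mat (n k) (n k)" by (rule mat_inv(1)[OF symmetric_matD(1)[OF S] inj])
    note RC = R[OF k(2)]
    have TC: "?T \<in> carrier_mat (n k) ?m" using RC by simp
    have RG: "?R * ?G \<in> carrier_mat ?m (n k)" using RC G by auto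
    have RGT: "?R * ?G * ?T \<in> carrier_mat ?m ?m" using RG TC by auto
    note D = Dg[OF Suc.prems]
    note DC = symmetric_matD(1)[OF D(1)]
    note ys = y[OF Suc.prems]
    have Ty: "?T *\<^sub>v y (Suc k) \<in> carrier_vec (n k)" using TC ys by auto
    have "y k = ?G *\<^sub>v (schur k *\<^sub>v y k)"
      using mat_inv_mult_vec(1)[OF symmetric_matD(1)[OF S] inj y[OF k(1)]] by simp
    also have "\<dots> = ?G *\<^sub>v (?T *\<^sub>v y (Suc k))" using Suc.IH[OF k(1)] k(2) by simp
    finally have "?R *\<^sub>v y k = (?R * ?G * ?T) *\<^sub>v y (Suc k)"
      using assoc_mult_mat_vec[OF RG TC ys] assoc_mult_mat_vec[OF RC G Ty] by simp
    then have "(Dg (Suc k) + ?R * ?G * ?T) *\<^sub>v y (Suc k) = Dg (Suc k) *\<^sub>v y (Suc k) + ?R *\<^sub>v y k"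
      using add_mult_distrib_mat_vec[OF DC RGT ys] by simp
    moreover have "symmetric_mat ?m (Dg (Suc k) + ?R * ?G * ?T)"
      by (rule symmetric_mat_add[OF D(1) symmetric_congruence[OF RC symmetric_mat_inv[OF S inj]]])
    ultimately have "schur (Suc k) *\<^sub>v y (Suc k) =
        x \<cdot>\<^sub>v y (Suc k) - (Dg (Suc k) *\<^sub>v y (Suc k) + ?R *\<^sub>v y k)"
      using shift_mat(2)[OF _ ys, where x = x] by simp
    also have "\<dots> = ?f (Suc k)"
    proof -
      let ?d = "Dg (Suc k) *\<^sub>v y (Suc k) + ?R *\<^sub>v y k"
      have Dy: "Dg (Suc k) *\<^sub>v y (Suc k) \<in> carrier_vec ?m" using DC ys by auto
      have Ry: "?R *\<^sub>v y k \<in> carrier_vec ?m" using RC y[OF k(1)] by auto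
      have "x \<cdot>\<^sub>v y (Suc k) = ?d + ?f (Suc k)"
        unfolding eq[OF Suc.prems, symmetric] by simp
      then show ?thesis
        using add_diff_cancel_left_vec[OF add_carrier_vec[OF Dy Ry] f[OF Suc.prems]] by (simp only:)
    qed
    finally show ?case .
  qed
  show ?thesis using \<open>k \<le> N\<close>
  proof (induction rule: inc_induct)
    case base
    show ?case using elim[of N] by (intro schur_injective[OF order_refl y[OF order_refl]]) simp
  next
    case (step k)
    have "transpose_mat (R (Suc k)) *\<^sub>v y (Suc k) = 0\<^sub>v (n k)"
      unfolding step.IH using R[of k] step.hyps by (intro eq_vecI) auto
    then have "schur k *\<^sub>v y k = 0\<^sub>v (n k)" using elim[of k] step.hyps by simp
    then show ?case using step.hyps by (intro schur_injective[OF _ y]) simp_all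
  qed
qed

end

section \<open>Block vectors and block tridiagonal matrices\<close>

text \<open>The position at which block \<open>k\<close> starts when blocks of sizes \<open>n 0, n 1, \<dots>\<close> are
  stacked; correspondingly \<open>cat_vec X k\<close> stacks the \<open>k\<close> blocks before block \<open>k\<close>.\<close>
definition offset :: "(nat \<Rightarrow> nat) \<Rightarrow> nat \<Rightarrow> nat" where
  "offset n k = (\<Sum>j<k. n j)"

lemma offset_simps [simp]: "offset n 0 = 0" "offset n (Suc k) = offset n k + n k"
  by (simp_all add: offset_def)

fun cat_vec :: "(nat \<Rightarrow> real vec) \<Rightarrow> nat \<Rightarrow> real vec" where
  "cat_vec X 0 = 0\<^sub>v 0"
| "cat_vec X (Suc k) = cat_vec X k @\<^sub>v X k"

lemma cat_vec_carrier:
  "(\<And>j. j < k \<Longrightarrow> X j \<in> carrier_vec (n j)) \<Longrightarrow> cat_vec X k \<in> carrier_vec (offset n k)"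
  by (induction k) auto

lemma cat_vec_cong: "(\<And>j. j < k \<Longrightarrow> X j = Y j) \<Longrightarrow> cat_vec X k = cat_vec Y k"
  by (induction k) auto

lemma cat_vec_inject:
  assumes "cat_vec X k = cat_vec Y k"
    and "\<And>j. j < k \<Longrightarrow> X j \<in> carrier_vec (n j)" "\<And>j. j < k \<Longrightarrow> Y j \<in> carrier_vec (n j)" and "j < k"
  shows "X j = Y j"
  using assms
proof (induction k)
  case (Suc k)
  have X: "cat_vec X k \<in> carrier_vec (offset n k)" and Y: "cat_vec Y k \<in> carrier_vec (offset n k)"
    using Suc.prems by (auto intro!: cat_vec_carrier)
  have "cat_vec X k = cat_vec Y k \<and> X k = Y k"
    using Suc.prems(1) append_vec_eq[OF X Y] by simp
  then show ?case using Suc.IH Suc.prems by (cases "j = k") auto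
qed simp

lemma cat_vec_exists:
  assumes "v \<in> carrier_vec (offset n k)"
  shows "\<exists>X. (\<forall>j. X j \<in> carrier_vec (n j)) \<and> v = cat_vec X k"
  using assms
proof (induction k arbitrary: v)
  case 0
  then show ?case by (intro exI[of _ "\<lambda>j. 0\<^sub>v (n j)"]) auto
next
  case (Suc k)
  have v: "vec_first v (offset n k) @\<^sub>v vec_last v (n k) = v"
    using Suc.prems by (intro vec_first_last_append) simp
  obtain X where X: "\<And>j. X j \<in> carrier_vec (n j)" "vec_first v (offset n k) = cat_vec X k"
    using Suc.IH[of "vec_first v (offset n k)"] by auto
  let ?X = "X(k := vec_last v (n k))"
  have "cat_vec ?X k = cat_vec X k" by (rule cat_vec_cong) simp
  then have "v = cat_vec ?X (Suc k)" using v X(2) by simp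
  moreover have "\<forall>j. ?X j \<in> carrier_vec (n j)" using X(1) by simp
  ultimately show ?case by blast
qed

lemma cat_vec_zero: "cat_vec (\<lambda>j. 0\<^sub>v (n j)) k = 0\<^sub>v (offset n k)"
  by (induction k) (auto intro!: eq_vecI)

lemma append_vec_add:
  fixes a b c d :: "real vec"
  assumes "a \<in> carrier_vec p" "c \<in> carrier_vec p" "b \<in> carrier_vec q" "d \<in> carrier_vec q"
  shows "(a @\<^sub>v b) + (c @\<^sub>v d) = (a + c) @\<^sub>v (b + d)"
  using assms by (intro eq_vecI) auto

lemma smult_append_vec:
  fixes a b :: "real vec"
  shows "c \<cdot>\<^sub>v (a @\<^sub>v b) = (c \<cdot>\<^sub>v a) @\<^sub>v (c \<cdot>\<^sub>v b)"
  by (intro eq_vecI) auto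

lemma smult_cat_vec: "c \<cdot>\<^sub>v cat_vec X k = cat_vec (\<lambda>j. c \<cdot>\<^sub>v X j) k"
  by (induction k) (auto simp: smult_append_vec)

lemma trailing_block_mult_vec:
  fixes L :: "real mat"
  assumes L: "L \<in> carrier_mat m q" and a: "a \<in> carrier_vec p" and b: "b \<in> carrier_vec q"
  shows "mat m (p + q) (\<lambda>(i, j). if j < p then 0 else L $$ (i, j - p)) *\<^sub>v (a @\<^sub>v b) = L *\<^sub>v b"
proof (rule eq_vecI)
  fix i assume i: "i < dim_vec (L *\<^sub>v b)"
  let ?M = "mat m (p + q) (\<lambda>(i, j). if j < p then 0 else L $$ (i, j - p))"
  have "row ?M i = 0\<^sub>v p @\<^sub>v row L i" using i L by (intro eq_vecI) auto
  then show "(?M *\<^sub>v (a @\<^sub>v b)) $ i = (L *\<^sub>v b) $ i"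
    using i L a b by (simp add: scalar_prod_append[of _ p _ q])
qed (use L in auto)

context
  fixes n :: "nat \<Rightarrow> nat" and D L U :: "nat \<Rightarrow> real mat" and N :: nat
  assumes D: "\<And>k. k \<le> N \<Longrightarrow> D k \<in> carrier_mat (n k) (n k)"
    and L: "\<And>k. k < N \<Longrightarrow> L (Suc k) \<in> carrier_mat (n (Suc k)) (n k)"
    and U: "\<And>k. k < N \<Longrightarrow> U (Suc k) \<in> carrier_mat (n k) (n (Suc k))"
begin

lemma block_tridiag_carrier:
  "k \<le> N \<Longrightarrow> block_tridiag D L U k \<in> carrier_mat (offset n (Suc k)) (offset n (Suc k))"
proof (induction k)
  case 0
  then show ?case using D[of 0] by simp
next
  case (Suc k)
  then have "block_tridiag D L U k \<in> carrier_mat (offset n (Suc k)) (offset n (Suc k))" by simp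
  then show ?case using D[OF Suc.prems]
    unfolding block_tridiag.simps Let_def offset_simps(2)[of n "Suc k"] by (rule four_block_carrier_mat)
qed

text \<open>The padding width that is computed from matrix dimensions in the definition is the start
  of the last but one block.\<close>
lemma block_tridiag_Suc:
  assumes k: "Suc k \<le> N"
  shows "block_tridiag D L U (Suc k) =
    four_block_mat (block_tridiag D L U k) (0\<^sub>m (offset n k) (n (Suc k)) @\<^sub>r U (Suc k))
      (mat (n (Suc k)) (offset n k + n k) (\<lambda>(i, j). if j < offset n k then 0 else L (Suc k) $$ (i, j - offset n k)))
      (D (Suc k))"
proof -
  have M: "block_tridiag D L U k \<in> carrier_mat (offset n (Suc k)) (offset n (Suc k))"
    using block_tridiag_carrier k by simp
  have "D k \<in> carrier_mat (n k) (n k)" using D k by simp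
  with M have "dim_row (block_tridiag D L U k) - dim_row (D k) = offset n k"
    "dim_col (block_tridiag D L U k) = offset n k + n k" by auto
  moreover have "dim_row (L (Suc k)) = n (Suc k)" "dim_col (U (Suc k)) = n (Suc k)"
    using L[of k] U[of k] k by auto
  ultimately show ?thesis by (simp only: block_tridiag.simps Let_def)
qed

lemma block_tridiag_mult_cat_vec:
  assumes "k \<le> N" and "\<And>j. X j \<in> carrier_vec (n j)"
  shows "block_tridiag D L U k *\<^sub>v cat_vec X (Suc k) =
    cat_vec (\<lambda>j. D j *\<^sub>v X j + (if j = 0 then 0\<^sub>v (n j) else L j *\<^sub>v X (j - 1)) +
                 (if j < k then U (Suc j) *\<^sub>v X (Suc j) else 0\<^sub>v (n j))) (Suc k)"
  using assms(1)
proof (induction k)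
  case 0
  have e: "(0\<^sub>v 0 :: real vec) @\<^sub>v v = v" for v by (intro eq_vecI) auto
  have "D 0 *\<^sub>v X 0 \<in> carrier_vec (n 0)" using D[of 0] assms(2)[of 0] by auto
  then show ?case by (simp add: e)
next
  case (Suc k)
  then have k: "k \<le> N" "k < N" by auto
  note X = assms(2)
  let ?M = "block_tridiag D L U k" and ?p = "offset n k" and ?m = "n (Suc k)" and ?x = "X (Suc k)"
  let ?F = "\<lambda>k j. D j *\<^sub>v X j + (if j = 0 then 0\<^sub>v (n j) else L j *\<^sub>v X (j - 1)) +
                 (if j < k then U (Suc j) *\<^sub>v X (Suc j) else 0\<^sub>v (n j))"
  have M: "?M \<in> carrier_mat (offset n (Suc k)) (offset n (Suc k))" by (rule block_tridiag_carrier[OF k(1)])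
  note Dk = D[OF Suc.prems] and Lk = L[OF k(2)] and Uk = U[OF k(2)]
  have DX: "D j *\<^sub>v X j \<in> carrier_vec (n j)" if "j \<le> N" for j using D[OF that] X[of j] by auto
  have LX: "(if j = 0 then 0\<^sub>v (n j) else L j *\<^sub>v X (j - 1)) \<in> carrier_vec (n j)" if "j \<le> N" for j
    using L[of "j - 1"] X[of "j - 1"] that by (cases j) auto
  have F: "?F i j \<in> carrier_vec (n j)" if "j \<le> N" "i \<le> N" for i j
    using DX[OF that(1)] LX[OF that(1)] U[of j] X[of "Suc j"] that by auto
  have cX: "cat_vec X j \<in> carrier_vec (offset n j)" for j by (rule cat_vec_carrier) (rule X)
  have Z: "(0\<^sub>m ?p ?m :: real mat) \<in> carrier_mat ?p ?m" by simp
  have Z0: "(0\<^sub>m ?p ?m :: real mat) *\<^sub>v ?x = 0\<^sub>v ?p" using X[of "Suc k"] by (intro eq_vecI) auto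
  have Ux: "U (Suc k) *\<^sub>v ?x \<in> carrier_vec (n k)" using Uk X[of "Suc k"] by auto
  have Lx: "L (Suc k) *\<^sub>v X k \<in> carrier_vec ?m" using Lk X[of k] by auto
  have cF: "cat_vec (?F k) k \<in> carrier_vec ?p" by (rule cat_vec_carrier, rule F) (use k in auto)
  have "block_tridiag D L U (Suc k) *\<^sub>v cat_vec X (Suc (Suc k)) =
      (?M *\<^sub>v cat_vec X (Suc k) + (0\<^sub>m ?p ?m @\<^sub>r U (Suc k)) *\<^sub>v ?x) @\<^sub>v
      (mat ?m (?p + n k) (\<lambda>(i, j). if j < ?p then 0 else L (Suc k) $$ (i, j - ?p)) *\<^sub>v cat_vec X (Suc k)
        + D (Suc k) *\<^sub>v ?x)"
    unfolding block_tridiag_Suc[OF Suc.prems] cat_vec.simps(2)[of X "Suc k"]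
    by (rule four_block_mat_mult_vec[OF M _ _ Dk])
      (use Uk X cX[of "Suc k"] Z in auto)
  also have "(0\<^sub>m ?p ?m @\<^sub>r U (Suc k)) *\<^sub>v ?x = 0\<^sub>v ?p @\<^sub>v (U (Suc k) *\<^sub>v ?x)"
    unfolding mat_mult_append[OF Z Uk X] Z0 ..
  also have "mat ?m (?p + n k) (\<lambda>(i, j). if j < ?p then 0 else L (Suc k) $$ (i, j - ?p)) *\<^sub>v cat_vec X (Suc k)
      = L (Suc k) *\<^sub>v X k"
    unfolding cat_vec.simps(2) by (rule trailing_block_mult_vec[OF Lk cX X])
  also have "?M *\<^sub>v cat_vec X (Suc k) + (0\<^sub>v ?p @\<^sub>v (U (Suc k) *\<^sub>v ?x)) =
      (cat_vec (?F k) k + 0\<^sub>v ?p) @\<^sub>v (?F k k + U (Suc k) *\<^sub>v ?x)"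
    unfolding Suc.IH[OF k(1)] cat_vec.simps(2)[of "?F k"]
    by (rule append_vec_add[OF cF _ F[OF k(1) k(1)] Ux]) simp
  also have "cat_vec (?F k) k + 0\<^sub>v ?p = cat_vec (?F (Suc k)) k"
  proof -
    have "cat_vec (?F k) k = cat_vec (?F (Suc k)) k" by (rule cat_vec_cong) simp
    then show ?thesis using cF by simp
  qed
  also have "?F k k + U (Suc k) *\<^sub>v ?x = ?F (Suc k) k"
    using DX[OF k(1)] LX[OF k(1)] Ux by auto
  also have "L (Suc k) *\<^sub>v X k + D (Suc k) *\<^sub>v ?x = ?F (Suc k) (Suc k)"
    using DX[OF Suc.prems] Lx by (auto intro: comm_add_vec)
  finally show ?case by simp
qed

lemma symmetric_block_tridiag:
  assumes sym: "\<And>k. k \<le> N \<Longrightarrow> transpose_mat (D k) = D k"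
    and UL: "\<And>k. k < N \<Longrightarrow> U (Suc k) = transpose_mat (L (Suc k))" and "k \<le> N"
  shows "symmetric_mat (offset n (Suc k)) (block_tridiag D L U k)"
  using \<open>k \<le> N\<close>
proof (induction k)
  case 0
  then show ?case using D[of 0] sym[of 0] by (simp add: symmetric_mat_def)
next
  case (Suc k)
  then have k: "k \<le> N" "k < N" by auto
  let ?p = "offset n k" and ?m = "n (Suc k)"
  let ?B = "0\<^sub>m ?p ?m @\<^sub>r U (Suc k)"
  let ?C = "mat ?m (?p + n k) (\<lambda>(i, j). if j < ?p then 0 else L (Suc k) $$ (i, j - ?p))"
  note M = symmetric_matD[OF Suc.IH[OF k(1)]]
  have B: "?B \<in> carrier_mat (offset n (Suc k)) ?m"
    using carrier_append_rows[of "0\<^sub>m ?p ?m" ?p ?m "U (Suc k)" "n k"] U[OF k(2)] by simp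
  have C: "?C \<in> carrier_mat ?m (offset n (Suc k))" by simp
  have CB: "transpose_mat ?C = ?B"
    unfolding UL[OF k(2)] append_rows_def using L[OF k(2)] by (intro eq_matI) auto
  have BC: "transpose_mat ?B = ?C"
    unfolding CB[symmetric] by (rule transpose_transpose)
  have "transpose_mat (block_tridiag D L U (Suc k)) = block_tridiag D L U (Suc k)"
    unfolding block_tridiag_Suc[OF Suc.prems]
    unfolding transpose_four_block_mat[OF M(1) B C D[OF Suc.prems]] M(2) sym[OF Suc.prems] CB BC ..
  then show ?case using block_tridiag_carrier[OF Suc.prems] by (simp add: symmetric_mat_def)
qed

end

lemma diag_block_mat_Suc:
  "diag_block_mat (map S [0..<Suc k]) =
     (let A = diag_block_mat (map S [0..<k])
      in four_block_mat A (0\<^sub>m (dim_row A) (dim_col (S k))) (0\<^sub>m (dim_row (S k)) (dim_col A)) (S k))"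
  by (simp add: diag_block_mat_last)

lemma diag_block_mat_mult_cat_vec:
  fixes S :: "nat \<Rightarrow> real mat"
  assumes S: "\<And>j. j < k \<Longrightarrow> S j \<in> carrier_mat (n j) (n j)" and X: "\<And>j. X j \<in> carrier_vec (n j)"
  shows "diag_block_mat (map S [0..<k]) \<in> carrier_mat (offset n k) (offset n k) \<and>
    diag_block_mat (map S [0..<k]) *\<^sub>v cat_vec X k = cat_vec (\<lambda>j. S j *\<^sub>v X j) k"
  using S
proof (induction k)
  case 0
  show ?case by (auto intro!: eq_vecI)
next
  case (Suc k)
  let ?P = "diag_block_mat (map S [0..<k])" and ?p = "offset n k"
  have P: "?P \<in> carrier_mat ?p ?p" and IH: "?P *\<^sub>v cat_vec X k = cat_vec (\<lambda>j. S j *\<^sub>v X j) k"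
    using Suc by auto
  have Sk: "S k \<in> carrier_mat (n k) (n k)" using Suc.prems by simp
  have eq: "diag_block_mat (map S [0..<Suc k]) = four_block_mat ?P (0\<^sub>m ?p (n k)) (0\<^sub>m (n k) ?p) (S k)"
    unfolding diag_block_mat_Suc Let_def using P Sk by simp
  have cX: "cat_vec X k \<in> carrier_vec ?p" by (rule cat_vec_carrier) (rule X)
  have z1: "(0\<^sub>m ?p (n k) :: real mat) *\<^sub>v X k = 0\<^sub>v ?p" using X[of k] by (intro eq_vecI) auto
  have z2: "(0\<^sub>m (n k) ?p :: real mat) *\<^sub>v cat_vec X k = 0\<^sub>v (n k)" using cX by (intro eq_vecI) auto
  have "diag_block_mat (map S [0..<Suc k]) *\<^sub>v cat_vec X (Suc k) =
      (?P *\<^sub>v cat_vec X k + 0\<^sub>m ?p (n k) *\<^sub>v X k) @\<^sub>v (0\<^sub>m (n k) ?p *\<^sub>v cat_vec X k + S k *\<^sub>v X k)"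
    unfolding eq cat_vec.simps(2) by (rule four_block_mat_mult_vec[OF P _ _ Sk cX X]) auto
  also have "\<dots> = cat_vec (\<lambda>j. S j *\<^sub>v X j) (Suc k)"
  proof -
    have "?P *\<^sub>v cat_vec X k \<in> carrier_vec ?p" "S k *\<^sub>v X k \<in> carrier_vec (n k)" using P cX Sk X[of k] by auto
    then show ?thesis unfolding z1 z2 by (simp add: IH)
  qed
  finally show ?case using four_block_carrier_mat[OF P Sk] unfolding eq by simp
qed

lemma cat_vec_scalar_prod:
  assumes "\<And>j. j < k \<Longrightarrow> X j \<in> carrier_vec (n j)" "\<And>j. j < k \<Longrightarrow> Y j \<in> carrier_vec (n j)"
  shows "cat_vec X k \<bullet> cat_vec Y k = (\<Sum>j<k. X j \<bullet> Y j)"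
  using assms
proof (induction k)
  case (Suc k)
  have "cat_vec X (Suc k) \<bullet> cat_vec Y (Suc k) = cat_vec X k \<bullet> cat_vec Y k + X k \<bullet> Y k"
    unfolding cat_vec.simps
    by (rule scalar_prod_append[of _ "offset n k" _ "n k"]) (use Suc.prems in \<open>auto intro!: cat_vec_carrier\<close>)
  then show ?case using Suc by simp
qed simp

lemma spd_diag_block_mat:
  assumes S: "\<And>j. j < k \<Longrightarrow> spd_mat (n j) (S j)"
  shows "spd_mat (offset n k) (diag_block_mat (map S [0..<k]))"
proof -
  have SC: "S j \<in> carrier_mat (n j) (n j)" if "j < k" for j using S[OF that] by (simp add: spd_mat_def)
  let ?P = "diag_block_mat (map S [0..<k])"
  note P = diag_block_mat_mult_cat_vec[of k S n, OF SC]
  have PC: "?P \<in> carrier_mat (offset n k) (offset n k)"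
    using P[of "\<lambda>j. 0\<^sub>v (n j)"] by simp
  have "transpose_mat ?P = ?P"
    using S
  proof (induction k)
    case 0
    show ?case by (intro eq_matI) auto
  next
    case (Suc k)
    have SC: "S j \<in> carrier_mat (n j) (n j)" if "j < Suc k" for j using Suc.prems[OF that] by (simp add: spd_mat_def)
    have P: "diag_block_mat (map S [0..<k]) \<in> carrier_mat (offset n k) (offset n k)"
      using diag_block_mat_mult_cat_vec[of k S n "\<lambda>j. 0\<^sub>v (n j)"] SC by simp
    have T: "transpose_mat (diag_block_mat (map S [0..<k])) = diag_block_mat (map S [0..<k])"
      using Suc by simp
    have Sk: "transpose_mat (S k) = S k" using Suc.prems[of k] by (simp add: spd_mat_def)
    show ?case
      unfolding diag_block_mat_Suc Let_def
      by (subst transpose_four_block_mat[OF P _ _ SC[of k]]) (use P SC[of k] T Sk in auto)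
  qed
  moreover have "v \<bullet> (?P *\<^sub>v v) > 0" if v: "v \<in> carrier_vec (offset n k)" "v \<noteq> 0\<^sub>v (offset n k)" for v
  proof -
    obtain X where X: "\<And>j. X j \<in> carrier_vec (n j)" "v = cat_vec X k" using cat_vec_exists[OF v(1)] by blast
    have SX: "S j *\<^sub>v X j \<in> carrier_vec (n j)" if "j < k" for j using SC[OF that] X(1)[of j] by auto
    have "v \<bullet> (?P *\<^sub>v v) = (\<Sum>j<k. X j \<bullet> (S j *\<^sub>v X j))"
      unfolding X(2) using P[OF _ X(1)] cat_vec_scalar_prod[of k X n "\<lambda>j. S j *\<^sub>v X j"] X(1) SX by simp
    also have "\<dots> > 0"
    proof -
      have nn: "X j \<bullet> (S j *\<^sub>v X j) \<ge> 0" if "j < k" for j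
        using spsd_matD(2)[OF spd_imp_spsd[OF S[OF that]] X(1)] .
      obtain i where i: "i < k" "X i \<noteq> 0\<^sub>v (n i)"
        using v(2) cat_vec_zero[of n k] cat_vec_cong[of k X "\<lambda>j. 0\<^sub>v (n j)"] X(2) by metis
      have "X i \<bullet> (S i *\<^sub>v X i) > 0" using S[OF i(1)] i(2) X(1)[of i] by (simp add: spd_mat_def)
      then show ?thesis using nn i(1) by (intro sum_pos2[of _ i]) auto
    qed
    finally show ?thesis .
  qed
  ultimately show ?thesis using PC by (simp add: spd_mat_def)
qed

section \<open>The preconditioned saddle point matrix\<close>

text \<open>Split an eigenvector \<open>w\<close> into real and imaginary parts \<open>u\<close>, \<open>v\<close> and compare \<open>v \<bullet> M u\<close> with
  \<open>u \<bullet> M v\<close>: their equality forces \<open>Im z (u \<bullet> P u + v \<bullet> P v) = 0\<close>. Thus \<open>z\<close> is real, and then \<open>u\<close>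
  and \<open>v\<close> solve the generalized eigenvalue equation separately.\<close>
lemma pencil_eigenvalue_real:
  assumes P: "spd_mat n P" and M: "symmetric_mat n M"
    and z: "eigenvalue (map_mat complex_of_real (mat_inv P * M)) z"
  shows "\<exists>x v. z = complex_of_real x \<and> v \<in> carrier_vec n \<and> v \<noteq> 0\<^sub>v n \<and> M *\<^sub>v v = x \<cdot>\<^sub>v (P *\<^sub>v v)"
proof -
  have PC: "P \<in> carrier_mat n n" and PS: "symmetric_mat n P"
    using P by (auto simp: spd_mat_def symmetric_mat_def)
  note MC = symmetric_matD(1)[OF M]
  note inj = spd_injective[OF P]
  note PI = mat_inv[OF PC inj]
  define T where "T = mat_inv P * M"
  have T: "T \<in> carrier_mat n n" using PI(1) MC by (auto simp: T_def)
  obtain w where w: "w \<in> carrier_vec n" "w \<noteq> 0\<^sub>v n" "map_mat complex_of_real T *\<^sub>v w = z \<cdot>\<^sub>v w"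
    using z T unfolding T_def[symmetric] eigenvalue_def eigenvector_def by auto
  define u v where "u = map_vec Re w" and "v = map_vec Im w"
  have u: "u \<in> carrier_vec n" and v: "v \<in> carrier_vec n" using w(1) by (auto simp: u_def v_def)
  let ?a = "Re z" and ?b = "Im z"
  have comp: "(\<Sum>j = 0..<n. complex_of_real (T $$ (i, j)) * w $ j) = z * w $ i" if i: "i < n" for i
  proof -
    have "(map_mat complex_of_real T *\<^sub>v w) $ i = (\<Sum>j = 0..<n. complex_of_real (T $$ (i, j)) * w $ j)"
      using i T w(1) by (simp add: scalar_prod_def)
    then show ?thesis using w(3) w(1) i by simp
  qed
  have Tu: "T *\<^sub>v u = ?a \<cdot>\<^sub>v u - ?b \<cdot>\<^sub>v v"
  proof (rule eq_vecI)
    fix i assume "i < dim_vec (?a \<cdot>\<^sub>v u - ?b \<cdot>\<^sub>v v)"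
    then have i: "i < n" using v by simp
    have "(T *\<^sub>v u) $ i = Re (\<Sum>j = 0..<n. complex_of_real (T $$ (i, j)) * w $ j)"
      using i T w(1) by (simp add: scalar_prod_def u_def)
    then show "(T *\<^sub>v u) $ i = (?a \<cdot>\<^sub>v u - ?b \<cdot>\<^sub>v v) $ i"
      unfolding comp[OF i] using i w(1) by (simp add: u_def v_def)
  qed (use T v in auto)
  have Tv: "T *\<^sub>v v = ?a \<cdot>\<^sub>v v + ?b \<cdot>\<^sub>v u"
  proof (rule eq_vecI)
    fix i assume "i < dim_vec (?a \<cdot>\<^sub>v v + ?b \<cdot>\<^sub>v u)"
    then have i: "i < n" using u by simp
    have "(T *\<^sub>v v) $ i = Im (\<Sum>j = 0..<n. complex_of_real (T $$ (i, j)) * w $ j)"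
      using i T w(1) by (simp add: scalar_prod_def v_def)
    then show "(T *\<^sub>v v) $ i = (?a \<cdot>\<^sub>v v + ?b \<cdot>\<^sub>v u) $ i"
      unfolding comp[OF i] using i w(1) by (simp add: u_def v_def)
  qed (use T u in auto)
  have PT: "P *\<^sub>v (T *\<^sub>v x) = M *\<^sub>v x" if x: "x \<in> carrier_vec n" for x
  proof -
    have Mx: "M *\<^sub>v x \<in> carrier_vec n" using MC x by auto
    show ?thesis
      unfolding T_def
      using assoc_mult_mat_vec[OF PI(1) MC x] mat_inv_mult_vec(2)[OF PC inj Mx] by simp
  qed
  have Pu: "P *\<^sub>v u \<in> carrier_vec n" and Pv: "P *\<^sub>v v \<in> carrier_vec n" using PC u v by auto
  have Mu: "M *\<^sub>v u = ?a \<cdot>\<^sub>v (P *\<^sub>v u) - ?b \<cdot>\<^sub>v (P *\<^sub>v v)"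
    unfolding PT[OF u, symmetric] Tu using u v
    by (simp add: mult_minus_distrib_mat_vec[OF PC] mult_mat_vec[OF PC])
  have Mv: "M *\<^sub>v v = ?a \<cdot>\<^sub>v (P *\<^sub>v v) + ?b \<cdot>\<^sub>v (P *\<^sub>v u)"
    unfolding PT[OF v, symmetric] Tv using u v
    by (simp add: mult_add_distrib_mat_vec[OF PC] mult_mat_vec[OF PC])
  have "v \<bullet> (M *\<^sub>v u) = ?a * (v \<bullet> (P *\<^sub>v u)) - ?b * (v \<bullet> (P *\<^sub>v v))"
    unfolding Mu using v Pu Pv by (subst scalar_prod_minus_distrib[of _ n]) auto
  moreover have "u \<bullet> (M *\<^sub>v v) = ?a * (u \<bullet> (P *\<^sub>v v)) + ?b * (u \<bullet> (P *\<^sub>v u))"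
    unfolding Mv using u Pu Pv by (subst scalar_prod_add_distrib[of _ n]) auto
  ultimately have b: "?b * (u \<bullet> (P *\<^sub>v u) + v \<bullet> (P *\<^sub>v v)) = 0"
    using symmetric_form_commute[OF M u v] symmetric_form_commute[OF PS u v] by (simp add: algebra_simps)
  have ne: "u \<noteq> 0\<^sub>v n \<or> v \<noteq> 0\<^sub>v n"
  proof (rule ccontr)
    assume "\<not> ?thesis"
    then have zero: "map_vec Re w = 0\<^sub>v n" "map_vec Im w = 0\<^sub>v n" by (auto simp: u_def v_def)
    have "w $ i = 0" if i: "i < n" for i
      using arg_cong[OF zero(1), of "\<lambda>x. x $ i"] arg_cong[OF zero(2), of "\<lambda>x. x $ i"] i w(1)
      by (simp add: complex_eq_iff)
    then have "w = 0\<^sub>v n" using w(1) by (intro eq_vecI) auto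
    then show False using w(2) by simp
  qed
  have "u \<bullet> (P *\<^sub>v u) + v \<bullet> (P *\<^sub>v v) > 0"
    using ne P u v spsd_matD(2)[OF spd_imp_spsd[OF P] u] spsd_matD(2)[OF spd_imp_spsd[OF P] v]
    by (auto simp: spd_mat_def intro: add_pos_nonneg add_nonneg_pos)
  with b have b0: "?b = 0" by auto
  then have "z = complex_of_real ?a" by (simp add: complex_eq_iff)
  moreover have "M *\<^sub>v u = ?a \<cdot>\<^sub>v (P *\<^sub>v u)" unfolding Mu b0 using Pu Pv by (intro eq_vecI) auto
  moreover have "M *\<^sub>v v = ?a \<cdot>\<^sub>v (P *\<^sub>v v)" unfolding Mv b0 using Pu Pv by (intro eq_vecI) auto
  ultimately show ?thesis using ne u v by blast
qed

locale block_problem =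
  fixes N :: nat and n :: "nat \<Rightarrow> nat" and A B S :: "nat \<Rightarrow> real mat"
  assumes n_mono: "k < N \<Longrightarrow> n (Suc k) \<le> n k" and n_last: "n N \<ge> 1"
    and A_0: "spd_mat (n 0) (A 0)"
    and A_Suc: "1 \<le> k \<Longrightarrow> k \<le> N \<Longrightarrow> spsd_mat (n k) (A k)"
    and B_rank: "1 \<le> k \<Longrightarrow> k \<le> N \<Longrightarrow> full_rank (n k) (n (k - 1)) (B k)"
    and S: "k \<le> N \<Longrightarrow> spd_mat (n k) (S k)"
begin

lemma n_pos: "k \<le> N \<Longrightarrow> n k \<ge> 1"
proof (induction rule: inc_induct)
  case base
  show ?case by (rule n_last)
next
  case (step k)
  then show ?case using n_mono[of k] by simp
qed

lemma A: "k \<le> N \<Longrightarrow> spsd_mat (n k) (A k)"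
  using spd_imp_spsd[OF A_0] A_Suc[of k] by (cases "k = 0") auto

lemma B: "k < N \<Longrightarrow> B (Suc k) \<in> carrier_mat (n (Suc k)) (n k)"
  using B_rank[of "Suc k"] by (simp add: full_rank_def)

text \<open>This is where the block sizes being nonincreasing enters: full rank is then full row rank.\<close>
lemma Bt_injective:
  assumes "k < N" "v \<in> carrier_vec (n (Suc k))" "transpose_mat (B (Suc k)) *\<^sub>v v = 0\<^sub>v (n k)"
  shows "v = 0\<^sub>v (n (Suc k))"
proof (rule full_row_rank_transpose_injective[OF B[OF assms(1)] _ assms(2,3)])
  show "vec_space.rank (n (Suc k)) (B (Suc k)) = n (Suc k)"
    using B_rank[of "Suc k"] n_mono[OF assms(1)] assms(1) by (simp add: full_rank_def)
qed

abbreviation "E \<equiv> E_mat A S"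
abbreviation "R \<equiv> R_mat B S"

lemma E:
  assumes "k \<le> N"
  shows "symmetric_mat (n k) (E k)"
    and "v \<in> carrier_vec (n k) \<Longrightarrow> E k *\<^sub>v v = inv_sqrt (S k) *\<^sub>v (A k *\<^sub>v (inv_sqrt (S k) *\<^sub>v v))"
    and "v \<in> carrier_vec (n k) \<Longrightarrow>
      v \<bullet> (E k *\<^sub>v v) = (inv_sqrt (S k) *\<^sub>v v) \<bullet> (A k *\<^sub>v (inv_sqrt (S k) *\<^sub>v v))"
  using E_mat[where S = S and A = A and k = k, OF S[OF assms] spsd_matD(1)[OF A[OF assms]]] by blast+

lemma R:
  assumes "k < N"
  shows "R (Suc k) \<in> carrier_mat (n (Suc k)) (n k)"
    and "v \<in> carrier_vec (n k) \<Longrightarrow>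
      R (Suc k) *\<^sub>v v = inv_sqrt (S (Suc k)) *\<^sub>v (B (Suc k) *\<^sub>v (inv_sqrt (S k) *\<^sub>v v))"
    and "w \<in> carrier_vec (n (Suc k)) \<Longrightarrow> transpose_mat (R (Suc k)) *\<^sub>v w =
      inv_sqrt (S k) *\<^sub>v (transpose_mat (B (Suc k)) *\<^sub>v (inv_sqrt (S (Suc k)) *\<^sub>v w))"
proof -
  have S1: "spd_mat (n (Suc k)) (S (Suc k))" and S0: "spd_mat (n k) (S (Suc k - 1))"
    using S[of "Suc k"] S[of k] assms by auto
  note r = R_mat[where S = S and B = B and k = "Suc k", OF S1 S0 B[OF assms]]
  show "R (Suc k) \<in> carrier_mat (n (Suc k)) (n k)" by (rule r(1))
  show "v \<in> carrier_vec (n k) \<Longrightarrow>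
      R (Suc k) *\<^sub>v v = inv_sqrt (S (Suc k)) *\<^sub>v (B (Suc k) *\<^sub>v (inv_sqrt (S k) *\<^sub>v v))"
    using r(2)[of v] by simp
  show "w \<in> carrier_vec (n (Suc k)) \<Longrightarrow> transpose_mat (R (Suc k)) *\<^sub>v w =
      inv_sqrt (S k) *\<^sub>v (transpose_mat (B (Suc k)) *\<^sub>v (inv_sqrt (S (Suc k)) *\<^sub>v w))"
    using r(3)[of w] by simp
qed

lemma inv_sqrt_carrier:
  assumes "k \<le> N" "v \<in> carrier_vec (n k)"
  shows "inv_sqrt (S k) *\<^sub>v v \<in> carrier_vec (n k)"
  using symmetric_matD(1)[OF inv_sqrt(1)[OF S[OF assms(1)]]] assms(2) by auto

lemma inv_sqrt_injective:
  assumes k: "k \<le> N" and v: "v \<in> carrier_vec (n k)" and zero: "inv_sqrt (S k) *\<^sub>v v = 0\<^sub>v (n k)"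
  shows "v = 0\<^sub>v (n k)"
proof -
  have X: "spd_sqrt (S k) \<in> carrier_mat (n k) (n k)" using spd_sqrt(1)[OF S[OF k]] by (simp add: spd_mat_def)
  have "v = spd_sqrt (S k) *\<^sub>v 0\<^sub>v (n k)" using inv_sqrt(3)[OF S[OF k] v] zero by simp
  also have "\<dots> = 0\<^sub>v (n k)" using X by (intro eq_vecI) auto
  finally show ?thesis .
qed

lemma Rt_injective:
  assumes k: "k < N" and v: "v \<in> carrier_vec (n (Suc k))" and zero: "transpose_mat (R (Suc k)) *\<^sub>v v = 0\<^sub>v (n k)"
  shows "v = 0\<^sub>v (n (Suc k))"
proof -
  have Zv: "inv_sqrt (S (Suc k)) *\<^sub>v v \<in> carrier_vec (n (Suc k))" using k v by (intro inv_sqrt_carrier) auto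
  have BZv: "transpose_mat (B (Suc k)) *\<^sub>v (inv_sqrt (S (Suc k)) *\<^sub>v v) \<in> carrier_vec (n k)"
    using B[OF k] Zv by auto
  have "transpose_mat (B (Suc k)) *\<^sub>v (inv_sqrt (S (Suc k)) *\<^sub>v v) = 0\<^sub>v (n k)"
    by (rule inv_sqrt_injective[OF _ BZv]) (use k zero R(3)[OF k v] in auto)
  then have "inv_sqrt (S (Suc k)) *\<^sub>v v = 0\<^sub>v (n (Suc k))" by (rule Bt_injective[OF k Zv])
  then show ?thesis by (rule inv_sqrt_injective[OF Suc_leI[OF k] v])
qed

lemma \<alpha>R_pos:
  assumes k: "k < N"
  shows "\<alpha>R B S (Suc k) > 0"
proof -
  note G = gram_mat[OF R(1)[OF k]]
  have "n (Suc k) \<ge> 1" using n_pos[of "Suc k"] k by simp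
  from Min_spectrum_form[OF G(1) this]
  obtain v where v: "v \<in> carrier_vec (n (Suc k))" "v \<bullet> v > 0"
    "v \<bullet> ((R (Suc k) * transpose_mat (R (Suc k))) *\<^sub>v v) = \<alpha>R B S (Suc k) * (v \<bullet> v)"
    unfolding \<alpha>R_def by blast
  let ?w = "transpose_mat (R (Suc k)) *\<^sub>v v"
  have w: "?w \<in> carrier_vec (n k)" using R(1)[OF k] v(1) by auto
  have "v \<noteq> 0\<^sub>v (n (Suc k))" using v(1,2) by auto
  then have "?w \<noteq> 0\<^sub>v (n k)" using Rt_injective[OF k v(1)] by blast
  then have "?w \<bullet> ?w > 0" by (rule scalar_prod_self_pos[OF w])
  then have "\<alpha>R B S (Suc k) * (v \<bullet> v) > 0" using v(3) G(2)[OF v(1)] by simp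
  then show ?thesis using v(2) by (simp add: zero_less_mult_iff)
qed

lemma \<alpha>E_nonneg:
  assumes k: "k \<le> N"
  shows "\<alpha>E A S k \<ge> 0" and "spd_mat (n k) (A k) \<Longrightarrow> \<alpha>E A S k > 0"
proof -
  obtain v where v: "v \<in> carrier_vec (n k)" "v \<bullet> v > 0" "v \<bullet> (E k *\<^sub>v v) = \<alpha>E A S k * (v \<bullet> v)"
    using Min_spectrum_form[OF E(1)[OF k] n_pos[OF k]] unfolding \<alpha>E_def by blast
  let ?z = "inv_sqrt (S k) *\<^sub>v v"
  have z: "?z \<in> carrier_vec (n k)" by (rule inv_sqrt_carrier[OF k v(1)])
  have eq: "\<alpha>E A S k * (v \<bullet> v) = ?z \<bullet> (A k *\<^sub>v ?z)" using v(3) E(3)[OF k v(1)] by simp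
  have "?z \<bullet> (A k *\<^sub>v ?z) \<ge> 0" by (rule spsd_matD(2)[OF A[OF k] z])
  then have "0 \<le> \<alpha>E A S k * (v \<bullet> v)" unfolding eq .
  then show "\<alpha>E A S k \<ge> 0" using v(2) by (metis mult_neg_pos not_le)
  show "\<alpha>E A S k > 0" if A: "spd_mat (n k) (A k)"
  proof -
    have "v \<noteq> 0\<^sub>v (n k)" using v(1,2) by auto
    then have "?z \<noteq> 0\<^sub>v (n k)" using inv_sqrt_injective[OF k v(1)] by blast
    then have "?z \<bullet> (A k *\<^sub>v ?z) > 0" using A z by (simp add: spd_mat_def)
    then show ?thesis using v(2) eq by (metis zero_less_mult_pos2)
  qed
qed

sublocale box: parameter_box N "\<alpha>E A S" "\<beta>E A S" "\<alpha>R B S" "\<beta>R B S"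
proof
  show "\<alpha>E A S 0 > 0" using \<alpha>E_nonneg(2)[of 0] A_0 by simp
  fix k
  show "\<alpha>E A S k \<ge> 0" if "k \<le> N" by (rule \<alpha>E_nonneg(1)[OF that])
  show "\<alpha>E A S k \<le> \<beta>E A S k" if k: "k \<le> N"
    unfolding \<alpha>E_def \<beta>E_def using rayleigh_bounds(1,2)[OF E(1)[OF k] n_pos[OF k]]
    by (meson Max_ge Min_in)
  assume "1 \<le> k" "k \<le> N"
  then obtain j where j: "k = Suc j" "j < N" by (cases k) auto
  show "\<alpha>R B S k > 0" unfolding j(1) by (rule \<alpha>R_pos[OF j(2)])
  show "\<alpha>R B S k \<le> \<beta>R B S k"
    unfolding \<alpha>R_def \<beta>R_def j(1)
    using rayleigh_bounds(1,2)[OF gram_mat(1)[OF R(1)[OF j(2)]] n_pos[of "Suc j"]] j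
    by (meson Max_ge Min_in Suc_leI)
qed

lemma block_eliminationI:
  assumes "separating N (\<alpha>E A S) (\<beta>E A S) (\<alpha>R B S) (\<beta>R B S) x C"
  shows "block_elimination N n E R (\<alpha>E A S) (\<beta>E A S) (\<alpha>R B S) (\<beta>R B S) x C"
proof
  fix k v
  show "n k \<ge> 1" if "k \<le> N" by (rule n_pos[OF that])
  show "symmetric_mat (n k) (E k)" if "k \<le> N" by (rule E(1)[OF that])
  show "\<alpha>E A S k * (v \<bullet> v) \<le> v \<bullet> (E k *\<^sub>v v) \<and> v \<bullet> (E k *\<^sub>v v) \<le> \<beta>E A S k * (v \<bullet> v)"
    if "k \<le> N" "v \<in> carrier_vec (n k)"
    unfolding \<alpha>E_def \<beta>E_def using rayleigh_bounds(3,4)[OF E(1)[OF that(1)] n_pos[OF that(1)] that(2)] by blast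
  assume k: "k < N"
  show "R (Suc k) \<in> carrier_mat (n (Suc k)) (n k)" by (rule R(1)[OF k])
  show "\<alpha>R B S (Suc k) > 0" by (rule \<alpha>R_pos[OF k])
  assume v: "v \<in> carrier_vec (n (Suc k))"
  have "n (Suc k) \<ge> 1" using n_pos[of "Suc k"] k by simp
  note ray = rayleigh_bounds(3,4)[OF gram_mat(1)[OF R(1)[OF k]] this v]
  show "\<alpha>R B S (Suc k) * (v \<bullet> v) \<le> (transpose_mat (R (Suc k)) *\<^sub>v v) \<bullet> (transpose_mat (R (Suc k)) *\<^sub>v v) \<and>
      (transpose_mat (R (Suc k)) *\<^sub>v v) \<bullet> (transpose_mat (R (Suc k)) *\<^sub>v v) \<le> \<beta>R B S (Suc k) * (v \<bullet> v)"
    unfolding \<alpha>R_def \<beta>R_def using ray unfolding gram_mat(2)[OF R(1)[OF k] v] by blast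
qed (rule assms)

abbreviation "total_dim \<equiv> offset n (Suc N)"

lemma precond_spd: "spd_mat total_dim (precond_mat S N)"
  unfolding precond_mat_def by (rule spd_diag_block_mat) (use S in simp)

lemma saddle_blocks:
  shows "k \<le> N \<Longrightarrow> (- 1) ^ k \<cdot>\<^sub>m A k \<in> carrier_mat (n k) (n k)"
    and "k \<le> N \<Longrightarrow> transpose_mat ((- 1) ^ k \<cdot>\<^sub>m A k) = (- 1) ^ k \<cdot>\<^sub>m A k"
    and "k < N \<Longrightarrow> transpose_mat (B (Suc k)) \<in> carrier_mat (n k) (n (Suc k))"
proof -
  show "(- 1) ^ k \<cdot>\<^sub>m A k \<in> carrier_mat (n k) (n k)" if "k \<le> N"
    using symmetric_matD(1)[OF spsd_matD(1)[OF A[OF that]]] by simp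
  show "transpose_mat ((- 1) ^ k \<cdot>\<^sub>m A k) = (- 1) ^ k \<cdot>\<^sub>m A k" if "k \<le> N"
    by (subst (2) symmetric_matD(2)[OF spsd_matD(1)[OF A[OF that]], symmetric]) (rule eq_matI, auto)
  show "transpose_mat (B (Suc k)) \<in> carrier_mat (n k) (n (Suc k))" if "k < N"
    using B[OF that] by simp
qed

lemma saddle_symmetric: "symmetric_mat total_dim (saddle_mat A B N)"
  unfolding saddle_mat_def
  by (rule symmetric_block_tridiag[where N = N]) (use saddle_blocks B in auto)

text \<open>In the variables \<open>y\<^sub>k = S\<^sub>k\<^sup>1\<^sup>/\<^sup>2 x\<^sub>k\<close>, multiplying block row \<open>k\<close> of the generalized eigenvalue
  equation by \<open>S\<^sub>k\<^sup>-\<^sup>1\<^sup>/\<^sup>2\<close> gives the scaled block equations.\<close>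
lemma separating_imp_trivial:
  assumes sep: "separating N (\<alpha>E A S) (\<beta>E A S) (\<alpha>R B S) (\<beta>R B S) x C"
    and v: "v \<in> carrier_vec total_dim" and eig: "saddle_mat A B N *\<^sub>v v = x \<cdot>\<^sub>v (precond_mat S N *\<^sub>v v)"
  shows "v = 0\<^sub>v total_dim"
proof -
  interpret el: block_elimination N n E R "\<alpha>E A S" "\<beta>E A S" "\<alpha>R B S" "\<beta>R B S" x C
    by (rule block_eliminationI[OF sep])
  obtain X where X: "\<And>j. X j \<in> carrier_vec (n j)" "v = cat_vec X (Suc N)" using cat_vec_exists[OF v] by blast
  let ?F = "\<lambda>j. ((- 1) ^ j \<cdot>\<^sub>m A j) *\<^sub>v X j + (if j = 0 then 0\<^sub>v (n j) else B j *\<^sub>v X (j - 1)) +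
                 (if j < N then transpose_mat (B (Suc j)) *\<^sub>v X (Suc j) else 0\<^sub>v (n j))"
  have AX: "((- 1) ^ j \<cdot>\<^sub>m A j) *\<^sub>v X j \<in> carrier_vec (n j)" if "j \<le> N" for j
    using saddle_blocks(1)[OF that] X(1)[of j] by auto
  have BX: "(if j = 0 then 0\<^sub>v (n j) else B j *\<^sub>v X (j - 1)) \<in> carrier_vec (n j)" if "j \<le> N" for j
    using B[of "j - 1"] X(1)[of "j - 1"] that by (cases j) auto
  have TX: "(if j < N then transpose_mat (B (Suc j)) *\<^sub>v X (Suc j) else 0\<^sub>v (n j)) \<in> carrier_vec (n j)" for j
    using saddle_blocks(3)[of j] X(1)[of "Suc j"] by auto
  have SX: "S j *\<^sub>v X j \<in> carrier_vec (n j)" if "j \<le> N" for j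
    using S[OF that] X(1)[of j] by (auto simp: spd_mat_def)
  have "saddle_mat A B N *\<^sub>v v = cat_vec ?F (Suc N)"
    unfolding saddle_mat_def X(2)
    by (rule block_tridiag_mult_cat_vec[where N = N]) (use saddle_blocks B X(1) in auto)
  moreover have "precond_mat S N *\<^sub>v v = cat_vec (\<lambda>j. S j *\<^sub>v X j) (Suc N)"
    unfolding precond_mat_def X(2)
    using diag_block_mat_mult_cat_vec[of "Suc N" S n X] S X(1) by (simp add: spd_mat_def)
  ultimately have cat: "cat_vec ?F (Suc N) = cat_vec (\<lambda>j. x \<cdot>\<^sub>v (S j *\<^sub>v X j)) (Suc N)"
    using eig smult_cat_vec[of x "\<lambda>j. S j *\<^sub>v X j" "Suc N"] by simp
  have F: "?F j = x \<cdot>\<^sub>v (S j *\<^sub>v X j)" if "j \<le> N" for j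
    by (rule cat_vec_inject[OF cat, where n = n]) (use AX BX TX SX that in auto)
  define y where "y = (\<lambda>j. spd_sqrt (S j) *\<^sub>v X j)"
  have y: "y j \<in> carrier_vec (n j)" if "j \<le> N" for j
    using spd_sqrt(1)[OF S[OF that]] X(1)[of j] by (auto simp: y_def spd_mat_def)
  have Zy: "inv_sqrt (S j) *\<^sub>v y j = X j" if "j \<le> N" for j
    unfolding y_def by (rule inv_sqrt(2)[OF S[OF that] X(1)])
  have yzero: "y j = 0\<^sub>v (n j)" if "j \<le> N" for j
  proof (rule el.trivial_solution[OF y _ that])
    fix k assume k: "k \<le> N"
    let ?Z = "inv_sqrt (S k)"
    have Z: "?Z \<in> carrier_mat (n k) (n k)" by (rule symmetric_matD(1)[OF inv_sqrt(1)[OF S[OF k]]])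
    have AXk: "A k *\<^sub>v X k \<in> carrier_vec (n k)"
      using symmetric_matD(1)[OF spsd_matD(1)[OF A[OF k]]] X(1)[of k] by auto
    have "((- 1) ^ k \<cdot>\<^sub>m E k) *\<^sub>v y k = ?Z *\<^sub>v (((- 1) ^ k \<cdot>\<^sub>m A k) *\<^sub>v X k)"
      unfolding smult_mat_mult_vec[OF symmetric_matD(1)[OF E(1)[OF k]] y[OF k]] E(2)[OF k y[OF k]] Zy[OF k]
        smult_mat_mult_vec[OF symmetric_matD(1)[OF spsd_matD(1)[OF A[OF k]]] X(1)] mult_mat_vec[OF Z AXk] ..
    moreover have "(if k = 0 then 0\<^sub>v (n k) else R k *\<^sub>v y (k - 1)) =
        ?Z *\<^sub>v (if k = 0 then 0\<^sub>v (n k) else B k *\<^sub>v X (k - 1))"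
    proof (cases k)
      case 0
      then show ?thesis using Z by (auto intro!: eq_vecI)
    next
      case (Suc j)
      then have "j < N" "j \<le> N" using k by auto
      then show ?thesis using R(2)[OF \<open>j < N\<close> y[OF \<open>j \<le> N\<close>]] Zy[OF \<open>j \<le> N\<close>] Suc by simp
    qed
    moreover have "(if k < N then transpose_mat (R (Suc k)) *\<^sub>v y (Suc k) else 0\<^sub>v (n k)) =
        ?Z *\<^sub>v (if k < N then transpose_mat (B (Suc k)) *\<^sub>v X (Suc k) else 0\<^sub>v (n k))"
    proof (cases "k < N")
      case True
      then show ?thesis using R(3)[OF True y[of "Suc k"]] Zy[of "Suc k"] by simp
    next
      case False
      then show ?thesis using Z by (auto intro!: eq_vecI)
    qed
    ultimately have "((- 1) ^ k \<cdot>\<^sub>m E k) *\<^sub>v y k + (if k = 0 then 0\<^sub>v (n k) else R k *\<^sub>v y (k - 1)) +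
        (if k < N then transpose_mat (R (Suc k)) *\<^sub>v y (Suc k) else 0\<^sub>v (n k)) = ?Z *\<^sub>v ?F k"
      using mult_add_distrib_mat_vec[OF Z AX[OF k] BX[OF k]]
        mult_add_distrib_mat_vec[OF Z add_carrier_vec[OF AX[OF k] BX[OF k]] TX[of k]] by (simp only:)
    also have "\<dots> = x \<cdot>\<^sub>v (?Z *\<^sub>v (S k *\<^sub>v X k))"
      unfolding F[OF k] by (rule mult_mat_vec[OF Z SX[OF k]])
    also have "?Z *\<^sub>v (S k *\<^sub>v X k) = y k"
      unfolding y_def by (rule inv_sqrt(4)[OF S[OF k] X(1)])
    finally show "((- 1) ^ k \<cdot>\<^sub>m E k) *\<^sub>v y k + (if k = 0 then 0\<^sub>v (n k) else R k *\<^sub>v y (k - 1)) +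
        (if k < N then transpose_mat (R (Suc k)) *\<^sub>v y (Suc k) else 0\<^sub>v (n k)) = x \<cdot>\<^sub>v y k" .
  qed
  have "X j = 0\<^sub>v (n j)" if "j \<le> N" for j
  proof -
    have "X j = inv_sqrt (S j) *\<^sub>v 0\<^sub>v (n j)" using Zy[OF that] yzero[OF that] by simp
    also have "\<dots> = 0\<^sub>v (n j)"
      using symmetric_matD(1)[OF inv_sqrt(1)[OF S[OF that]]] by (intro eq_vecI) auto
    finally show ?thesis .
  qed
  then have "cat_vec X (Suc N) = cat_vec (\<lambda>j. 0\<^sub>v (n j)) (Suc N)" by (intro cat_vec_cong) simp
  then show ?thesis unfolding X(2) cat_vec_zero .
qed

lemma eigenvalue_not_separated:
  assumes "eigenvalue (map_mat complex_of_real (mat_inv (precond_mat S N) * saddle_mat A B N)) z"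
  shows "\<exists>x. z = complex_of_real x \<and> (\<nexists>C. separating N (\<alpha>E A S) (\<beta>E A S) (\<alpha>R B S) (\<beta>R B S) x C)"
proof -
  obtain x v where "z = complex_of_real x" "v \<in> carrier_vec total_dim" "v \<noteq> 0\<^sub>v total_dim"
    "saddle_mat A B N *\<^sub>v v = x \<cdot>\<^sub>v (precond_mat S N *\<^sub>v v)"
    using pencil_eigenvalue_real[OF precond_spd saddle_symmetric assms] by blast
  then show ?thesis using separating_imp_trivial[of x _ v] by blast
qed

lemma admissible_params_iff: "admissible_params N A B S = box.admissible"
  unfolding admissible_params_def box.admissible_def by (intro ext) simp

lemma \<mu>_eqs:
  "\<mu>_neg_LB N A B S = \<xi>_min (box.U box.gE_lo (\<beta>R B S) (N + 1))"
  "\<mu>_pos_UB N A B S = \<xi>_max (box.U box.gE_up (\<beta>R B S) (N + 1))"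
  "\<mu>_neg_UB N A B S = box.gap_left"
  "\<mu>_pos_LB N A B S = box.gap_right"
  unfolding \<mu>_neg_LB_def \<mu>_pos_UB_def \<mu>_neg_UB_def \<mu>_pos_LB_def U_poly_eq_jacobi_poly
    box.gE_lo_def box.gE_up_def box.gR_lo_def box.gR_up_def by simp_all

end

theorem mainTheorem3:
  fixes N :: nat and n :: "nat \<Rightarrow> nat" and A B S :: "nat \<Rightarrow> real mat"
  assumes "N \<ge> 1"
    and "\<forall>k < N. n (Suc k) \<le> n k" and "n N \<ge> 1"
    and "spd_mat (n 0) (A 0)"
    and "\<forall>k \<in> {1..N}. spsd_mat (n k) (A k)"
    and "\<forall>k \<in> {1..N}. full_rank (n k) (n (k - 1)) (B k)"
    and "\<forall>k \<in> {0..N}. spd_mat (n k) (S k)"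
  shows "is_minimum (\<mu>_neg_LB N A B S)
           {\<xi>_min (U_poly \<gamma>E \<gamma>R (N + 1)) | \<gamma>E \<gamma>R. admissible_params N A B S \<gamma>E \<gamma>R}
       \<and> is_maximum (\<mu>_neg_UB N A B S)
           {\<xi>_neg (U_poly \<gamma>E \<gamma>R k) | k \<gamma>E \<gamma>R.
              even k \<and> 2 \<le> k \<and> k \<le> N + 1 \<and> admissible_params N A B S \<gamma>E \<gamma>R}
       \<and> is_minimum (\<mu>_pos_LB N A B S)
           {\<xi>_pos (U_poly \<gamma>E \<gamma>R k) | k \<gamma>E \<gamma>R.
              odd k \<and> 1 \<le> k \<and> k \<le> N + 1 \<and> admissible_params N A B S \<gamma>E \<gamma>R}
       \<and> is_maximum (\<mu>_pos_UB N A B S)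
           {\<xi>_max (U_poly \<gamma>E \<gamma>R (N + 1)) | \<gamma>E \<gamma>R. admissible_params N A B S \<gamma>E \<gamma>R}
       \<and> (\<forall>z :: complex.
            eigenvalue (map_mat complex_of_real (mat_inv (precond_mat S N) * saddle_mat A B N)) z
            \<longrightarrow> z \<in> complex_of_real ` ({\<mu>_neg_LB N A B S..\<mu>_neg_UB N A B S} \<union>
                                         {\<mu>_pos_LB N A B S..\<mu>_pos_UB N A B S}))"
proof -
  interpret block_problem N n A B S
    by unfold_locales (use assms in auto)
  have "z \<in> complex_of_real ` ({\<mu>_neg_LB N A B S..\<mu>_neg_UB N A B S} \<union> {\<mu>_pos_LB N A B S..\<mu>_pos_UB N A B S})"
    if "eigenvalue (map_mat complex_of_real (mat_inv (precond_mat S N) * saddle_mat A B N)) z" for z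
    using eigenvalue_not_separated[OF that] box.nonseparating_bounds unfolding \<mu>_eqs by blast
  then show ?thesis
    using box.\<xi>_min_minimum box.\<xi>_neg_maximum[OF assms(1)] box.\<xi>_pos_minimum box.\<xi>_max_maximum
    unfolding \<mu>_eqs U_poly_eq_jacobi_poly admissible_params_iff by blast
qed

end
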